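(* Let $(K,v)$ be a valued field, fix any extension of $v$ to the algebraic closure $\tilde K$, and let $(K^r,v)$ be the absolute ramification field of $(K,v)$ with respect to this extension. Then $(K^r,v)$ is a gdr field if and only if $(K,v)$ is a gdr field, and $(K^r,v)$ is a semitame field if and only if $(K,v)$ is a semitame field.
   Context: The absolute ramification field $(K^r,v)$ of $(K,v)$ (w.r.t. a fixed extension of $v$ to $\tilde K$) is the ramification field of the normal extension $(K^{sep}|K,v)$, $K^{sep}$ the separable-algebraic closure. For a valued field $(F,u)$ with value group $uF$, residue field $Fu$, completion $\hat F$ with valuation ring $\mathcal{O}_{\hat F}$: (DRvr): if $\operatorname{char}Fu=p>0$, then $x\mapsto x^p$ is surjective on $\mathcal{O}_{\hat F}/p\mathcal{O}_{\hat F}$; (DRvp): if $\operatorname{char}Fu=p>0$, then $up$ is not the smallest positive element of $uF$ ($up=\infty$ if $\operatorname{char}F=p$); (DRst): if $\operatorname{char}Fu=p>0$, then $uF$ is $p$-divisible. Gdr field: (DRvr) and (DRvp). Semitame field: (DRvr) and (DRst). *)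

theory Defs
  imports "HOL-Computational_Algebra.Polynomial" "HOL-Computational_Algebra.Primes"
begin

definition alg_closed_field :: "'a::field itself \<Rightarrow> bool" where
  "alg_closed_field _ \<longleftrightarrow> (\<forall>p::'a poly. degree p > 0 \<longrightarrow> (\<exists>x. poly p x = 0))"

definition is_subfield :: "'a::field set \<Rightarrow> bool" where
  "is_subfield K \<longleftrightarrow> 0 \<in> K \<and> 1 \<in> K \<and>
     (\<forall>x\<in>K. \<forall>y\<in>K. x + y \<in> K \<and> x - y \<in> K \<and> x * y \<in> K) \<and>
     (\<forall>x\<in>K. x \<noteq> 0 \<longrightarrow> inverse x \<in> K)"

definition poly_over :: "'a::field set \<Rightarrow> 'a poly \<Rightarrow> bool" where
  "poly_over K p \<longleftrightarrow> (\<forall>i. coeff p i \<in> K)"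

definition algebraic_over :: "'a::field set \<Rightarrow> 'a \<Rightarrow> bool" where
  "algebraic_over K x \<longleftrightarrow> (\<exists>p. p \<noteq> 0 \<and> poly_over K p \<and> poly p x = 0)"

text \<open>Separable polynomial: nonzero and without multiple roots in the (algebraically closed)
  ambient field.\<close>
definition separable_poly :: "'a::field poly \<Rightarrow> bool" where
  "separable_poly p \<longleftrightarrow> p \<noteq> 0 \<and> (\<forall>y. poly p y = 0 \<longrightarrow> poly (pderiv p) y \<noteq> 0)"

definition separable_over :: "'a::field set \<Rightarrow> 'a \<Rightarrow> bool" where
  "separable_over K x \<longleftrightarrow> (\<exists>p. poly_over K p \<and> separable_poly p \<and> poly p x = 0)"

definition sep_closure :: "'a::field set \<Rightarrow> 'a set" where
  "sep_closure K = {x. separable_over K x}"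

text \<open>Automorphisms of the field L fixing K pointwise (only their values on L matter).\<close>
definition rel_auts :: "'a::field set \<Rightarrow> 'a set \<Rightarrow> ('a \<Rightarrow> 'a) set" where
  "rel_auts L K = {\<sigma>. bij_betw \<sigma> L L \<and>
      (\<forall>x\<in>L. \<forall>y\<in>L. \<sigma> (x + y) = \<sigma> x + \<sigma> y \<and> \<sigma> (x * y) = \<sigma> x * \<sigma> y) \<and>
      (\<forall>x\<in>K. \<sigma> x = x)}"

section \<open>Valuations, given by their valuation rings\<close>

definition valuation_ring :: "'a::field set \<Rightarrow> bool" where
  "valuation_ring R \<longleftrightarrow> 0 \<in> R \<and> 1 \<in> R \<and>
     (\<forall>x\<in>R. \<forall>y\<in>R. x + y \<in> R \<and> x - y \<in> R \<and> x * y \<in> R) \<and>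
     (\<forall>x. x \<in> R \<or> inverse x \<in> R)"

definition max_ideal :: "'a::field set \<Rightarrow> 'a set" where
  "max_ideal R = {x \<in> R. x = 0 \<or> inverse x \<notin> R}"

text \<open>vle R x y  means  v x \<le> v y  (with v 0 = \<infinity>); vless R x y means v x < v y.\<close>
definition vle :: "'a::field set \<Rightarrow> 'a \<Rightarrow> 'a \<Rightarrow> bool" where
  "vle R x y \<longleftrightarrow> y = 0 \<or> (x \<noteq> 0 \<and> y / x \<in> R)"

definition vless :: "'a::field set \<Rightarrow> 'a \<Rightarrow> 'a \<Rightarrow> bool" where
  "vless R x y \<longleftrightarrow> vle R x y \<and> \<not> vle R y x"

definition ram_group :: "'a::field set \<Rightarrow> 'a set \<Rightarrow> ('a \<Rightarrow> 'a) set" where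
  "ram_group K R = {\<sigma> \<in> rel_auts (sep_closure K) K.
      \<forall>x\<in>sep_closure K. x \<noteq> 0 \<longrightarrow> vless R x (\<sigma> x - x)}"

definition ram_field :: "'a::field set \<Rightarrow> 'a set \<Rightarrow> 'a set" where
  "ram_field K R = {x \<in> sep_closure K. \<forall>\<sigma>\<in>ram_group K R. \<sigma> x = x}"

section \<open>Completion of (F, R restricted to F) via Cauchy nets indexed by F^* ordered by value\<close>

definition net_index :: "'a::field set \<Rightarrow> 'a set" where
  "net_index F = {c \<in> F. c \<noteq> 0}"

definition cauchy_net :: "'a::field set \<Rightarrow> 'a set \<Rightarrow> ('a \<Rightarrow> 'a) \<Rightarrow> bool" where
  "cauchy_net F R a \<longleftrightarrow> (\<forall>c\<in>net_index F. a c \<in> F) \<and>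
     (\<forall>d\<in>net_index F. \<exists>c0\<in>net_index F. \<forall>c\<in>net_index F. \<forall>c'\<in>net_index F.
        vle R c0 c \<and> vle R c0 c' \<longrightarrow> vless R d (a c - a c'))"

definition null_net :: "'a::field set \<Rightarrow> 'a set \<Rightarrow> ('a \<Rightarrow> 'a) \<Rightarrow> bool" where
  "null_net F R a \<longleftrightarrow>
     (\<forall>d\<in>net_index F. \<exists>c0\<in>net_index F. \<forall>c\<in>net_index F. vle R c0 c \<longrightarrow> vless R d (a c))"

text \<open>Representatives of elements of the valuation ring of the completion.\<close>
definition compl_val_ring :: "'a::field set \<Rightarrow> 'a set \<Rightarrow> ('a \<Rightarrow> 'a) set" where
  "compl_val_ring F R = {a. cauchy_net F R a \<and>
     (\<exists>c0\<in>net_index F. \<forall>c\<in>net_index F. vle R c0 c \<longrightarrow> a c \<in> R)}"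

text \<open>char Fu = p > 0 iff p is prime and p \<cdot> 1 lies in the maximal ideal.\<close>
definition DRvr :: "'a::field set \<Rightarrow> 'a set \<Rightarrow> bool" where
  "DRvr F R \<longleftrightarrow> (\<forall>p::nat. prime p \<and> of_nat p \<in> max_ideal R \<longrightarrow>
     (\<forall>a\<in>compl_val_ring F R. \<exists>b\<in>compl_val_ring F R. \<exists>c\<in>compl_val_ring F R.
        null_net F R (\<lambda>i. b i ^ p - a i - of_nat p * c i)))"

definition smallest_pos :: "'a::field set \<Rightarrow> 'a set \<Rightarrow> 'a \<Rightarrow> bool" where
  "smallest_pos F R z \<longleftrightarrow> z \<in> F \<and> z \<noteq> 0 \<and> vless R 1 z \<and>
     (\<forall>x\<in>F. x \<noteq> 0 \<and> vless R 1 x \<longrightarrow> vle R z x)"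

definition DRvp :: "'a::field set \<Rightarrow> 'a set \<Rightarrow> bool" where
  "DRvp F R \<longleftrightarrow> (\<forall>p::nat. prime p \<and> of_nat p \<in> max_ideal R \<longrightarrow>
     \<not> smallest_pos F R (of_nat p))"

definition DRst :: "'a::field set \<Rightarrow> 'a set \<Rightarrow> bool" where
  "DRst F R \<longleftrightarrow> (\<forall>p::nat. prime p \<and> of_nat p \<in> max_ideal R \<longrightarrow>
     (\<forall>x\<in>F. x \<noteq> 0 \<longrightarrow> (\<exists>y\<in>F. y \<noteq> 0 \<and> vle R x (y ^ p) \<and> vle R (y ^ p) x)))"

definition gdr :: "'a::field set \<Rightarrow> 'a set \<Rightarrow> bool" where
  "gdr F R \<longleftrightarrow> DRvr F R \<and> DRvp F R"

definition semitame :: "'a::field set \<Rightarrow> 'a set \<Rightarrow> bool" where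
  "semitame F R \<longleftrightarrow> DRvr F R \<and> DRst F R"

end

theory Submission
  imports Defs "HOL-Library.FuncSet"
begin

text \<open>
  The ramification field is the union, over the finite Galois levels \<open>N\<close> of the separable closure,
  of the fixed fields of the ramification groups \<open>V \<le> I \<le> D\<close> of \<open>N\<close>. Let \<open>C\<close> be the ring
  of all \<open>x \<in> N\<close> with all conjugates in the valuation ring. Orbit polynomials provide finitely
  many \<open>x\<^sub>i, y\<^sub>i \<in> C \<inter> N\<^sup>I\<close> such that \<open>\<Sum> x\<^sub>i \<sigma>(y\<^sub>i)\<close> vanishes for all \<open>\<sigma>\<close> outside \<open>I\<close>
  and is a unit for \<open>\<sigma> = 1\<close>; for \<open>I / V\<close> there are such elements with \<open>x\<^sub>i \<sigma>(y\<^sub>i)\<close> integral.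
  Up to a unit, \<open>a\<close> is then congruent to \<open>\<Sum> x\<^sub>i\<^sup>p Tr(a y\<^sub>i\<^sup>p)\<close> modulo \<open>p\<close>, so that surjectivity of
  Frobenius ascends. It descends along \<open>b \<mapsto> Tr(\<eta> b) / Tr(\<eta>)\<close>, where an \<open>\<eta>\<close> with \<open>Tr(\<eta>)\<close>
  a unit is found among the \<open>t y\<^sub>i\<close>. The value group of \<open>N\<^sup>I\<close> is that of \<open>K\<close>, and the index of
  \<open>V\<close> in \<open>I\<close> is prime to \<open>p\<close>, so \<open>p\<close>-divisibility of values is preserved in both directions.
\<close>

section \<open>Subfields and extension of isomorphisms\<close>

text \<open>The valuation of \<open>K\<close> may have several conjugate extensions to
  \<open>N\<close>, and no henselization intervenes: conjugates of integral elements need not be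
  integral. Hence the ring \<open>C\<close>, and denominators that are units for the given
  valuation. The completion in \<open>DRvr\<close> is eliminated too. If \<open>p\<close> is nonzero
  in the field, Frobenius has to be surjective on \<open>R \<inter> F\<close> modulo
  \<open>p\<close>; if \<open>p\<close> is zero, \<open>p\<close>-th powers have to be dense in
  \<open>R \<inter> F\<close>, which is tested modulo nonzero elements of \<open>K\<close>, or
  modulo \<open>0\<close> for the trivial valuation. The obstacle is the tame ascent: the tensors
  for \<open>I / V\<close> have non-integral entries, so roots are wanted for elements
  \<open>x ^ p * c\<close> with \<open>c\<close> in the inertia field but perhaps not integral. If
  \<open>p\<close> is zero, a change of modulus approximates \<open>c\<close> up to a relative
  error. Otherwise the value of \<open>c\<close> must first be shown divisible by \<open>p\<close>,
  which uses some \<open>\<pi>\<close> in \<open>K\<close> such that \<open>\<pi> ^ p\<close> has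
  the value of \<open>p\<close>. It comes from (DRvr) and (DRvp) together, so these two are
  transferred jointly; as (DRst) implies (DRvp), semitame means gdr plus (DRst).\<close>

lemma subfield_zero: "is_subfield F \<Longrightarrow> 0 \<in> F"
  and subfield_one: "is_subfield F \<Longrightarrow> 1 \<in> F"
  and subfield_add: "is_subfield F \<Longrightarrow> x \<in> F \<Longrightarrow> y \<in> F \<Longrightarrow> x + y \<in> F"
  and subfield_diff: "is_subfield F \<Longrightarrow> x \<in> F \<Longrightarrow> y \<in> F \<Longrightarrow> x - y \<in> F"
  and subfield_mult: "is_subfield F \<Longrightarrow> x \<in> F \<Longrightarrow> y \<in> F \<Longrightarrow> x * y \<in> F"
  by (auto simp: is_subfield_def)

lemma subfield_inverse: "is_subfield F \<Longrightarrow> x \<in> F \<Longrightarrow> inverse x \<in> F"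
  by (cases "x = 0") (auto simp: is_subfield_def)

lemma subfield_divide: "is_subfield F \<Longrightarrow> x \<in> F \<Longrightarrow> y \<in> F \<Longrightarrow> x / y \<in> F"
  by (simp add: divide_inverse subfield_mult subfield_inverse)

lemma subfield_uminus: "is_subfield F \<Longrightarrow> x \<in> F \<Longrightarrow> - x \<in> F"
  using subfield_diff[of F 0 x] by (simp add: subfield_zero)

lemma subfield_power: "is_subfield F \<Longrightarrow> x \<in> F \<Longrightarrow> x ^ n \<in> F"
  by (induction n) (auto simp: subfield_one subfield_mult)

lemma subfield_sum: "is_subfield F \<Longrightarrow> (\<And>i. i \<in> A \<Longrightarrow> f i \<in> F) \<Longrightarrow> sum f A \<in> F"
  by (induction A rule: infinite_finite_induct) (auto simp: subfield_zero subfield_add)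

lemma subfield_prod: "is_subfield F \<Longrightarrow> (\<And>i. i \<in> A \<Longrightarrow> f i \<in> F) \<Longrightarrow> prod f A \<in> F"
  by (induction A rule: infinite_finite_induct) (auto simp: subfield_one subfield_mult)

lemma subfield_of_nat: "is_subfield F \<Longrightarrow> of_nat n \<in> F"
  by (induction n) (auto simp: subfield_zero subfield_one subfield_add)

lemmas subfield_intros = subfield_zero subfield_one subfield_add subfield_diff subfield_mult
  subfield_inverse subfield_divide subfield_uminus subfield_power subfield_sum subfield_prod
  subfield_of_nat

lemma subfieldI:
  assumes "1 \<in> F" "\<And>x y. x \<in> F \<Longrightarrow> y \<in> F \<Longrightarrow> x - y \<in> F"
    "\<And>x y. x \<in> F \<Longrightarrow> y \<in> F \<Longrightarrow> x * y \<in> F" "\<And>x. x \<in> F \<Longrightarrow> x \<noteq> 0 \<Longrightarrow> inverse x \<in> F"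
  shows "is_subfield F"
proof -
  have z: "0 \<in> F" using assms(1) assms(2)[of 1 1] by simp
  have "x + y \<in> F" if "x \<in> F" "y \<in> F" for x y
    using assms(2)[OF that(1) assms(2)[OF z that(2)]] by simp
  then show ?thesis using assms z by (auto simp: is_subfield_def)
qed

text \<open>Isomorphisms between subfields are encoded by their graphs.\<close>
definition hom_graph :: "('a::field \<times> 'a) set \<Rightarrow> bool" where
  "hom_graph \<Gamma> \<longleftrightarrow> (0, 0) \<in> \<Gamma> \<and> (1, 1) \<in> \<Gamma> \<and>
     (\<forall>x x' y y'. (x, x') \<in> \<Gamma> \<longrightarrow> (y, y') \<in> \<Gamma> \<longrightarrow>
        (x + y, x' + y') \<in> \<Gamma> \<and> (x - y, x' - y') \<in> \<Gamma> \<and> (x * y, x' * y') \<in> \<Gamma>) \<and>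
     (\<forall>x x'. (x, x') \<in> \<Gamma> \<longrightarrow> (inverse x, inverse x') \<in> \<Gamma>) \<and>
     (\<forall>y. (0, y) \<in> \<Gamma> \<longrightarrow> y = 0)"

text \<open>\<open>p'\<close> is the image of \<open>p\<close> under the isomorphism with graph
  \<open>\<Gamma>\<close>; the relation also records that \<open>p\<close> has its coefficients in
  the domain.\<close>

definition poly_pair :: "('a::field \<times> 'a) set \<Rightarrow> 'a poly \<Rightarrow> 'a poly \<Rightarrow> bool" where
  "poly_pair \<Gamma> p p' \<longleftrightarrow> (\<forall>i. (coeff p i, coeff p' i) \<in> \<Gamma>)"

lemma hom_graph_zero: "hom_graph \<Gamma> \<Longrightarrow> (0, 0) \<in> \<Gamma>"
  and hom_graph_one: "hom_graph \<Gamma> \<Longrightarrow> (1, 1) \<in> \<Gamma>"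
  and hom_graph_add: "hom_graph \<Gamma> \<Longrightarrow> (x, x') \<in> \<Gamma> \<Longrightarrow> (y, y') \<in> \<Gamma> \<Longrightarrow> (x + y, x' + y') \<in> \<Gamma>"
  and hom_graph_diff: "hom_graph \<Gamma> \<Longrightarrow> (x, x') \<in> \<Gamma> \<Longrightarrow> (y, y') \<in> \<Gamma> \<Longrightarrow> (x - y, x' - y') \<in> \<Gamma>"
  and hom_graph_mult: "hom_graph \<Gamma> \<Longrightarrow> (x, x') \<in> \<Gamma> \<Longrightarrow> (y, y') \<in> \<Gamma> \<Longrightarrow> (x * y, x' * y') \<in> \<Gamma>"
  and hom_graph_inverse: "hom_graph \<Gamma> \<Longrightarrow> (x, x') \<in> \<Gamma> \<Longrightarrow> (inverse x, inverse x') \<in> \<Gamma>"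
  and hom_graph_left0: "hom_graph \<Gamma> \<Longrightarrow> (0, y) \<in> \<Gamma> \<Longrightarrow> y = 0"
  by (auto simp: hom_graph_def)

lemma hom_graph_unique:
  assumes "hom_graph \<Gamma>" "(x, y) \<in> \<Gamma>" "(x, z) \<in> \<Gamma>"
  shows "y = z"
  using hom_graph_left0[OF assms(1), of "y - z"] hom_graph_diff[OF assms] by simp

lemma hom_graph_right0:
  assumes "hom_graph \<Gamma>" "(x, 0) \<in> \<Gamma>"
  shows "x = 0"
proof (rule ccontr)
  assume "x \<noteq> 0"
  with hom_graph_mult[OF assms hom_graph_inverse[OF assms]] have "(1, 0) \<in> \<Gamma>" by simp
  with hom_graph_one[OF assms(1)] show False using hom_graph_unique[OF assms(1)] by fastforce
qed

lemma hom_graph_sum: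
  assumes "hom_graph \<Gamma>" "\<And>i. i \<in> A \<Longrightarrow> (f i, g i) \<in> \<Gamma>"
  shows "(sum f A, sum g A) \<in> \<Gamma>"
  using assms(2)
  by (induction A rule: infinite_finite_induct)
     (auto intro: hom_graph_zero[OF assms(1)] hom_graph_add[OF assms(1)])

lemma hom_graph_power: "hom_graph \<Gamma> \<Longrightarrow> (x, x') \<in> \<Gamma> \<Longrightarrow> (x ^ n, x' ^ n) \<in> \<Gamma>"
  by (induction n) (auto intro: hom_graph_one hom_graph_mult)

lemma poly_pair_arith:
  assumes "hom_graph \<Gamma>" "poly_pair \<Gamma> p p'" "poly_pair \<Gamma> q q'"
  shows "poly_pair \<Gamma> (p + q) (p' + q')" "poly_pair \<Gamma> (p - q) (p' - q')"
    "poly_pair \<Gamma> (p * q) (p' * q')"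
  using assms(2,3)
  by (auto simp: poly_pair_def coeff_mult intro!: hom_graph_add[OF assms(1)]
      hom_graph_diff[OF assms(1)] hom_graph_sum[OF assms(1)] hom_graph_mult[OF assms(1)])

lemma poly_pair_monom: "hom_graph \<Gamma> \<Longrightarrow> (c, c') \<in> \<Gamma> \<Longrightarrow> poly_pair \<Gamma> (monom c n) (monom c' n)"
  by (auto simp: poly_pair_def hom_graph_zero)

lemma poly_pair_degree:
  assumes "hom_graph \<Gamma>" "poly_pair \<Gamma> p p'"
  shows "degree p' = degree p"
proof -
  have "coeff p' i = 0 \<longleftrightarrow> coeff p i = 0" for i
    using assms(2) hom_graph_left0[OF assms(1)] hom_graph_right0[OF assms(1)]
    by (metis poly_pair_def)
  then show ?thesis by (simp add: degree_def)
qed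

lemma poly_pair_eval:
  assumes "hom_graph \<Gamma>" "poly_pair \<Gamma> p p'" "(x, x') \<in> \<Gamma>"
  shows "(poly p x, poly p' x') \<in> \<Gamma>"
proof -
  have "degree p' = degree p" by (rule poly_pair_degree[OF assms(1,2)])
  then show ?thesis using assms
    by (auto simp: poly_altdef poly_pair_def intro!: hom_graph_sum hom_graph_mult hom_graph_power)
qed

text \<open>Here \<open>q\<close> is a minimal polynomial of \<open>x\<close> over the domain of
  \<open>\<Gamma>\<close>. Long division is carried out on both sides of the isomorphism at once, so
  that every polynomial vanishing at \<open>x\<close> has an image vanishing at the roots of
  \<open>q'\<close>.\<close>

lemma poly_pair_dvd:
  assumes "hom_graph \<Gamma>" "poly_pair \<Gamma> q q'" "q \<noteq> 0" "poly q x = 0"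
    "\<forall>p p'. poly_pair \<Gamma> p p' \<longrightarrow> p \<noteq> 0 \<longrightarrow> poly p x = 0 \<longrightarrow> degree q \<le> degree p"
    "poly_pair \<Gamma> p p'" "poly p x = 0"
  shows "\<exists>s s'. poly_pair \<Gamma> s s' \<and> p = q * s \<and> p' = q' * s'"
  using assms(6,7)
\<comment> \<open>The degree is shifted by one so that a zero remainder lies below a nonzero
  constant.\<close>
proof (induction "if p = 0 then 0 else Suc (degree p)" arbitrary: p p' rule: less_induct)
  case less
  show ?case
  proof (cases "p = 0")
    case True
    then have "p' = 0"
      using less(2) hom_graph_left0[OF assms(1)] by (auto simp: poly_pair_def poly_eq_iff)
    then show ?thesis using True hom_graph_zero[OF assms(1)]
      by (intro exI[of _ 0]) (auto simp: poly_pair_def)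
  next
    case False
    have le: "degree q \<le> degree p" using assms(5) less(2,3) False by blast
    define c where "c = lead_coeff p / lead_coeff q"
    define c' where "c' = coeff p' (degree p) / coeff q' (degree q)"
    define n where "n = degree p - degree q"
    have cc: "(c, c') \<in> \<Gamma>"
      unfolding c_def c'_def divide_inverse using less(2) assms(2)
      by (auto simp: poly_pair_def intro!: hom_graph_mult[OF assms(1)] hom_graph_inverse[OF assms(1)])
    have m: "poly_pair \<Gamma> (monom c n) (monom c' n)" by (rule poly_pair_monom[OF assms(1) cc])
    define r where "r = p - q * monom c n"
    define r' where "r' = p' - q' * monom c' n"
    have pr: "poly_pair \<Gamma> r r'"
      unfolding r_def r'_def by (intro poly_pair_arith[OF assms(1)] less(2) assms(2) m)
    have rx: "poly r x = 0" using less(3) assms(4) by (simp add: r_def)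
    have c0: "c \<noteq> 0" using False assms(3) by (simp add: c_def)
    have dm: "degree (q * monom c n) = degree p"
      using c0 assms(3) le by (simp add: degree_mult_eq degree_monom_eq n_def)
    have "coeff (q * monom c n) (degree p) = lead_coeff p"
      using assms(3) le by (simp add: coeff_monom_mult c_def n_def mult.commute[of q])
    then have "r = 0 \<or> degree r < degree p"
      using dm False unfolding r_def
      by (metis coeff_diff degree_diff_le diff_self eq_zero_or_degree_less order_refl)
    then have "(if r = 0 then 0 else Suc (degree r)) < (if p = 0 then 0 else Suc (degree p))"
      using False by auto
    from less(1)[OF this pr rx] obtain s s' where
      s: "poly_pair \<Gamma> s s'" "r = q * s" "r' = q' * s'" by blast
    have "p = q * (s + monom c n)" "p' = q' * (s' + monom c' n)"
      using s(2,3) by (auto simp: r_def r'_def algebra_simps)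
    then show ?thesis using poly_pair_arith(1)[OF assms(1) s(1) m] by blast
  qed
qed

text \<open>In a polynomial of least degree vanishing at \<open>y \<noteq> 0\<close>, a zero
  constant term could be divided out. The nonzero constant term will express
  \<open>inverse y\<close> as a polynomial in \<open>y\<close>.\<close>

lemma algebraic_const_coeff:
  assumes "algebraic_over K y" "y \<noteq> 0"
  shows "\<exists>c k. c \<noteq> 0 \<and> poly_over K (pCons c k) \<and> poly (pCons c k) y = 0"
proof -
  define P where "P p \<longleftrightarrow> p \<noteq> 0 \<and> poly_over K p \<and> poly p y = 0" for p
  obtain p0 where "P p0" using assms by (auto simp: algebraic_over_def P_def)
  then obtain p where p: "P p" and min: "\<And>q. P q \<Longrightarrow> degree p \<le> degree q"
    using ex_has_least_nat[of P p0 degree] by blast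
  obtain c k where ck: "p = pCons c k" by (cases p)
  have "c \<noteq> 0"
  proof
    assume c: "c = 0"
    then have "k \<noteq> 0" "poly k y = 0" using p ck assms(2) by (auto simp: P_def)
    moreover have "poly_over K k"
      unfolding poly_over_def
    proof
      fix i
      have "coeff p (Suc i) \<in> K" using p by (auto simp: P_def poly_over_def)
      then show "coeff k i \<in> K" by (simp add: ck)
    qed
    ultimately have "degree p \<le> degree k" by (intro min) (auto simp: P_def)
    then show False using ck \<open>k \<noteq> 0\<close> by simp
  qed
  then show ?thesis using p ck by (auto simp: P_def)
qed

lemma Id_on_poly_pair: "poly_over K p \<Longrightarrow> Id_on K \<subseteq> \<Gamma> \<Longrightarrow> poly_pair \<Gamma> p p"
  by (auto simp: poly_over_def poly_pair_def)

lemma inverse_of_root: "(y::'a::field) * k = - c \<Longrightarrow> c \<noteq> 0 \<Longrightarrow> inverse y = k * (- inverse c)"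
proof -
  assume h: "y * k = - c" "c \<noteq> 0"
  then have "y \<noteq> 0" by auto
  have "y * (k * (- inverse c)) = 1" using h by (simp add: mult.assoc[symmetric])
  with \<open>y \<noteq> 0\<close> show ?thesis by (metis inverse_unique)
qed

text \<open>This is the isomorphism of simple extensions that sends \<open>x\<close> to a root
  \<open>x'\<close> of the transported minimal polynomial. Divisibility by \<open>q\<close> makes it
  well defined.\<close>

lemma hom_graph_step:
  assumes "hom_graph \<Gamma>" "Id_on K \<subseteq> \<Gamma>" "is_subfield K" "\<forall>y. algebraic_over K y"
    "poly_pair \<Gamma> q q'" "q \<noteq> 0" "poly q x = 0" "poly q' x' = 0"
    "\<forall>p p'. poly_pair \<Gamma> p p' \<longrightarrow> p \<noteq> 0 \<longrightarrow> poly p x = 0 \<longrightarrow> degree q \<le> degree p"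
  shows "\<exists>\<Delta>. hom_graph \<Delta> \<and> \<Gamma> \<subseteq> \<Delta> \<and> (x, x') \<in> \<Delta>"
proof -
  define \<Delta> where "\<Delta> = {(poly p x, poly p' x') | p p'. poly_pair \<Gamma> p p'}"
  have I: "(poly p x, poly p' x') \<in> \<Delta>" if "poly_pair \<Gamma> p p'" for p p'
    using that by (auto simp: \<Delta>_def)
  have sub: "\<Gamma> \<subseteq> \<Delta>"
  proof clarify
    fix a b assume "(a, b) \<in> \<Gamma>"
    then show "(a, b) \<in> \<Delta>" using I[OF poly_pair_monom[OF assms(1), of a b 0]] by (simp add: poly_monom)
  qed
  have left0: "z = 0" if "(0, z) \<in> \<Delta>" for z
  proof -
    from that obtain p p' where p0: "poly_pair \<Gamma> p p'" "(0, z) = (poly p x, poly p' x')"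
      unfolding \<Delta>_def by blast
    then have p: "poly_pair \<Gamma> p p'" "poly p x = 0" "poly p' x' = z" by simp_all
    from poly_pair_dvd[OF assms(1,5,6,7,9) p(1,2)] obtain s' where "p' = q' * s'" by blast
    then show ?thesis using p(3) assms(8) by simp
  qed
  have arith: "(a + b, a' + b') \<in> \<Delta> \<and> (a - b, a' - b') \<in> \<Delta> \<and> (a * b, a' * b') \<in> \<Delta>"
    if "(a, a') \<in> \<Delta>" "(b, b') \<in> \<Delta>" for a a' b b'
  proof -
    obtain p p' r r' where "poly_pair \<Gamma> p p'" "poly_pair \<Gamma> r r'" "a = poly p x" "a' = poly p' x'"
      "b = poly r x" "b' = poly r' x'" using \<open>(a, a') \<in> \<Delta>\<close> \<open>(b, b') \<in> \<Delta>\<close> by (auto simp: \<Delta>_def)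
    with I[OF poly_pair_arith(1)[OF assms(1), of p p' r r']] I[OF poly_pair_arith(2)[OF assms(1), of p p' r r']]
      I[OF poly_pair_arith(3)[OF assms(1), of p p' r r']] show ?thesis by auto
  qed
  have zero: "(0, 0) \<in> \<Delta>" "(1, 1) \<in> \<Delta>" using sub hom_graph_zero hom_graph_one assms(1) by blast+
  have pow: "(a ^ n, a' ^ n) \<in> \<Delta>" if "(a, a') \<in> \<Delta>" for a a' n
    by (induction n) (use zero arith that in auto)
  have dsum: "(sum f A, sum g A) \<in> \<Delta>" if "\<And>i. (f i, g i) \<in> \<Delta>" for f g and A :: "nat set"
    by (induction A rule: infinite_finite_induct) (use zero arith that in auto)
  have ev: "(poly p a, poly p a') \<in> \<Delta>" if "poly_over K p" "(a, a') \<in> \<Delta>" for p a a'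
  proof -
    have "(coeff p i, coeff p i) \<in> \<Delta>" for i
      using that(1) sub assms(2) by (auto simp: poly_over_def Id_on_def)
    then show ?thesis unfolding poly_altdef using arith pow[OF that(2)] by (intro dsum) blast
  qed
  have inv: "(inverse a, inverse a') \<in> \<Delta>" if a: "(a, a') \<in> \<Delta>" for a a'
  proof (cases "a = 0")
    case True
    then have "a' = 0" using a left0 by blast
    then show ?thesis using True zero by simp
  next
    case False
    \<comment> \<open>As \<open>\<Delta>\<close> fixes \<open>K\<close>, both \<open>a\<close> and
      \<open>a'\<close> satisfy the same equation over \<open>K\<close>; it yields the same
      polynomial formula for both inverses.\<close>
    obtain c k where ck: "c \<noteq> 0" "poly_over K (pCons c k)" "poly (pCons c k) a = 0"
      using algebraic_const_coeff[of K a] assms(4) False by blast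
    have "(0, poly (pCons c k) a') \<in> \<Delta>" using ev[OF ck(2) a] ck(3) by simp
    then have k': "poly (pCons c k) a' = 0" by (rule left0)
    have "poly_over K k"
      unfolding poly_over_def
    proof
      fix i
      show "coeff k i \<in> K" using ck(2)[unfolded poly_over_def, rule_format, of "Suc i"] by simp
    qed
    then have "(poly k a, poly k a') \<in> \<Delta>" using a by (rule ev)
    moreover have "c \<in> K" using ck(2)[unfolded poly_over_def, rule_format, of 0] by simp
    then have "(- inverse c, - inverse c) \<in> \<Delta>"
      using sub assms(2,3) by (auto intro!: subfield_intros)
    ultimately have "(poly k a * (- inverse c), poly k a' * (- inverse c)) \<in> \<Delta>" using arith by blast
    moreover have "inverse a = poly k a * (- inverse c)" "inverse a' = poly k a' * (- inverse c)"
      using ck(3) k' inverse_of_root[OF _ ck(1)] by (simp_all add: eq_neg_iff_add_eq_0 add.commute)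
    ultimately show ?thesis by simp
  qed
  have "hom_graph \<Delta>" unfolding hom_graph_def using arith zero inv left0 by blast
  moreover have "poly_pair \<Gamma> (monom 1 1) (monom 1 1)"
    by (rule poly_pair_monom[OF assms(1) hom_graph_one[OF assms(1)]])
  then have "(x, x') \<in> \<Delta>" using I[of "monom 1 1" "monom 1 1"] by (simp add: poly_monom)
  ultimately show ?thesis using sub by blast
qed

lemma hom_graph_Union:
  assumes "C \<noteq> {}" "\<And>\<Gamma>. \<Gamma> \<in> C \<Longrightarrow> hom_graph \<Gamma>" "\<And>X Y. X \<in> C \<Longrightarrow> Y \<in> C \<Longrightarrow> X \<subseteq> Y \<or> Y \<subseteq> X"
  shows "hom_graph (\<Union>C)"
proof -
  have two: "\<exists>X\<in>C. u \<in> X \<and> v \<in> X" if "u \<in> \<Union>C" "v \<in> \<Union>C" for u v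
  proof -
    obtain X Y where "X \<in> C" "Y \<in> C" "u \<in> X" "v \<in> Y" using \<open>u \<in> \<Union>C\<close> \<open>v \<in> \<Union>C\<close> by blast
    then show ?thesis using assms(3)[of X Y] by blast
  qed
  obtain X where X: "X \<in> C" using assms(1) by blast
  show ?thesis
    unfolding hom_graph_def
  proof (intro conjI allI impI)
    show "(0, 0) \<in> \<Union>C" "(1, 1) \<in> \<Union>C"
      using X assms(2)[OF X] by (auto intro: hom_graph_zero hom_graph_one)
  next
    fix x x' y y' assume "(x, x') \<in> \<Union>C" "(y, y') \<in> \<Union>C"
    then obtain Y where "Y \<in> C" "(x, x') \<in> Y" "(y, y') \<in> Y" using two by blast
    then show "(x + y, x' + y') \<in> \<Union>C" "(x - y, x' - y') \<in> \<Union>C" "(x * y, x' * y') \<in> \<Union>C"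
      using assms(2) by (auto intro: hom_graph_add hom_graph_diff hom_graph_mult)
  next
    fix x x' assume "(x, x') \<in> \<Union>C"
    then show "(inverse x, inverse x') \<in> \<Union>C" using assms(2) by (auto intro: hom_graph_inverse)
  next
    fix y assume "(0, y) \<in> \<Union>C"
    then obtain X where "X \<in> C" "(0, y) \<in> X" by blast
    then show "y = 0" using assms(2) hom_graph_left0 by blast
  qed
qed

section \<open>Extension of isomorphisms to the algebraic closure\<close>

locale alg_ext =
  fixes K :: "'a::field set"
  assumes alg_closed: "alg_closed_field TYPE('a)"
    and subfield_K: "is_subfield K"
    and algebraic_K: "\<forall>x. algebraic_over K x"
begin

abbreviation Gal :: "('a \<Rightarrow> 'a) set" where "Gal \<equiv> rel_auts UNIV K"

lemma root_exists: "degree (p::'a poly) > 0 \<Longrightarrow> \<exists>x. poly p x = 0"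
  using alg_closed by (simp add: alg_closed_field_def)

lemma min_poly_pair_exists:
  assumes "hom_graph \<Gamma>" "Id_on K \<subseteq> \<Gamma>"
  shows "\<exists>q q'. poly_pair \<Gamma> q q' \<and> q \<noteq> 0 \<and> poly q x = 0 \<and>
    (\<forall>p p'. poly_pair \<Gamma> p p' \<longrightarrow> p \<noteq> 0 \<longrightarrow> poly p x = 0 \<longrightarrow> degree q \<le> degree p)"
proof -
  define P where "P q \<longleftrightarrow> (\<exists>q'. poly_pair \<Gamma> q q') \<and> q \<noteq> 0 \<and> poly q x = 0" for q
  obtain k where "k \<noteq> 0" "poly_over K k" "poly k x = 0"
    using algebraic_K by (auto simp: algebraic_over_def)
  then have "P k" using Id_on_poly_pair[OF _ assms(2)] by (auto simp: P_def)
  then obtain q where "P q" and "\<And>p. P p \<Longrightarrow> degree q \<le> degree p"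
    using ex_has_least_nat[of P k degree] by blast
  then show ?thesis by (auto simp: P_def)
qed

text \<open>Zorn's lemma gives a maximal graph. It is total because the image of a minimal
  polynomial has a root in the algebraically closed ambient field, so \<open>hom_graph_step\<close>
  could adjoin any missing element.\<close>

lemma hom_graph_extend:
  assumes "hom_graph \<Gamma>" "Id_on K \<subseteq> \<Gamma>"
  shows "\<exists>\<sigma>\<in>Gal. \<forall>(x, y)\<in>\<Gamma>. \<sigma> x = y"
proof -
  define A where "A = {\<Delta>. hom_graph \<Delta> \<and> \<Gamma> \<subseteq> \<Delta>}"
  have "\<forall>C\<in>chains A. \<exists>U\<in>A. \<forall>X\<in>C. X \<subseteq> U"
  proof
    fix C assume C: "C \<in> chains A"
    show "\<exists>U\<in>A. \<forall>X\<in>C. X \<subseteq> U"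
  proof (cases "C = {}")
    case True
    then show ?thesis using assms by (auto simp: A_def)
  next
    case False
    have "hom_graph (\<Union>C)"
      using C False by (intro hom_graph_Union) (auto simp: chains_def chain_subset_def A_def)
    moreover have "\<Gamma> \<subseteq> \<Union>C" using C False by (auto simp: chains_def A_def)
    ultimately show ?thesis by (auto simp: A_def)
  qed
  qed
  from Zorn_Lemma2[OF this] obtain M where M: "M \<in> A" "\<forall>X\<in>A. M \<subseteq> X \<longrightarrow> X = M" ..
  have hM: "hom_graph M" and sM: "\<Gamma> \<subseteq> M" using M(1) by (auto simp: A_def)
  have KM: "Id_on K \<subseteq> M" using assms(2) sM by blast
  have tot: "\<exists>y. (x, y) \<in> M" for x
  proof -
    obtain q q' where q: "poly_pair M q q'" "q \<noteq> 0" "poly q x = 0"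
      "\<forall>p p'. poly_pair M p p' \<longrightarrow> p \<noteq> 0 \<longrightarrow> poly p x = 0 \<longrightarrow> degree q \<le> degree p"
      using min_poly_pair_exists[OF hM KM, of x] by blast
    have "degree q \<noteq> 0" 
    proof
      assume "degree q = 0"
      then obtain c where "q = [:c:]" by (rule degree_eq_zeroE)
      then show False using q(2,3) by simp
    qed
    then have "degree q' > 0" using poly_pair_degree[OF hM q(1)] by simp
    then obtain x' where "poly q' x' = 0" using root_exists by blast
    have "\<exists>\<Delta>. hom_graph \<Delta> \<and> M \<subseteq> \<Delta> \<and> (x, x') \<in> \<Delta>"
      by (rule hom_graph_step[OF hM KM subfield_K algebraic_K q(1,2,3) \<open>poly q' x' = 0\<close> q(4)])
    then obtain \<Delta> where D: "hom_graph \<Delta>" "M \<subseteq> \<Delta>" "(x, x') \<in> \<Delta>" by blast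
    then have "\<Delta> = M" using sM by (intro M(2)[rule_format]) (auto simp: A_def)
    then show ?thesis using D by blast
  qed
  define \<sigma> where "\<sigma> x = (THE y. (x, y) \<in> M)" for x
  have iff: "(x, y) \<in> M \<longleftrightarrow> \<sigma> x = y" for x y
  proof -
    have "\<exists>!y. (x, y) \<in> M" using tot[of x] hom_graph_unique[OF hM] by blast
    from theI'[OF this] show ?thesis using hom_graph_unique[OF hM] by (auto simp: \<sigma>_def)
  qed
  have M: "(x, \<sigma> x) \<in> M" for x using iff by simp
  have add: "\<sigma> (x + y) = \<sigma> x + \<sigma> y" and mult: "\<sigma> (x * y) = \<sigma> x * \<sigma> y"
    and diff: "\<sigma> (x - y) = \<sigma> x - \<sigma> y" for x y
    using iff hom_graph_add[OF hM M M] hom_graph_mult[OF hM M M] hom_graph_diff[OF hM M M] by auto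
  have fixK: "\<sigma> x = x" if "x \<in> K" for x using KM that iff by blast
  have "inj \<sigma>"
  proof (rule injI)
    fix x y assume "\<sigma> x = \<sigma> y"
    then have "(x - y, 0) \<in> M" using diff iff by simp
    then show "x = y" using hom_graph_right0[OF hM] by force
  qed
  moreover have "surj \<sigma>"
  proof -
    have "y \<in> range \<sigma>" for y
    proof -
      \<comment> \<open>The injective \<open>\<sigma>\<close> maps the finite set of roots of
        \<open>k\<close> into itself, hence onto itself.\<close>
      obtain k where k: "k \<noteq> 0" "poly_over K k" "poly k y = 0"
        using algebraic_K by (auto simp: algebraic_over_def)
      have fin: "finite {z. poly k z = 0}" using k(1) by (rule poly_roots_finite)
      have "\<sigma> ` {z. poly k z = 0} \<subseteq> {z. poly k z = 0}"
      proof clarify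
        fix z assume "poly k z = 0"
        moreover have "(poly k z, poly k (\<sigma> z)) \<in> M"
          using poly_pair_eval[OF hM Id_on_poly_pair[OF k(2) KM]] iff by blast
        ultimately show "poly k (\<sigma> z) = 0" using hom_graph_left0[OF hM] by metis
      qed
      then have "\<sigma> ` {z. poly k z = 0} = {z. poly k z = 0}"
        using fin \<open>inj \<sigma>\<close> by (meson endo_inj_surj inj_on_subset subset_UNIV)
      then show ?thesis using k(3) by blast
    qed
    then show ?thesis by blast
  qed
  ultimately have "\<sigma> \<in> Gal" using add mult fixK by (auto simp: rel_auts_def bij_def)
  then show ?thesis using sM iff by blast
qed

end

section \<open>The separable closure\<close>

lemma poly_over_mono: "poly_over K p \<Longrightarrow> K \<subseteq> F \<Longrightarrow> poly_over F p"
  by (auto simp: poly_over_def)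

lemma rel_auts_mono: "K \<subseteq> F \<Longrightarrow> rel_auts L F \<subseteq> rel_auts L K"
  by (auto simp: rel_auts_def)

lemma poly_pair_Id_on: "poly_pair (Id_on F) p p' \<longleftrightarrow> p = p' \<and> poly_over F p"
  unfolding poly_pair_def poly_over_def poly_eq_iff Id_on_iff by auto

lemma hom_graph_Id_on: "is_subfield F \<Longrightarrow> hom_graph (Id_on F)"
  by (auto simp: hom_graph_def intro: subfield_intros)

section \<open>Linear spans over a subfield\<close>

inductive_set kspan :: "'a::field set \<Rightarrow> 'a set \<Rightarrow> 'a set" for K S where
  zero: "0 \<in> kspan K S"
| step: "v \<in> kspan K S \<Longrightarrow> c \<in> K \<Longrightarrow> s \<in> S \<Longrightarrow> c * s + v \<in> kspan K S"

lemma kspan_add: "u \<in> kspan K S \<Longrightarrow> v \<in> kspan K S \<Longrightarrow> u + v \<in> kspan K S"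
  by (induction rule: kspan.induct) (auto simp: add.assoc intro: kspan.step)

lemma kspan_scale: "u \<in> kspan K S \<Longrightarrow> is_subfield K \<Longrightarrow> c \<in> K \<Longrightarrow> c * u \<in> kspan K S"
  by (induction rule: kspan.induct)
     (auto simp: distrib_left mult.assoc[symmetric] intro!: kspan.intros subfield_mult[of K])

lemma kspan_base: "is_subfield K \<Longrightarrow> s \<in> S \<Longrightarrow> s \<in> kspan K S"
  using kspan.step[OF kspan.zero, of 1 K s S] by (simp add: subfield_one)

lemma kspan_sum:
  "(\<And>i. i \<in> A \<Longrightarrow> f i \<in> kspan K S) \<Longrightarrow> sum f A \<in> kspan K S"
  by (induction A rule: infinite_finite_induct) (auto intro: kspan.zero kspan_add)

lemma kspan_minimal:
  assumes "is_subfield K" "u \<in> kspan K S" "S \<subseteq> kspan K T"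
  shows "u \<in> kspan K T"
  using assms(2) by induction (use assms(1,3) in \<open>auto intro: kspan.zero kspan_add kspan_scale\<close>)

lemma kspan_mono:
  assumes "S \<subseteq> T"
  shows "kspan K S \<subseteq> kspan K T"
proof
  fix u assume "u \<in> kspan K S"
  then show "u \<in> kspan K T" by induction (use assms in \<open>auto intro: kspan.intros\<close>)
qed

lemma kspan_mult:
  assumes K: "is_subfield K" and u: "u \<in> kspan K S" and v: "v \<in> kspan K T"
    and ST: "\<And>s t. s \<in> S \<Longrightarrow> t \<in> T \<Longrightarrow> s * t \<in> kspan K U"
  shows "u * v \<in> kspan K U"
proof -
  have s: "s * v \<in> kspan K U" if "s \<in> S" for s
    using v
  proof induction
    case (step v c t)
    have "s * (c * t + v) = c * (s * t) + s * v" by (simp add: algebra_simps)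
    then show ?case
      using kspan_add[OF kspan_scale[OF ST[OF that step.hyps(3)] K step.hyps(2)] step.IH] by simp
  qed (auto intro: kspan.zero)
  show ?thesis using u
  proof induction
    case (step u c t)
    have "(c * t + u) * v = c * (t * v) + u * v" by (simp add: algebra_simps)
    then show ?case
      using kspan_add[OF kspan_scale[OF s[OF step.hyps(3)] K step.hyps(2)] step.IH] by simp
  qed (auto intro: kspan.zero)
qed

lemma kspan_insert:
  assumes "is_subfield K" "u \<in> kspan K (insert l S)"
  shows "\<exists>c\<in>K. u - c * l \<in> kspan K S"
  using assms(2)
proof induction
  case zero
  then show ?case using subfield_zero[OF assms(1)] by (auto intro!: bexI[of _ 0] kspan.zero)
next
  case (step v c s)
  then obtain d where d: "d \<in> K" "v - d * l \<in> kspan K S" by blast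
  show ?case
  proof (cases "s = l")
    case True
    have "c * s + v - (c + d) * l = v - d * l" using True by (simp add: algebra_simps)
    then show ?thesis using d step assms(1) by (intro bexI[of _ "c + d"]) (simp_all only: subfield_add)
  next
    case False
    then have "s \<in> S" using step by simp
    have "c * s + v - d * l = c * s + (v - d * l)" by simp
    also have "\<dots> \<in> kspan K S" using \<open>s \<in> S\<close> step(2) d by (intro kspan.step)
    finally show ?thesis using d by blast
  qed
qed

text \<open>Steinitz exchange modulo the span of \<open>U\<close>: some element of \<open>L\<close>
  occurs in \<open>z\<close> with a nonzero coefficient and can be solved for.\<close>

lemma kspan_exchange:
  assumes K: "is_subfield K" and "finite L" "z \<in> kspan K (U \<union> L)" "z \<notin> kspan K U"
  shows "\<exists>l\<in>L. L \<subseteq> kspan K (insert z (U \<union> (L - {l})))"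
  using assms(2-)
proof (induction L rule: finite_induct)
  case (insert l L)
  obtain c where c: "c \<in> K" "z - c * l \<in> kspan K (U \<union> L)"
    using kspan_insert[OF K, of z l "U \<union> L"] insert(4) by auto
  show ?case
  proof (cases "c = 0")
    case True
    then obtain l' where l': "l' \<in> L" "L \<subseteq> kspan K (insert z (U \<union> (L - {l'})))"
      using insert c by auto
    have "insert z (U \<union> (L - {l'})) \<subseteq> insert z (U \<union> (insert l L - {l'}))" by auto
    from kspan_mono[OF this] have "L \<subseteq> kspan K (insert z (U \<union> (insert l L - {l'})))"
      using l'(2) by blast
    moreover have "l \<in> kspan K (insert z (U \<union> (insert l L - {l'})))"
      using insert(2) l'(1) by (auto intro!: kspan_base K)
    ultimately show ?thesis using l'(1) by blast
  next
    case False
    let ?S = "insert z (U \<union> (insert l L - {l}))"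
    have "z - c * l \<in> kspan K ?S"
      using c(2) kspan_mono[of "U \<union> L" ?S K] insert(2) by auto
    moreover have "z \<in> kspan K ?S" by (auto intro: kspan_base K)
    ultimately have "inverse c * (z + (- 1) * (z - c * l)) \<in> kspan K ?S"
      using subfield_inverse[OF K c(1)] subfield_uminus[OF K subfield_one[OF K]]
      by (intro kspan_scale[OF _ K] kspan_add)
    moreover have "inverse c * (z + (- 1) * (z - c * l)) = l" using False by (simp add: field_simps)
    ultimately have "l \<in> kspan K ?S" by (simp only:)
    moreover have "L \<subseteq> kspan K ?S" using insert(2) by (auto intro!: kspan_base K)
    ultimately have "insert l L \<subseteq> kspan K ?S" by blast
    then show ?thesis by blast
  qed
qed auto

lemma kspan_powers:
  assumes "is_subfield K"
  shows "w \<in> kspan K (range (\<lambda>i. y ^ i)) \<longleftrightarrow> (\<exists>g. poly_over K g \<and> w = poly g y)"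
proof
  assume "w \<in> kspan K (range (\<lambda>i. y ^ i))"
  then show "\<exists>g. poly_over K g \<and> w = poly g y"
  proof induction
    case zero
    then show ?case using assms by (intro exI[of _ 0]) (auto simp: poly_over_def subfield_intros)
  next
    case (step v c s)
    then obtain g i where "poly_over K g" "v = poly g y" "s = y ^ i" by blast
    then show ?case using step(2) assms
      by (intro exI[of _ "monom c i + g"])
         (auto simp: poly_monom poly_over_def intro!: subfield_intros)
  qed
next
  assume "\<exists>g. poly_over K g \<and> w = poly g y"
  then show "w \<in> kspan K (range (\<lambda>i. y ^ i))" using assms
    unfolding poly_altdef poly_over_def
    by (auto intro!: kspan_sum kspan_scale[OF kspan_base])
qed

text \<open>The polynomial \<open>g(X ^ p) - X\<close> vanishes at \<open>z\<close> and has
  derivative \<open>- 1\<close>, so it has no multiple root.\<close>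

lemma separable_overI_frobenius:
  fixes z :: "'a::field"
  assumes "is_subfield K" "prime CHAR('a)" "poly_over K g" "z = poly g (z ^ CHAR('a))"
  shows "separable_over K z"
proof -
  let ?p = "CHAR('a)"
  define f where "f = pcompose g (monom 1 ?p) - monom 1 1"
  have "pderiv (monom (1::'a) ?p) = 0" by (simp add: pderiv_monom)
  then have d: "pderiv f = - 1"
    by (simp add: f_def pderiv_diff pderiv_pcompose pderiv_monom monom_0 one_pCons)
  have "f \<noteq> 0" using d by auto
  then have "separable_poly f" using d by (auto simp: separable_poly_def)
  moreover have "poly f z = 0"
    using assms(4) by (simp add: f_def poly_pcompose poly_monom)
  moreover have "poly_over K f"
  proof -
    have "pcompose g (monom 1 ?p) = (\<Sum>i\<le>degree g. monom (coeff g i) (?p * i))"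
      by (simp add: pcompose_altdef poly_altdef monom_power smult_monom mult.commute
          flip: smult_conv_map_poly)
        (simp add: degree_map_poly coeff_map_poly monom_power smult_monom)
    then show ?thesis using assms(1,3) unfolding f_def
      by (auto simp: poly_over_def coeff_sum intro!: subfield_intros)
  qed
  ultimately show ?thesis by (auto simp: separable_over_def)
qed

context alg_ext
begin

lemma min_poly_exists:
  assumes "is_subfield F" "K \<subseteq> F"
  shows "\<exists>q. poly_over F q \<and> q \<noteq> 0 \<and> poly q x = 0 \<and>
    (\<forall>p. poly_over F p \<longrightarrow> p \<noteq> 0 \<longrightarrow> poly p x = 0 \<longrightarrow> degree q \<le> degree p)"
proof -
  have "Id_on K \<subseteq> Id_on F" using assms(2) by (auto simp: Id_on_def)
  from min_poly_pair_exists[OF hom_graph_Id_on[OF assms(1)] this, of x]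
  show ?thesis by (auto simp: poly_pair_Id_on)
qed

lemma conjugate_exists:
  assumes "is_subfield F" "K \<subseteq> F" "poly_over F q" "q \<noteq> 0" "poly q x = 0"
    "\<forall>p. poly_over F p \<longrightarrow> p \<noteq> 0 \<longrightarrow> poly p x = 0 \<longrightarrow> degree q \<le> degree p" "poly q y = 0"
  shows "\<exists>\<sigma>\<in>rel_auts UNIV F. \<sigma> x = y"
proof -
  have KF: "Id_on K \<subseteq> Id_on F" using assms(2) by (auto simp: Id_on_def)
  have "\<exists>\<Delta>. hom_graph \<Delta> \<and> Id_on F \<subseteq> \<Delta> \<and> (x, y) \<in> \<Delta>"
    by (rule hom_graph_step[OF hom_graph_Id_on[OF assms(1)] KF subfield_K algebraic_K _ assms(4,5,7)])
       (use assms(3,6) in \<open>auto simp: poly_pair_Id_on\<close>)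
  then obtain \<Delta> where D: "hom_graph \<Delta>" "Id_on F \<subseteq> \<Delta>" "(x, y) \<in> \<Delta>" by blast
  have "Id_on K \<subseteq> \<Delta>" using D KF by blast
  from hom_graph_extend[OF D(1) this] obtain \<sigma> where s: "\<sigma> \<in> Gal" "\<And>x y. (x, y) \<in> \<Delta> \<Longrightarrow> \<sigma> x = y" by fast
  then have "\<sigma> \<in> rel_auts UNIV F" using D(2) by (auto simp: rel_auts_def)
  then show ?thesis using s D by blast
qed

text \<open>All roots of the minimal polynomial of \<open>x\<close> over \<open>F\<close> are
  conjugate to \<open>x\<close>, hence equal to \<open>x\<close>. If its degree exceeded one,
  \<open>[:- x, 1:]\<close> would divide it twice, and would then divide twice every polynomial over
  \<open>F\<close> vanishing at \<open>x\<close>, including a separable one.\<close>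

lemma separable_fixed:
  assumes F: "is_subfield F" "K \<subseteq> F" and x: "separable_over F x"
    and fixed: "\<And>\<sigma>. \<sigma> \<in> rel_auts UNIV F \<Longrightarrow> \<sigma> x = x"
  shows "x \<in> F"
proof -
  obtain q where q: "poly_over F q" "q \<noteq> 0" "poly q x = 0"
    "\<forall>p. poly_over F p \<longrightarrow> p \<noteq> 0 \<longrightarrow> poly p x = 0 \<longrightarrow> degree q \<le> degree p"
    using min_poly_exists[OF F] by blast
  have only: "y = x" if "poly q y = 0" for y
    using conjugate_exists[OF F q that] fixed by blast
  obtain g where g: "q = [:- x, 1:] * g" using q(3) by (auto simp: poly_eq_0_iff_dvd)
  then have g0: "g \<noteq> 0" using q(2) by auto
  show ?thesis
  proof (cases "degree g = 0")
    case True
    then obtain b where b: "g = [:b:]" by (rule degree_eq_zeroE)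
    have "coeff q 0 = - x * b" "coeff q 1 = b" "b \<noteq> 0" using g b g0 by auto
    then have "x = - (coeff q 0 / coeff q 1)" by simp
    also have "\<dots> \<in> F" using q(1) F(1) by (auto simp: poly_over_def intro!: subfield_intros)
    finally show ?thesis .
  next
    case False
    then obtain y where "poly g y = 0" using root_exists by blast
    moreover from this have "y = x" using only g by simp
    ultimately obtain h where h: "g = [:- x, 1:] * h" by (auto simp: poly_eq_0_iff_dvd)
    obtain f where f: "poly_over F f" "separable_poly f" "poly f x = 0"
      using x by (auto simp: separable_over_def)
    have "\<exists>s s'. poly_pair (Id_on F) s s' \<and> f = q * s \<and> f = q * s'"
      by (rule poly_pair_dvd[OF hom_graph_Id_on[OF F(1)] _ q(2,3)])
         (use q f in \<open>auto simp: poly_pair_Id_on\<close>)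
    then obtain s where "f = q * s" by blast
    then have "f = [:- x, 1:] * ([:- x, 1:] * (h * s))" using g h by (simp only: mult.assoc)
    then have "poly (pderiv f) x = 0"
      by (simp only: pderiv_mult) (simp del: mult_pCons_left mult_pCons_right)
    then show ?thesis using f by (auto simp: separable_poly_def)
  qed
qed

text \<open>An inverse is a polynomial in the element with coefficients in \<open>K\<close>, since
  everything is algebraic over \<open>K\<close>.\<close>

lemma subring_is_subfield:
  assumes "K \<subseteq> A" "\<And>x y. x \<in> A \<Longrightarrow> y \<in> A \<Longrightarrow> x - y \<in> A" "\<And>x y. x \<in> A \<Longrightarrow> y \<in> A \<Longrightarrow> x * y \<in> A"
  shows "is_subfield A"
proof (rule subfieldI)
  show one: "1 \<in> A" using assms(1) subfield_one[OF subfield_K] by blast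
  fix y assume y: "y \<in> A" "y \<noteq> 0"
  obtain c k where ck: "c \<noteq> 0" "poly_over K (pCons c k)" "poly (pCons c k) y = 0"
    using algebraic_const_coeff[of K y] algebraic_K y(2) by blast
  have cK: "coeff (pCons c k) i \<in> K" for i using ck(2) by (auto simp: poly_over_def)
  have c: "c \<in> K" "coeff k i \<in> K" for i using cK[of 0] cK[of "Suc i"] by auto
  have z: "0 \<in> A" using assms(2)[OF one one] by simp
  have add: "x + y \<in> A" if "x \<in> A" "y \<in> A" for x y
    using assms(2)[OF that(1) assms(2)[OF z that(2)]] by simp
  have pow: "y ^ n \<in> A" for n by (induction n) (auto simp: one y assms(3))
  have "sum (\<lambda>i. coeff k i * y ^ i) B \<in> A" for B
    by (induction B rule: infinite_finite_induct)
       (use z assms(1) c in \<open>auto intro!: add assms(3) pow\<close>)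
  then have "poly k y \<in> A" by (simp add: poly_altdef)
  moreover have "- inverse c \<in> A" using subfield_uminus[OF subfield_K subfield_inverse[OF subfield_K c(1)]] assms(1) by blast
  moreover have "inverse y = poly k y * (- inverse c)"
    using ck inverse_of_root[of y "poly k y" c] by (simp add: eq_neg_iff_add_eq_0 add.commute)
  ultimately show "inverse y \<in> A" using assms(3) by (simp only:)
qed (use assms in auto)

lemma kspan_subfield:
  assumes "1 \<in> S" "\<And>s t. s \<in> S \<Longrightarrow> t \<in> S \<Longrightarrow> s * t \<in> S"
  shows "is_subfield (kspan K S)" "K \<subseteq> kspan K S"
proof -
  show K: "K \<subseteq> kspan K S"
  proof
    fix c assume "c \<in> K"
    then have "c * 1 + 0 \<in> kspan K S" using assms(1) by (intro kspan.intros)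
    then show "c \<in> kspan K S" by simp
  qed
  show "is_subfield (kspan K S)"
  proof (rule subring_is_subfield[OF K])
    fix x y assume "x \<in> kspan K S" "y \<in> kspan K S"
    then have "x + (- 1) * y \<in> kspan K S"
      by (intro kspan_add kspan_scale subfield_intros subfield_K)
    then show "x - y \<in> kspan K S" by simp
  next
    fix x y assume "x \<in> kspan K S" "y \<in> kspan K S"
    then show "x * y \<in> kspan K S"
      by (rule kspan_mult[OF subfield_K]) (auto intro: kspan_base subfield_K assms)
  qed
qed

lemma powers_finite_span: "\<exists>n. \<forall>i. y ^ i \<in> kspan K ((\<lambda>j. y ^ j) ` {..<n})"
proof -
  obtain q where q: "q \<noteq> 0" "poly_over K q" "poly q y = 0"
    using algebraic_K by (auto simp: algebraic_over_def)
  define n where "n = degree q"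
  let ?S = "kspan K ((\<lambda>j. y ^ j) ` {..<n})"
  have qn: "coeff q n \<noteq> 0" using q(1) by (simp add: n_def)
  have "(\<Sum>j<n. coeff q j * y ^ j) + coeff q n * y ^ n = 0"
    using q(3) by (simp add: poly_altdef n_def lessThan_Suc_atMost[symmetric])
  then have "y ^ n = (\<Sum>j<n. (- coeff q j / coeff q n) * y ^ j)"
    using qn by (simp add: sum_negf sum_divide_distrib[symmetric] field_simps eq_neg_iff_add_eq_0)
  also have "\<dots> \<in> ?S"
    using q(2) subfield_K
    by (intro kspan_sum kspan_scale[OF kspan_base] subfield_divide subfield_uminus)
      (auto simp: poly_over_def)
  finally have yn: "y ^ n \<in> ?S" .
  have "y ^ i \<in> ?S" for i
  proof (induction i)
    case 0
    show ?case
    proof (cases "n = 0")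
      case False
      then show ?thesis by (intro kspan_base[OF subfield_K] imageI) simp
    qed (use yn in simp)
  next
    case (Suc i)
    have "y \<in> kspan K {y}" by (auto intro: kspan_base subfield_K)
    then have "y * y ^ i \<in> ?S" using Suc
    proof (rule kspan_mult[OF subfield_K])
      fix s t assume "s \<in> {y}" "t \<in> (\<lambda>j. y ^ j) ` {..<n}"
      then obtain j where j: "j < n" "s * t = y ^ Suc j" by auto
      then show "s * t \<in> ?S"
      proof (cases "Suc j = n")
        case False
        then have "y ^ Suc j \<in> ?S" using j by (intro kspan_base[OF subfield_K] imageI) simp
        then show ?thesis using j by simp
      qed (use j yn in auto)
    qed
    then show ?case by simp
  qed
  then show ?thesis by blast
qed

text \<open>Over \<open>K(x ^ p)\<close> the element \<open>x\<close> is still separable, while an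
  automorphism fixing \<open>x ^ p\<close> also fixes \<open>x\<close> because Frobenius is
  injective. So \<open>separable_fixed\<close> applies to this field.\<close>

lemma separable_frobenius:
  assumes x: "separable_over K x" and p: "prime CHAR('a)"
  shows "x \<in> kspan K (range (\<lambda>i. (x ^ CHAR('a)) ^ i))" (is "_ \<in> ?F")
proof (rule separable_fixed)
  show F: "is_subfield ?F" and KF: "K \<subseteq> ?F"
    by (rule kspan_subfield; force simp: power_add[symmetric] intro: range_eqI[of _ _ 0])+
  show "separable_over ?F x"
    using x KF by (auto simp: separable_over_def intro: poly_over_mono)
  fix \<sigma> assume s: "\<sigma> \<in> rel_auts UNIV ?F"
  have "x ^ CHAR('a) \<in> ?F" by (rule kspan_base[OF subfield_K]) (auto intro: range_eqI[of _ _ 1])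
  then have "\<sigma> (x ^ CHAR('a)) = x ^ CHAR('a)" using s by (auto simp: rel_auts_def)
  moreover have one: "\<sigma> 1 = 1" using s subfield_one[OF F] by (auto simp: rel_auts_def)
  have "\<sigma> (x ^ n) = \<sigma> x ^ n" for n
    by (induction n) (use s one in \<open>auto simp: rel_auts_def\<close>)
  ultimately have e: "(\<sigma> x) ^ CHAR('a) = x ^ CHAR('a)" by simp
  have "((\<sigma> x - x) + x) ^ CHAR('a) = (\<sigma> x - x) ^ CHAR('a) + x ^ CHAR('a)"
    by (rule freshmans_dream[OF p refl])
  then have "(\<sigma> x - x) ^ CHAR('a) = 0" using e by simp
  then show "\<sigma> x = x" by simp
qed


section \<open>Arithmetic of automorphisms over \<open>K\<close>\<close>

lemma Gal_add: "\<sigma> \<in> Gal \<Longrightarrow> \<sigma> (x + y) = \<sigma> x + \<sigma> y"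
  and Gal_mult: "\<sigma> \<in> Gal \<Longrightarrow> \<sigma> (x * y) = \<sigma> x * \<sigma> y"
  and Gal_fix: "\<sigma> \<in> Gal \<Longrightarrow> c \<in> K \<Longrightarrow> \<sigma> c = c"
  and Gal_bij: "\<sigma> \<in> Gal \<Longrightarrow> bij \<sigma>"
  by (auto simp: rel_auts_def)

lemma Gal_0: "\<sigma> \<in> Gal \<Longrightarrow> \<sigma> 0 = 0"
  and Gal_1: "\<sigma> \<in> Gal \<Longrightarrow> \<sigma> 1 = 1"
  using Gal_fix subfield_zero[OF subfield_K] subfield_one[OF subfield_K] by auto

lemma Gal_inj: "\<sigma> \<in> Gal \<Longrightarrow> \<sigma> x = \<sigma> y \<longleftrightarrow> x = y"
  using Gal_bij by (metis bij_is_inj injD)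

lemma Gal_eq_0: "\<sigma> \<in> Gal \<Longrightarrow> \<sigma> x = 0 \<longleftrightarrow> x = 0"
  using Gal_inj[of \<sigma> x 0] by (simp add: Gal_0)

lemma Gal_uminus: "\<sigma> \<in> Gal \<Longrightarrow> \<sigma> (- x) = - \<sigma> x"
  using Gal_add[of \<sigma> x "- x"] by (simp add: Gal_0 eq_neg_iff_add_eq_0 add.commute)

lemma Gal_diff: "\<sigma> \<in> Gal \<Longrightarrow> \<sigma> (x - y) = \<sigma> x - \<sigma> y"
  using Gal_add[of \<sigma> x "- y"] by (simp add: Gal_uminus)

lemma Gal_inverse: "\<sigma> \<in> Gal \<Longrightarrow> \<sigma> (inverse x) = inverse (\<sigma> x)"
  by (cases "x = 0")
     (simp_all add: Gal_0, metis Gal_1 Gal_mult inverse_unique right_inverse)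

lemma Gal_divide: "\<sigma> \<in> Gal \<Longrightarrow> \<sigma> (x / y) = \<sigma> x / \<sigma> y"
  by (simp add: divide_inverse Gal_mult Gal_inverse)

lemma Gal_power: "\<sigma> \<in> Gal \<Longrightarrow> \<sigma> (x ^ n) = \<sigma> x ^ n"
  by (induction n) (simp_all add: Gal_1 Gal_mult)

lemma Gal_sum: "\<sigma> \<in> Gal \<Longrightarrow> \<sigma> (sum f A) = (\<Sum>i\<in>A. \<sigma> (f i))"
  by (induction A rule: infinite_finite_induct) (simp_all add: Gal_0 Gal_add)

lemma Gal_prod: "\<sigma> \<in> Gal \<Longrightarrow> \<sigma> (prod f A) = (\<Prod>i\<in>A. \<sigma> (f i))"
  by (induction A rule: infinite_finite_induct) (simp_all add: Gal_1 Gal_mult)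

lemma Gal_poly: "\<sigma> \<in> Gal \<Longrightarrow> poly_over K p \<Longrightarrow> \<sigma> (poly p x) = poly p (\<sigma> x)"
  by (simp add: poly_altdef Gal_sum Gal_mult Gal_power Gal_fix poly_over_def)

lemmas Gal_simps = Gal_add Gal_mult Gal_fix Gal_0 Gal_1 Gal_inj Gal_eq_0 Gal_uminus Gal_diff
  Gal_inverse Gal_divide Gal_power Gal_sum Gal_prod

lemma Gal_comp: "\<sigma> \<in> Gal \<Longrightarrow> \<tau> \<in> Gal \<Longrightarrow> \<sigma> \<circ> \<tau> \<in> Gal"
  by (auto simp: rel_auts_def intro: bij_betw_trans)

lemma Gal_id: "id \<in> Gal"
  by (auto simp: rel_auts_def)

lemma Gal_inv: 
  assumes s: "\<sigma> \<in> Gal"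
  shows "inv \<sigma> \<in> Gal" "\<sigma> (inv \<sigma> x) = x" "inv \<sigma> (\<sigma> x) = x"
proof -
  have b: "bij \<sigma>" by (rule Gal_bij[OF s])
  then show 1: "\<sigma> (inv \<sigma> x) = x" "inv \<sigma> (\<sigma> x) = x" for x
    by (auto simp: bij_is_surj surj_f_inv_f bij_is_inj)
  have e: "inv \<sigma> y = x" if "\<sigma> x = y" for x y using that 1 by auto
  have "inv \<sigma> (x + y) = inv \<sigma> x + inv \<sigma> y" "inv \<sigma> (x * y) = inv \<sigma> x * inv \<sigma> y" for x y
    by (rule e, simp only: Gal_add[OF s] Gal_mult[OF s] 1)+
  moreover have "inv \<sigma> c = c" if "c \<in> K" for c by (rule e) (rule Gal_fix[OF s that])
  ultimately show "inv \<sigma> \<in> Gal"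
    using bij_imp_bij_inv[OF b] by (simp add: rel_auts_def)
qed

lemma finite_orbit: "finite {\<sigma> x |\<sigma>. \<sigma> \<in> Gal}"
proof -
  obtain q where q: "q \<noteq> 0" "poly_over K q" "poly q x = 0"
    using algebraic_K by (auto simp: algebraic_over_def)
  have "{\<sigma> x |\<sigma>. \<sigma> \<in> Gal} \<subseteq> {y. poly q y = 0}"
    using q Gal_poly[OF _ q(2), of _ x] by (auto simp: Gal_0)
  then show ?thesis using poly_roots_finite[OF q(1)] finite_subset by blast
qed

lemma separable_char_0:
  assumes "CHAR('a) = 0"
  shows "separable_over K z"
proof -
  obtain q where q: "poly_over K q" "q \<noteq> 0" "poly q z = 0"
    "\<forall>p. poly_over K p \<longrightarrow> p \<noteq> 0 \<longrightarrow> poly p z = 0 \<longrightarrow> degree q \<le> degree p"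
    using min_poly_exists[OF subfield_K order_refl] by blast
  have "degree q \<noteq> 0"
  proof
    assume "degree q = 0"
    then obtain c where "q = [:c:]" by (rule degree_eq_zeroE)
    then show False using q by simp
  qed
  then obtain n where n: "degree q = Suc n" by (cases "degree q") auto
  have "coeff (pderiv q) n \<noteq> 0"
  proof -
    have "coeff q (Suc n) \<noteq> 0" using q(2) n by (metis leading_coeff_0_iff)
    moreover have "of_nat (Suc n) \<noteq> (0::'a)" by (simp only: of_nat_eq_0_iff_char_dvd assms) simp
    ultimately show ?thesis by (simp add: coeff_pderiv del: of_nat_Suc)
  qed
  then have d0: "pderiv q \<noteq> 0" by auto
  have "degree (pderiv q) \<le> n"
    by (rule degree_le) (auto simp: coeff_pderiv coeff_eq_0 n)
  moreover have dK: "poly_over K (pderiv q)"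
    using q(1) subfield_K by (auto simp: poly_over_def coeff_pderiv simp del: of_nat_Suc intro!: subfield_intros)
  ultimately have z: "poly (pderiv q) z \<noteq> 0" using q(4) d0 n by fastforce
  have "poly (pderiv q) y \<noteq> 0" if y: "poly q y = 0" for y
  proof -
    obtain \<sigma> where "\<sigma> \<in> Gal" "\<sigma> z = y"
      using conjugate_exists[OF subfield_K order_refl q y] by blast
    then show ?thesis using z Gal_poly[OF _ dK, of \<sigma> z] by (auto simp: Gal_eq_0)
  qed
  then show ?thesis using q by (auto simp: separable_over_def separable_poly_def)
qed

text \<open>In characteristic \<open>p\<close>, \<open>A = K(x, y)\<close> is spanned by \<open>p\<close>-th powers. If \<open>z\<close> were
  not in \<open>K(z\<^sup>p)\<close>, then Frobenius applied to \<open>A = K(z) + \<langle>L\<rangle>\<close> would give a complement of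
  \<open>K(z)\<close> smaller than \<open>L\<close>.\<close>
lemma separable_adjoin_two:
  assumes x: "separable_over K x" and y: "separable_over K y"
    and z: "z \<in> kspan K {x ^ i * y ^ j |i j. True}"
  shows "separable_over K z"
proof (cases "CHAR('a) = 0")
  case True
  then show ?thesis by (rule separable_char_0)
next
  case False
  then have p: "prime CHAR('a)" using prime_CHAR_semidom[where 'a='a] by simp
  let ?p = "CHAR('a)"
  let ?A = "kspan K {x ^ i * y ^ j |i j. True}"
  let ?B = "kspan K (range (\<lambda>i. z ^ i))"
  let ?C = "kspan K (range (\<lambda>i. (z ^ ?p) ^ i))"
  note Ksub = subfield_K
  obtain n where n: "\<And>i. x ^ i \<in> kspan K ((\<lambda>j. x ^ j) ` {..<n})" using powers_finite_span by blast
  obtain m where m: "\<And>i. y ^ i \<in> kspan K ((\<lambda>j. y ^ j) ` {..<m})" using powers_finite_span by blast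
  define T where "T = (\<lambda>(i, j). x ^ i * y ^ j) ` ({..<n} \<times> {..<m})"
  have AT: "?A \<subseteq> kspan K T"
  proof
    fix a assume "a \<in> ?A"
    then show "a \<in> kspan K T"
    proof (rule kspan_minimal[OF Ksub])
      have "x ^ i * y ^ j \<in> kspan K T" for i j
        by (rule kspan_mult[OF Ksub n m]) (auto simp: T_def intro!: kspan_base[OF Ksub])
      then show "{x ^ i * y ^ j |i j. True} \<subseteq> kspan K T" by blast
    qed
  qed
  define P where "P L \<longleftrightarrow> finite L \<and> ?A \<subseteq> kspan K (?B \<union> L)" for L
  have "P T" using AT kspan_mono[of T "?B \<union> T" K] by (auto simp: P_def T_def)
  then obtain L where L: "P L" and min: "\<And>L'. P L' \<Longrightarrow> card L \<le> card L'"
    using ex_has_least_nat[of P T card] by blast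
  have BC: "b ^ ?p \<in> ?C" if "b \<in> ?B" for b
    using that
  proof induction
    case (step v c s)
    obtain i where i: "s = z ^ i" using step.hyps(3) by blast
    have "s ^ ?p = (z ^ ?p) ^ i" by (simp add: i power_mult[symmetric] mult.commute)
    then have "s ^ ?p \<in> ?C" by (auto intro!: kspan_base[OF Ksub])
    moreover have "(c * s + v) ^ ?p = c ^ ?p * s ^ ?p + v ^ ?p"
      by (simp add: freshmans_dream[OF p refl] power_mult_distrib)
    ultimately show ?case
      using step.IH kspan_add kspan_scale[OF _ Ksub] subfield_power[OF Ksub step.hyps(2)] by metis
  qed (use p in \<open>auto simp: prime_gt_0_nat power_0_left intro: kspan.zero\<close>)
  have Bp: "b ^ ?p \<in> kspan K (?C \<union> (\<lambda>l. l ^ ?p) ` L)" if "b \<in> kspan K (?B \<union> L)" for b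
    using that
  proof induction
    case (step v c s)
    have "s ^ ?p \<in> kspan K (?C \<union> (\<lambda>l. l ^ ?p) ` L)"
      using step.hyps(3) BC by (intro kspan_base[OF Ksub]) auto
    moreover have "(c * s + v) ^ ?p = c ^ ?p * s ^ ?p + v ^ ?p"
      by (simp add: freshmans_dream[OF p refl] power_mult_distrib)
    ultimately show ?case
      using step.IH kspan_add kspan_scale[OF _ Ksub] subfield_power[OF Ksub step.hyps(2)] by metis
  qed (use p in \<open>auto simp: prime_gt_0_nat power_0_left intro: kspan.zero\<close>)
  \<comment> \<open>Each of \<open>x\<close> and \<open>y\<close> is a polynomial in its own
    \<open>p\<close>-th power, by \<open>separable_frobenius\<close>, and products of such powers
    are again \<open>p\<close>-th powers.\<close>
  have gen: "x ^ i * y ^ j \<in> kspan K {a ^ ?p |a. a \<in> ?A}" for i j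
  proof -
    have pw: "u ^ i \<in> kspan K (range (\<lambda>i. (u ^ ?p) ^ i))" if "separable_over K u" for u i
    proof -
      have "is_subfield (kspan K (range (\<lambda>i. (u ^ ?p) ^ i)))"
        by (rule kspan_subfield(1); force simp: power_add[symmetric] intro: range_eqI[of _ _ 0])
      then show ?thesis by (intro subfield_power separable_frobenius[OF that p])
    qed
    show ?thesis
    proof (rule kspan_mult[OF Ksub pw[OF x] pw[OF y]])
      fix s t assume "s \<in> range (\<lambda>i. (x ^ ?p) ^ i)" "t \<in> range (\<lambda>i. (y ^ ?p) ^ i)"
      then obtain k l where "s = (x ^ ?p) ^ k" "t = (y ^ ?p) ^ l" by blast
      then have "s * t = (x ^ k * y ^ l) ^ ?p"
        by (simp add: power_mult_distrib power_mult[symmetric] mult.commute)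
      moreover have "x ^ k * y ^ l \<in> ?A" by (auto intro: kspan_base[OF Ksub])
      ultimately show "s * t \<in> kspan K {a ^ ?p |a. a \<in> ?A}" by (auto intro!: kspan_base[OF Ksub])
    qed
  qed
  have A2: "a \<in> kspan K (?C \<union> (\<lambda>l. l ^ ?p) ` L)" if "a \<in> ?A" for a
  proof -
    have "a \<in> kspan K {a ^ ?p |a. a \<in> ?A}"
      using that by (rule kspan_minimal[OF Ksub]) (use gen in blast)
    then show ?thesis
      by (rule kspan_minimal[OF Ksub]) (use Bp L in \<open>auto simp: P_def\<close>)
  qed
  have CB: "?C \<subseteq> ?B"
    by (rule kspan_mono) (auto simp: power_mult[symmetric])
  have zB: "z \<in> ?B" by (rule kspan_base[OF Ksub]) (auto intro: range_eqI[of _ _ 1])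
  have "z \<in> ?C"
  proof (rule ccontr)
    assume zC: "z \<notin> ?C"
    let ?L = "(\<lambda>l. l ^ ?p) ` L"
    have fL: "finite ?L" using L by (simp add: P_def)
    have "z \<notin> kspan K ?C" using zC kspan_minimal[OF Ksub, of z ?C "range (\<lambda>i. (z ^ ?p) ^ i)"] by blast
    \<comment> \<open>\<open>?A\<close> lies in the span of \<open>?C\<close> and the
      \<open>p\<close>-th powers of \<open>L\<close>. Since \<open>z\<close> lies outside
      \<open>?C\<close> but inside \<open>?B\<close>, it can replace one of these powers.\<close>
    from kspan_exchange[OF Ksub fL A2[OF z] this] obtain l where
      l: "l \<in> ?L" "?L \<subseteq> kspan K (insert z (?C \<union> (?L - {l})))" by blast
    have "insert z (?C \<union> (?L - {l})) \<subseteq> ?B \<union> (?L - {l})" using CB zB by blast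
    from kspan_mono[OF this] have L2: "?L \<subseteq> kspan K (?B \<union> (?L - {l}))" using l(2) by blast
    have "a \<in> kspan K (?B \<union> (?L - {l}))" if "a \<in> ?A" for a
      using A2[OF that]
      by (rule kspan_minimal[OF Ksub]) (use L2 CB in \<open>auto intro: kspan_base[OF Ksub]\<close>)
    then have "P (?L - {l})" using fL by (auto simp: P_def)
    then have "card L \<le> card (?L - {l})" by (rule min)
    also have "\<dots> < card ?L" using l(1) fL by (meson card_Diff1_less)
    also have "\<dots> \<le> card L" using L by (simp add: P_def card_image_le)
    finally show False by simp
  qed
  then obtain g where "poly_over K g" "z = poly g (z ^ ?p)"
    using kspan_powers[OF Ksub] by blast
  then show ?thesis by (intro separable_overI_frobenius[OF Ksub p])
qed

section \<open>The separable closure as a Galois extension\<close>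

abbreviation "W \<equiv> sep_closure K"

lemma K_sub_W: "K \<subseteq> W"
proof
  fix c assume "c \<in> K"
  then have "poly_over K [:- c, 1:]"
    using subfield_K by (auto simp: poly_over_def coeff_pCons intro!: subfield_intros split: nat.split)
  moreover have "separable_poly [:- c, 1:]" by (auto simp: separable_poly_def pderiv_pCons)
  ultimately show "c \<in> W" unfolding sep_closure_def separable_over_def mem_Collect_eq
    by (intro exI[of _ "[:- c, 1:]"]) simp
qed

lemma subfield_W: "is_subfield W"
proof -
  have two: "z \<in> W" if "x \<in> W" "y \<in> W" "z \<in> kspan K {x ^ i * y ^ j |i j. True}" for x y z
    using that separable_adjoin_two[of x y z] unfolding sep_closure_def mem_Collect_eq by blast
  have mem: "x ^ i * y ^ j \<in> kspan K {x ^ i * y ^ j |i j. True}" for x y i j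
    by (auto intro: kspan_base[OF subfield_K])
  show ?thesis
  proof (rule subring_is_subfield[OF K_sub_W])
    fix x y assume xy: "x \<in> W" "y \<in> W"
    have "x + (- 1) * y \<in> kspan K {x ^ i * y ^ j |i j. True}"
      using mem[of x 1 y 0] mem[of x 0 y 1] subfield_K
      by (intro kspan_add kspan_scale) (auto intro: subfield_intros)
    then have "x + (- 1) * y \<in> W" by (rule two[OF xy])
    then show "x - y \<in> W" by simp
    show "x * y \<in> W" using mem[of x 1 y 1] by (intro two[OF xy]) simp
  qed
qed

lemma Gal_W: "\<sigma> \<in> Gal \<Longrightarrow> x \<in> W \<Longrightarrow> \<sigma> x \<in> W"
proof -
  assume s: "\<sigma> \<in> Gal" and x: "x \<in> W"
  then obtain q where q: "poly_over K q" "separable_poly q" "poly q x = 0"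
    by (auto simp: sep_closure_def separable_over_def)
  then have "poly q (\<sigma> x) = 0" using Gal_poly[OF s q(1), of x] by (simp add: Gal_0 s)
  then show "\<sigma> x \<in> W" using q by (auto simp: sep_closure_def separable_over_def)
qed

lemma fixed_in_K: "x \<in> W \<Longrightarrow> (\<And>\<sigma>. \<sigma> \<in> Gal \<Longrightarrow> \<sigma> x = x) \<Longrightarrow> x \<in> K"
  using separable_fixed[OF subfield_K order_refl] by (simp add: sep_closure_def)

text \<open>Elements of \<open>ram_group\<close> are controlled only on \<open>W\<close>. This
  replaces them by automorphisms of the whole ambient field, for which the rules of
  \<open>Gal\<close> are available.\<close>

lemma rel_auts_W_extend:
  assumes s: "\<sigma> \<in> rel_auts W K"
  shows "\<exists>\<tau>\<in>Gal. \<forall>x\<in>W. \<tau> x = \<sigma> x"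
proof -
  have add: "\<sigma> (x + y) = \<sigma> x + \<sigma> y" and mult: "\<sigma> (x * y) = \<sigma> x * \<sigma> y"
    if "x \<in> W" "y \<in> W" for x y using s that by (auto simp: rel_auts_def)
  have fixK: "\<sigma> c = c" if "c \<in> K" for c using s that by (auto simp: rel_auts_def)
  have inj: "inj_on \<sigma> W" using s by (auto simp: rel_auts_def bij_betw_def)
  have W0: "0 \<in> W" "1 \<in> W" using subfield_W by (auto intro: subfield_intros)
  have s0: "\<sigma> 0 = 0" "\<sigma> 1 = 1" using fixK subfield_K by (auto intro: subfield_intros)
  have diff: "\<sigma> (x - y) = \<sigma> x - \<sigma> y" if "x \<in> W" "y \<in> W" for x y
    using add[OF subfield_diff[OF subfield_W that] that(2)] by simp
  have inv: "\<sigma> (inverse x) = inverse (\<sigma> x)" if "x \<in> W" for x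
  proof (cases "x = 0")
    case False
    then have "\<sigma> x * \<sigma> (inverse x) = 1"
      using mult[OF that subfield_inverse[OF subfield_W that]] s0 by simp
    then show ?thesis by (metis inverse_unique)
  qed (simp add: s0)
  define \<Gamma> where "\<Gamma> = {(x, \<sigma> x) |x. x \<in> W}"
  have "hom_graph \<Gamma>"
    unfolding hom_graph_def \<Gamma>_def
    using W0 s0 subfield_W
    by (auto simp: add[symmetric] diff[symmetric] mult[symmetric] inv[symmetric] intro: subfield_intros)
  moreover have "Id_on K \<subseteq> \<Gamma>" using K_sub_W fixK by (force simp: \<Gamma>_def)
  ultimately obtain \<tau> where "\<tau> \<in> Gal" "\<forall>(x, y)\<in>\<Gamma>. \<tau> x = y" using hom_graph_extend by blast
  then show ?thesis by (intro bexI[of _ \<tau>]) (auto simp: \<Gamma>_def)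
qed

end

section \<open>Valuation rings\<close>

definition geom :: "nat \<Rightarrow> 'a::field \<Rightarrow> 'a" where
  "geom k x = (\<Sum>i<k. x ^ i)"

lemma geom_simps: "geom 0 x = 0" "geom (Suc k) x = geom k x + x ^ k"
  by (simp_all add: geom_def)

lemma geom_add: "geom (a + b) x = geom a x + x ^ a * geom b x"
  by (induction b) (simp_all add: geom_simps algebra_simps power_add)

lemma geom_Suc_left: "geom (Suc k) x = 1 + x * geom k x"
  using geom_add[of 1 k x] by (simp add: geom_simps)

lemma geom_reflect: "x \<noteq> 0 \<Longrightarrow> geom (Suc n) x = x ^ n * geom (Suc n) (inverse x)"
proof (induction n)
  case (Suc n)
  have "geom (Suc (Suc n)) x = x ^ n * geom (Suc n) (inverse x) + x ^ Suc n"
    unfolding geom_simps(2)[of "Suc n"] using Suc by simp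
  also have "\<dots> = x ^ Suc n * (1 + inverse x * geom (Suc n) (inverse x))"
    using Suc.prems by (simp add: algebra_simps)
  finally show ?case by (simp only: geom_Suc_left[of "Suc n"])
qed (simp add: geom_simps)

definition roots_poly :: "'a::field set \<Rightarrow> 'a poly" where
  "roots_poly Z = (\<Prod>\<zeta>\<in>Z. [:- \<zeta>, 1:])"

lemma poly_roots_poly: "poly (roots_poly Z) x = (\<Prod>\<zeta>\<in>Z. x - \<zeta>)"
  by (simp add: roots_poly_def poly_prod)

lemma roots_poly_insert:
  "finite Z \<Longrightarrow> a \<notin> Z \<Longrightarrow> roots_poly (insert a Z) = [:- a, 1:] * roots_poly Z"
  by (simp add: roots_poly_def del: mult_pCons_left)

lemma coeff_linear_mult:
  fixes a :: "'a::field"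
  shows "coeff ([:- a, 1:] * p) i = (case i of 0 \<Rightarrow> 0 | Suc j \<Rightarrow> coeff p j) - a * coeff p i"
  by (cases i) simp_all

lemma degree_roots_poly: "finite Z \<Longrightarrow> degree (roots_poly Z) = card Z"
  unfolding roots_poly_def by (subst degree_prod_eq_sum_degree) auto

lemma coeff_roots_poly_subfield:
  assumes "is_subfield F" "Z \<subseteq> F"
  shows "coeff (roots_poly Z) i \<in> F"
  using assms(2)
proof (induction Z arbitrary: i rule: infinite_finite_induct)
  case (insert a Z)
  then show ?case using assms(1)
    by (auto simp: roots_poly_insert coeff_linear_mult simp del: mult_pCons_left
        intro!: subfield_intros split: nat.split)
qed (use assms(1) in \<open>auto simp: roots_poly_def intro!: subfield_intros\<close>)

locale val_ring =
  fixes R :: "'a::field set"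
  assumes val: "valuation_ring R"
begin

abbreviation "\<mm> \<equiv> max_ideal R"

lemma R_0: "0 \<in> R" and R_1: "1 \<in> R"
  and R_add: "x \<in> R \<Longrightarrow> y \<in> R \<Longrightarrow> x + y \<in> R"
  and R_diff: "x \<in> R \<Longrightarrow> y \<in> R \<Longrightarrow> x - y \<in> R"
  and R_mult: "x \<in> R \<Longrightarrow> y \<in> R \<Longrightarrow> x * y \<in> R"
  and R_total: "x \<in> R \<or> inverse x \<in> R"
  using val by (auto simp: valuation_ring_def)

lemma R_uminus: "x \<in> R \<Longrightarrow> - x \<in> R"
  using R_diff[OF R_0, of x] by simp

lemma R_power: "x \<in> R \<Longrightarrow> x ^ n \<in> R"
  by (induction n) (auto intro: R_1 R_mult)

lemma R_sum: "(\<And>i. i \<in> A \<Longrightarrow> f i \<in> R) \<Longrightarrow> sum f A \<in> R"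
  by (induction A rule: infinite_finite_induct) (auto intro: R_0 R_add)

lemma R_prod: "(\<And>i. i \<in> A \<Longrightarrow> f i \<in> R) \<Longrightarrow> prod f A \<in> R"
  by (induction A rule: infinite_finite_induct) (auto intro: R_1 R_mult)

lemma R_of_nat: "of_nat n \<in> R"
  by (induction n) (auto intro: R_0 R_1 R_add)

lemma R_sum_list: "(\<And>x. x \<in> set l \<Longrightarrow> f x \<in> R) \<Longrightarrow> sum_list (map f l) \<in> R"
  by (induction l) (auto intro: R_0 R_add)

lemmas R_intros = R_0 R_1 R_add R_diff R_mult R_uminus R_power R_sum R_prod R_of_nat

lemma m_iff: "x \<in> \<mm> \<longleftrightarrow> x = 0 \<or> inverse x \<notin> R"
  using R_total[of x] R_0 by (auto simp: max_ideal_def)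

lemma m_R: "x \<in> \<mm> \<Longrightarrow> x \<in> R"
  by (simp add: max_ideal_def)

lemma notin_m: "x \<notin> \<mm> \<longleftrightarrow> x \<noteq> 0 \<and> inverse x \<in> R"
  by (auto simp: m_iff)

lemma notin_R: "x \<notin> R \<longleftrightarrow> x \<noteq> 0 \<and> inverse x \<in> \<mm>"
  using R_0 by (auto simp: m_iff)

lemma m_0: "0 \<in> \<mm>" and one_notin_m: "1 \<notin> \<mm>"
  using R_1 by (auto simp: m_iff)

lemma m_mult: "x \<in> \<mm> \<Longrightarrow> y \<in> R \<Longrightarrow> x * y \<in> \<mm>"
proof (rule ccontr)
  assume h: "x \<in> \<mm>" "y \<in> R" "x * y \<notin> \<mm>"
  then have "y * inverse (x * y) \<in> R" "x \<noteq> 0" "y \<noteq> 0" by (auto simp: notin_m intro: R_mult)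
  then have "inverse x \<in> R" by (simp add: field_simps)
  with h(1) \<open>x \<noteq> 0\<close> show False by (simp add: m_iff)
qed

lemma m_mult2: "x \<in> R \<Longrightarrow> y \<in> \<mm> \<Longrightarrow> x * y \<in> \<mm>"
  using m_mult[of y x] by (simp add: mult.commute)

lemma m_uminus: "x \<in> \<mm> \<Longrightarrow> - x \<in> \<mm>"
  using m_mult[of x "- 1"] by (simp add: R_uminus R_1)

lemma m_add:
  assumes "x \<in> \<mm>" "y \<in> \<mm>"
  shows "x + y \<in> \<mm>"
proof -
  have *: "u + w \<in> \<mm>" if "u \<in> \<mm>" "w / u \<in> R" "u \<noteq> 0" for u w
  proof -
    have "u + w = u * (1 + w / u)" using that by (simp add: field_simps)
    then show ?thesis using m_mult[OF that(1), of "1 + w / u"] that by (auto intro: R_intros)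
  qed
  show ?thesis
  proof (cases "x = 0 \<or> y = 0")
    case False
    then have "y / x \<in> R \<or> x / y \<in> R" using R_total[of "y / x"] by (auto simp: field_simps)
    then show ?thesis using *[of x y] *[of y x] assms False by (auto simp: add.commute)
  qed (use assms in auto)
qed

lemma m_diff: "x \<in> \<mm> \<Longrightarrow> y \<in> \<mm> \<Longrightarrow> x - y \<in> \<mm>"
  using m_add[of x "- y"] by (simp add: m_uminus)

lemma m_sum: "(\<And>i. i \<in> A \<Longrightarrow> f i \<in> \<mm>) \<Longrightarrow> sum f A \<in> \<mm>"
  by (induction A rule: infinite_finite_induct) (auto intro: m_0 m_add)

lemma m_sum_list: "(\<And>x. x \<in> set l \<Longrightarrow> f x \<in> \<mm>) \<Longrightarrow> sum_list (map f l) \<in> \<mm>"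
  by (induction l) (auto intro: m_0 m_add)

lemma notin_m_mult: "x \<notin> \<mm> \<Longrightarrow> y \<notin> \<mm> \<Longrightarrow> x * y \<notin> \<mm>"
  by (auto simp: notin_m intro: R_mult)

lemma notin_m_power: "x \<notin> \<mm> \<Longrightarrow> x ^ n \<notin> \<mm>"
  by (induction n) (simp_all add: notin_m_mult one_notin_m)

lemma notin_m_prod: "(\<And>i. i \<in> A \<Longrightarrow> f i \<notin> \<mm>) \<Longrightarrow> prod f A \<notin> \<mm>"
  by (induction A rule: infinite_finite_induct) (simp_all add: notin_m_mult one_notin_m)

lemma notin_m_add: "x \<notin> \<mm> \<Longrightarrow> y \<in> \<mm> \<Longrightarrow> x + y \<notin> \<mm>"
  using m_diff[of "x + y" y] by auto

lemma notin_m_cong: "x - y \<in> \<mm> \<Longrightarrow> x \<in> \<mm> \<longleftrightarrow> y \<in> \<mm>"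
  using m_add[of "x - y" y] m_diff[of x "x - y"] by auto

lemma m_prod:
  assumes "finite A" "i \<in> A" "f i \<in> \<mm>" "\<And>i. i \<in> A \<Longrightarrow> f i \<in> R"
  shows "prod f A \<in> \<mm>"
proof -
  have "prod f A = f i * prod f (A - {i})" using assms by (simp add: prod.remove)
  then show ?thesis using assms by (auto intro!: m_mult R_prod)
qed

lemma m_power: "x \<in> \<mm> \<Longrightarrow> n > 0 \<Longrightarrow> x ^ n \<in> \<mm>"
  by (cases n) (auto intro: m_mult R_power m_R)

lemma R_power_iff: "n > 0 \<Longrightarrow> x ^ n \<in> R \<longleftrightarrow> x \<in> R"
  using m_power[of "inverse x" n] notin_R[of x] notin_R[of "x ^ n"]
  by (auto simp: R_power power_inverse)

lemma inverse_unit: "x \<in> R \<Longrightarrow> x \<notin> \<mm> \<Longrightarrow> inverse x \<in> R \<and> inverse x \<notin> \<mm>"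
  by (auto simp: notin_m)

text \<open>If \<open>geom e \<zeta>\<close> lies in \<open>\<mm>\<close>, so does
  \<open>geom (e * l) \<zeta>\<close> for every \<open>l\<close>, and one more term leads outside
  \<open>\<mm>\<close>, since \<open>geom (Suc n) \<zeta> = 1 + \<zeta> * geom n \<zeta>\<close>. A
  common multiple of the \<open>e\<close>, plus one, serves all elements of
  \<open>S\<close>.\<close>

lemma geom_unit_exists:
  assumes "finite S"
  shows "\<exists>k\<ge>2. \<forall>\<zeta>\<in>S. \<zeta> \<in> R \<longrightarrow> geom k \<zeta> \<notin> \<mm>"
proof -
  have "\<exists>e\<ge>1. \<forall>l. \<zeta> \<in> R \<longrightarrow> geom (Suc (e * l)) \<zeta> \<notin> \<mm>" for \<zeta>
  proof (cases "\<exists>e\<ge>1. geom e \<zeta> \<in> \<mm>")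
    case True
    then obtain e where e: "e \<ge> 1" "geom e \<zeta> \<in> \<mm>" by blast
    have "geom (Suc (e * l)) \<zeta> \<notin> \<mm>" if "\<zeta> \<in> R" for l
    proof -
      have "geom (e * l) \<zeta> \<in> \<mm>"
      proof (induction l)
        case (Suc l)
        have "geom (e * l + e) \<zeta> \<in> \<mm>"
          unfolding geom_add using Suc e that by (auto intro!: m_add m_mult2 R_power)
        then show ?case by (simp add: add.commute)
      qed (simp add: geom_simps m_0)
      then have "\<zeta> * geom (e * l) \<zeta> \<in> \<mm>" using that by (rule m_mult2[rotated])
      then show ?thesis unfolding geom_Suc_left by (rule notin_m_add[OF one_notin_m])
    qed
    then show ?thesis using e by blast
  next
    case False
    then show ?thesis by (intro exI[of _ 1]) auto
  qed
  then obtain e where e: "\<And>\<zeta>. e \<zeta> \<ge> (1::nat)"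
    "\<And>\<zeta> l. \<zeta> \<in> R \<Longrightarrow> geom (Suc (e \<zeta> * l)) \<zeta> \<notin> \<mm>" by metis
  define P where "P = prod e S"
  have "P \<noteq> 0" unfolding P_def using assms e(1) by (metis not_one_le_zero prod_zero_iff)
  moreover have "geom (Suc P) \<zeta> \<notin> \<mm>" if "\<zeta> \<in> S" "\<zeta> \<in> R" for \<zeta>
    using e(2)[OF that(2), of "prod e (S - {\<zeta>})"] that assms by (simp add: P_def prod.remove)
  ultimately show ?thesis by (intro exI[of _ "Suc P"]) auto
qed

text \<open>For integral \<open>x\<close> the geometric sum is a unit. Otherwise it is
  \<open>x ^ (k - 1)\<close> times the unit \<open>geom k (inverse x)\<close>; its inverse is then
  in \<open>\<mm>\<close>, and \<open>k \<ge> 2\<close> leaves enough powers of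
  \<open>inverse x\<close> to absorb a factor \<open>x\<close>.\<close>

lemma inverse_geom:
  assumes "k \<ge> 2" "x \<in> R \<longrightarrow> geom k x \<notin> \<mm>"
  shows "inverse (geom k x) \<in> R" "x * inverse (geom k x) \<in> R"
    "x \<in> R \<Longrightarrow> inverse (geom k x) \<notin> \<mm>" "x \<notin> R \<Longrightarrow> inverse (geom k x) \<in> \<mm>"
proof -
  have "inverse (geom k x) \<in> R \<and> x * inverse (geom k x) \<in> R \<and>
    (x \<in> R \<longrightarrow> inverse (geom k x) \<notin> \<mm>) \<and> (x \<notin> R \<longrightarrow> inverse (geom k x) \<in> \<mm>)"
  proof (cases "x \<in> R")
    case True
    then have "geom k x \<in> R" by (auto simp: geom_def intro: R_intros)
    then show ?thesis using inverse_unit[of "geom k x"] assms True by (auto intro: R_mult)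
  next
    case False
    define y where "y = inverse x"
    have y: "y \<in> \<mm>" "x \<noteq> 0" using False by (auto simp: notin_R y_def)
    obtain n where n: "k = Suc (Suc n)" using assms(1) by (metis add_2_eq_Suc le_Suc_ex)
    define g where "g = geom k y"
    have "geom (Suc n) y \<in> R" using y m_R by (auto simp: geom_def intro: R_intros)
    then have "y * geom (Suc n) y \<in> \<mm>" using y by (simp add: m_mult)
    then have "g \<notin> \<mm>" unfolding g_def n geom_Suc_left[of "Suc n"]
      by (rule notin_m_add[OF one_notin_m])
    then have ig: "inverse g \<in> R" by (simp add: notin_m)
    have "geom k x = x ^ Suc n * g" using geom_reflect[OF y(2), of "Suc n"] by (simp add: n y_def g_def)
    then have e: "inverse (geom k x) = y ^ Suc n * inverse g" "x * inverse (geom k x) = y ^ n * inverse g"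
      using y(2) by (auto simp: y_def power_inverse field_simps)
    have "inverse (geom k x) \<in> \<mm>"
      unfolding e using y ig by (intro m_mult m_power) auto
    moreover have "x * inverse (geom k x) \<in> R" unfolding e(2) using m_R[OF y(1)] ig by (intro R_mult R_power)
    ultimately show ?thesis using False m_R by blast
  qed
  then show "inverse (geom k x) \<in> R" "x * inverse (geom k x) \<in> R"
    "x \<in> R \<Longrightarrow> inverse (geom k x) \<notin> \<mm>" "x \<notin> R \<Longrightarrow> inverse (geom k x) \<in> \<mm>" by blast+
qed

text \<open>The coefficient of index \<open>j\<close> is homogeneous of degree
  \<open>card Z - j\<close> in the roots; the quotient is the same coefficient for the roots divided
  by \<open>z\<close>.\<close>

lemma coeff_roots_poly_bound:
  assumes "finite Z" "z \<noteq> 0" "\<And>\<zeta>. \<zeta> \<in> Z \<Longrightarrow> \<zeta> / z \<in> R"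
  shows "coeff (roots_poly Z) j * z ^ j / z ^ card Z \<in> R"
  using assms(1,3)
proof (induction Z arbitrary: j rule: finite_induct)
  case empty
  then show ?case by (cases j) (auto simp: roots_poly_def R_0 R_1)
next
  case (insert a Z)
  define f where "f j = coeff (roots_poly Z) j * z ^ j / z ^ card Z" for j
  have f: "f j \<in> R" for j using insert by (simp add: f_def)
  have a: "a / z \<in> R" using insert.prems by simp
  have "coeff (roots_poly (insert a Z)) j * z ^ j / z ^ card (insert a Z) =
    (case j of 0 \<Rightarrow> 0 | Suc i \<Rightarrow> f i) - a / z * f j"
    using insert.hyps assms(2)
    by (simp add: roots_poly_insert coeff_linear_mult f_def field_simps del: mult_pCons_left split: nat.split)
  also have "\<dots> \<in> R"
    by (rule R_diff[OF _ R_mult[OF a f]]) (use f R_0 in \<open>simp split: nat.split\<close>)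
  finally show ?case .
qed

lemma coeff_roots_poly_R:
  assumes "Z \<subseteq> R"
  shows "coeff (roots_poly Z) j \<in> R"
proof (cases "finite Z")
  case True
  then show ?thesis using coeff_roots_poly_bound[of Z 1 j] assms by auto
next
  case False
  then show ?thesis by (cases j) (auto simp: roots_poly_def R_intros)
qed

lemma coeff_mult_m:
  assumes "\<And>i. coeff p i \<in> R" "\<And>i. coeff q i \<in> \<mm>"
  shows "coeff (p * q) i \<in> \<mm>"
  unfolding coeff_mult using assms by (intro m_sum m_mult2)

lemma coeff_mult_R:
  assumes "\<And>i. coeff p i \<in> R" "\<And>i. coeff q i \<in> R"
  shows "coeff (p * q) i \<in> R"
  unfolding coeff_mult using assms by (intro R_sum R_mult)

lemma coeff_prod_R:
  "(\<And>\<zeta> i. \<zeta> \<in> Z \<Longrightarrow> coeff (f \<zeta>) i \<in> R) \<Longrightarrow> coeff (prod f Z) i \<in> R"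
  by (induction Z arbitrary: i rule: infinite_finite_induct)
     (auto intro: R_intros coeff_mult_R)

lemma coeff_prod_cong:
  assumes "\<And>\<zeta> i. \<zeta> \<in> Z \<Longrightarrow> coeff (f \<zeta>) i \<in> R" "\<And>\<zeta> i. \<zeta> \<in> Z \<Longrightarrow> coeff (g \<zeta>) i \<in> R"
    "\<And>\<zeta> i. \<zeta> \<in> Z \<Longrightarrow> coeff (f \<zeta> - g \<zeta>) i \<in> \<mm>"
  shows "coeff (prod f Z - prod g Z) i \<in> \<mm>"
  using assms
proof (induction Z arbitrary: i rule: infinite_finite_induct)
  case (insert a Z)
  have "prod f (insert a Z) - prod g (insert a Z) =
    f a * (prod f Z - prod g Z) + prod g Z * (f a - g a)"
    using insert.hyps by (simp add: algebra_simps)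
  moreover have "coeff (f a * (prod f Z - prod g Z)) i \<in> \<mm>"
    using insert by (intro coeff_mult_m) auto
  moreover have "coeff (prod g Z * (f a - g a)) i \<in> \<mm>"
    using insert by (intro coeff_mult_m coeff_prod_R) auto
  ultimately show ?case by (simp add: m_add)
qed (auto intro: m_0)

text \<open>The segment of the Newton polygon belonging to \<open>z\<close> has length one.\<close>
lemma isolated_root_value:
  assumes Z: "finite Z" "z \<in> Z" "0 \<notin> Z"
    and sep: "\<And>\<zeta>. \<zeta> \<in> Z \<Longrightarrow> \<zeta> \<noteq> z \<Longrightarrow> \<zeta> / z \<in> \<mm> \<or> z / \<zeta> \<in> \<mm>"
  shows "\<exists>i. coeff (roots_poly Z) i / coeff (roots_poly Z) (Suc i) / z \<in> R - \<mm>"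
proof -
  have z0: "z \<noteq> 0" using Z by auto
  define A where "A = {\<zeta>\<in>Z. z / \<zeta> \<in> \<mm>}"
  define B where "B = {\<zeta>\<in>Z. \<zeta> / z \<in> \<mm>}"
  have "z \<notin> A" "z \<notin> B" using z0 one_notin_m by (auto simp: A_def B_def)
  have AB: "A \<inter> B = {}"
  proof -
    have False if "z / \<zeta> \<in> \<mm>" "\<zeta> / z \<in> \<mm>" "\<zeta> \<in> Z" for \<zeta>
    proof -
      have "\<zeta> \<noteq> 0" using that Z by auto
      then show False using m_mult[OF that(1) m_R[OF that(2)]] z0 one_notin_m by simp
    qed
    then show ?thesis by (auto simp: A_def B_def)
  qed
  have Zeq: "Z = insert z (A \<union> B)" using Z sep by (auto simp: A_def B_def)
  \<comment> \<open>After substituting \<open>z * X\<close> for the variable, each linear factor is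
    scaled to have integral coefficients. The factor of a root of smaller value than
    \<open>z\<close> reduces to \<open>- 1\<close>, that of a root of larger value to
    \<open>X\<close>, and that of \<open>z\<close> itself to \<open>X - 1\<close>; \<open>g\<close>
    lists these reductions.\<close>
  define s where "s \<zeta> = (if \<zeta> \<in> A then 1 / \<zeta> else 1 / z)" for \<zeta>
  define f where "f \<zeta> = smult (s \<zeta>) (pcompose [:- \<zeta>, 1:] [:0, z:])" for \<zeta>
  define g where "g \<zeta> = (if \<zeta> \<in> A then [:- 1:] else if \<zeta> \<in> B then monom 1 1 else [:- 1, 1:] :: 'a poly)" for \<zeta>
  have f_eq: "f \<zeta> = [:- s \<zeta> * \<zeta>, s \<zeta> * z:]" for \<zeta> by (simp add: f_def pcompose_pCons)
  have zA: "\<zeta> \<noteq> 0" if "\<zeta> \<in> Z" for \<zeta> using that Z by auto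
  have m1: "- 1 \<in> R" by (intro R_intros)
  have fR: "coeff (f \<zeta>) i \<in> R" if "\<zeta> \<in> Z" for \<zeta> i
  proof (cases "\<zeta> \<in> A")
    case True
    then have "z / \<zeta> \<in> R" by (auto simp: A_def intro: m_R)
    then show ?thesis using True zA[OF that] m1
      by (auto simp: f_eq s_def coeff_pCons R_0 split: nat.split)
  next
    case False
    then have "\<zeta> = z \<or> \<zeta> / z \<in> \<mm>" using that Zeq B_def by blast
    then have "\<zeta> / z \<in> R" using z0 by (auto simp: R_1 intro: m_R)
    then show ?thesis using False z0 R_1 R_uminus
      by (auto simp: f_eq s_def coeff_pCons R_0 split: nat.split)
  qed
  have gR: "coeff (g \<zeta>) i \<in> R" for \<zeta> i
    by (auto simp: g_def coeff_pCons R_0 R_1 m1 split: nat.split)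
  have fg: "coeff (f \<zeta> - g \<zeta>) i \<in> \<mm>" if \<zeta>: "\<zeta> \<in> Z" for \<zeta> i
  proof -
    consider "\<zeta> \<in> A" | "\<zeta> \<in> B" "\<zeta> \<notin> A" | "\<zeta> = z" "\<zeta> \<notin> A" "\<zeta> \<notin> B"
      using \<zeta> Zeq \<open>z \<notin> A\<close> \<open>z \<notin> B\<close> by blast
    then show ?thesis
    proof cases
      case 1
      then show ?thesis using zA[OF \<zeta>]
        by (auto simp: f_eq s_def g_def coeff_pCons m_0 A_def split: nat.split)
    next
      case 2
      then have "\<zeta> / z \<in> \<mm>" by (simp add: B_def)
      then show ?thesis using 2 z0 m_uminus[of "\<zeta> / z"]
        by (auto simp: f_eq s_def g_def coeff_pCons m_0 monom_altdef split: nat.split)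
    next
      case 3
      then show ?thesis using z0 by (auto simp: f_eq s_def g_def m_0)
    qed
  qed
  define n where "n = card B"
  have fin: "finite A" "finite B" using Z by (auto simp: A_def B_def)
  have gB: "prod g B = monom 1 n"
  proof -
    have "prod g B = (\<Prod>\<zeta>\<in>B. monom 1 1)" using AB by (intro prod.cong) (auto simp: g_def)
    then show ?thesis by (simp add: n_def monom_power)
  qed
  have gA: "prod g A = [:- 1:] ^ card A"
  proof -
    have "prod g A = (\<Prod>\<zeta>\<in>A. [:- 1:])" by (intro prod.cong) (auto simp: g_def)
    then show ?thesis by simp
  qed
  have "prod g Z = g z * (prod g A * prod g B)"
    using fin AB \<open>z \<notin> A\<close> \<open>z \<notin> B\<close> by (subst Zeq) (simp add: prod.union_disjoint)
  also have "g z = [:- 1, 1:]" using \<open>z \<notin> A\<close> \<open>z \<notin> B\<close> by (simp add: g_def)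
  finally have gZ: "prod g Z = [:- 1, 1:] * ([:(- 1) ^ card A:] * monom 1 n)"
    by (simp only: gA gB poly_const_pow)
  define \<epsilon> where "\<epsilon> = (- 1 :: 'a) ^ card A"
  have e: "\<epsilon> \<notin> \<mm>" unfolding \<epsilon>_def using one_notin_m m_uminus[of "- 1"] by (intro notin_m_power) auto
  \<comment> \<open>The product reduces to \<open>\<epsilon> * X ^ n * (X - 1)\<close>, with two
    adjacent unit coefficients. Undoing the substitution, the quotient of the original coefficients
    has the value of \<open>z\<close>.\<close>
  have g1: "coeff (prod g Z) n = - \<epsilon>" "coeff (prod g Z) (Suc n) = \<epsilon>"
    unfolding gZ \<epsilon>_def[symmetric] by (auto simp: coeff_pCons smult_monom split: nat.split)
  define S where "S = prod s Z"
  have "prod f Z = smult S (pcompose (roots_poly Z) [:0, z:])"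
    by (simp add: f_def S_def prod_smult pcompose_prod roots_poly_def)
  then have cf: "coeff (prod f Z) i = S * (z ^ i * coeff (roots_poly Z) i)" for i
    by (simp add: coeff_pcompose_linear)
  have c: "coeff (prod f Z) i - coeff (prod g Z) i \<in> \<mm>" for i
    using coeff_prod_cong[of Z f g i] fR gR fg by simp
  define X where "X = coeff (prod f Z) n"
  define Y where "Y = coeff (prod f Z) (Suc n)"
  have XR: "X \<in> R" "Y \<in> R" using fR by (auto simp: X_def Y_def intro: coeff_prod_R)
  have Xm: "X \<notin> \<mm>" "Y \<notin> \<mm>"
    using c[of n] c[of "Suc n"] e m_uminus[of "- \<epsilon>"] notin_m_cong[of X "- \<epsilon>"] notin_m_cong[of Y \<epsilon>]
    by (auto simp: X_def Y_def g1)
  have "X / Y \<in> R - \<mm>"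
    using inverse_unit[OF XR(2) Xm(2)] XR Xm notin_m_mult[of X "inverse Y"] R_mult[of X "inverse Y"]
    by (simp add: divide_inverse)
  moreover have "S \<noteq> 0" using Xm(1) m_0 by (auto simp: X_def cf)
  then have "X / Y = coeff (roots_poly Z) n / coeff (roots_poly Z) (Suc n) / z"
    using z0 by (simp add: X_def Y_def cf field_simps)
  ultimately show ?thesis by auto
qed

end

section \<open>Finite Galois levels\<close>

context val_ring
begin

abbreviation U :: "'a set" where "U \<equiv> R - \<mm>"

lemma U_iff: "x \<in> U \<longleftrightarrow> x \<noteq> 0 \<and> x \<in> R \<and> inverse x \<in> R"
  by (auto simp: notin_m)

lemma U_mult: "x \<in> U \<Longrightarrow> y \<in> U \<Longrightarrow> x * y \<in> U"
  unfolding U_iff by (auto intro: R_mult)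

lemma U_inverse: "x \<in> U \<Longrightarrow> inverse x \<in> U"
  unfolding U_iff by auto

lemma U_divide: "x \<in> U \<Longrightarrow> y \<in> U \<Longrightarrow> x / y \<in> U"
  by (simp only: divide_inverse U_mult U_inverse)

lemma U_power: "x \<in> U \<Longrightarrow> x ^ n \<in> U"
  unfolding U_iff by (auto simp: power_inverse[symmetric] intro: R_power)

lemma U_prod: "(\<And>i. i \<in> A \<Longrightarrow> f i \<in> U) \<Longrightarrow> prod f A \<in> U"
  using R_prod[of A f] notin_m_prod[of A f] by blast

lemma not_U: "x \<noteq> 0 \<Longrightarrow> x \<notin> U \<Longrightarrow> x \<in> \<mm> \<or> inverse x \<in> \<mm>"
  using notin_R by blast

end

text \<open>A list of pairs \<open>(x\<^sub>i, y\<^sub>i)\<close> stands for the tensor \<open>\<Sum> x\<^sub>i \<otimes> y\<^sub>i\<close>, on which an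
  embedding \<open>e\<close> is evaluated through the second factors.\<close>
definition eval_pairs :: "('a::field \<times> 'a) list \<Rightarrow> ('a \<Rightarrow> 'a) \<Rightarrow> 'a" where
  "eval_pairs l e = (\<Sum>(x, y)\<leftarrow>l. x * e y)"

lemma eval_pairs_Cons: "eval_pairs ((x, y) # l) e = x * e y + eval_pairs l e"
  by (simp add: eval_pairs_def)

lemma eval_pairs_append: "eval_pairs (l @ l') e = eval_pairs l e + eval_pairs l' e"
  by (simp add: eval_pairs_def)

definition mult_pairs :: "('a::field \<times> 'a) list \<Rightarrow> ('a \<times> 'a) list \<Rightarrow> ('a \<times> 'a) list" where
  "mult_pairs l l' = concat (map (\<lambda>(x, y). map (\<lambda>(x', y'). (x * x', y * y')) l') l)"

lemma eval_mult_pairs: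
  assumes "\<And>y y'. e (y * y') = e y * e y'"
  shows "eval_pairs (mult_pairs l l') e = eval_pairs l e * eval_pairs l' e"
proof (induction l)
  case (Cons a l)
  obtain x y where a: "a = (x, y)" by force
  have "eval_pairs (map (\<lambda>(x', y'). (x * x', y * y')) l') e = x * e y * eval_pairs l' e"
    by (induction l') (auto simp: eval_pairs_def assms algebra_simps)
  then show ?case using Cons
    by (simp add: mult_pairs_def a eval_pairs_append eval_pairs_Cons distrib_right)
qed (simp add: mult_pairs_def eval_pairs_def)

lemma set_mult_pairs:
  "set (mult_pairs l l') = {(x * x', y * y') |x y x' y'. (x, y) \<in> set l \<and> (x', y') \<in> set l'}"
  by (force simp: mult_pairs_def)

locale valued_ext = alg_ext K + val_ring R for K R :: "'a::field set"

text \<open>A finite Galois extension of \<open>K\<close> inside \<open>W\<close>; finiteness is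
  expressed by the number of restrictions of automorphisms.\<close>

locale fin_level = valued_ext K R for K R :: "'a::field set" +
  fixes N :: "'a set"
  assumes subfield_N: "is_subfield N" and K_sub_N: "K \<subseteq> N" and N_sub_W: "N \<subseteq> W"
    and Gal_N: "\<sigma> \<in> Gal \<Longrightarrow> x \<in> N \<Longrightarrow> \<sigma> x \<in> N"
    and finite_level: "finite ((\<lambda>\<sigma>. restrict \<sigma> N) ` Gal)"
begin

definition fixf :: "('a \<Rightarrow> 'a) set \<Rightarrow> 'a set" where
  "fixf H = {x \<in> N. \<forall>\<sigma>\<in>H. \<sigma> x = x}"

definition subgrp :: "('a \<Rightarrow> 'a) set \<Rightarrow> bool" where
  "subgrp H \<longleftrightarrow> H \<subseteq> Gal \<and> id \<in> H \<and> (\<forall>\<sigma>\<in>H. \<forall>\<tau>\<in>H. \<sigma> \<circ> \<tau> \<in> H) \<and> (\<forall>\<sigma>\<in>H. inv \<sigma> \<in> H)"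

definition orb :: "('a \<Rightarrow> 'a) set \<Rightarrow> 'a \<Rightarrow> 'a set" where
  "orb H x = (\<lambda>\<sigma>. \<sigma> x) ` H"

text \<open>The restrictions correspond to the cosets in \<open>H\<close> of the pointwise
  stabiliser of \<open>M\<close>. For a field \<open>M\<close> between \<open>fixf H\<close> and
  \<open>N\<close>, sums over them are traces and products are norms down to \<open>fixf H\<close>.
  The embeddings take values in \<open>N\<close>, as \<open>M\<close> need not be stable under
  \<open>H\<close>.\<close>

definition emb :: "('a \<Rightarrow> 'a) set \<Rightarrow> 'a set \<Rightarrow> ('a \<Rightarrow> 'a) set" where
  "emb H M = (\<lambda>\<sigma>. restrict \<sigma> M) ` H"

text \<open>This is the integral closure of \<open>R \<inter> K\<close> in \<open>N\<close>, in a
  form visibly stable under \<open>Gal\<close>.\<close>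

definition integ :: "'a set" where
  "integ = {x \<in> N. \<forall>\<sigma>\<in>Gal. \<sigma> x \<in> R}"

lemma subgrp_Gal: "subgrp Gal"
  by (auto simp: subgrp_def Gal_id Gal_comp Gal_inv)

lemma fixf_N: "fixf H \<subseteq> N" by (auto simp: fixf_def)

lemma fixf_K: "H \<subseteq> Gal \<Longrightarrow> K \<subseteq> fixf H"
  using K_sub_N by (auto simp: fixf_def Gal_fix)

lemma fixf_subfield: "H \<subseteq> Gal \<Longrightarrow> is_subfield (fixf H)"
  using subfield_N
  by (intro subfieldI) (auto simp: fixf_def Gal_simps subset_iff intro: subfield_intros)

lemma fixf_Gal: "fixf Gal = K"
  using fixf_K[of Gal] fixed_in_K N_sub_W by (auto simp: fixf_def)

lemma fixf_anti: "H \<subseteq> H' \<Longrightarrow> fixf H' \<subseteq> fixf H"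
  by (auto simp: fixf_def)

lemma finite_orb: "H \<subseteq> Gal \<Longrightarrow> finite (orb H x)"
  using finite_orbit[of x] by (rule rev_finite_subset) (auto simp: orb_def)

lemma orb_self: "subgrp H \<Longrightarrow> x \<in> orb H x"
  by (auto simp: orb_def subgrp_def image_iff intro!: bexI[of _ id])

lemma orb_N: "H \<subseteq> Gal \<Longrightarrow> x \<in> N \<Longrightarrow> orb H x \<subseteq> N"
  by (auto simp: orb_def Gal_N)

lemma orb_image:
  assumes "subgrp H" "\<tau> \<in> H"
  shows "\<tau> ` orb H x = orb H x"
proof (intro equalityI subsetI)
  fix y assume "y \<in> \<tau> ` orb H x"
  then obtain \<sigma> where "\<sigma> \<in> H" "y = (\<tau> \<circ> \<sigma>) x" by (auto simp: orb_def)
  moreover from this have "\<tau> \<circ> \<sigma> \<in> H" using assms by (simp add: subgrp_def)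
  ultimately show "y \<in> orb H x" unfolding orb_def by blast
next
  fix y assume "y \<in> orb H x"
  then obtain \<sigma> where s: "\<sigma> \<in> H" "y = \<sigma> x" by (auto simp: orb_def)
  have "\<tau> \<in> Gal" using assms by (auto simp: subgrp_def)
  then have "y = \<tau> ((inv \<tau> \<circ> \<sigma>) x)" using s by (simp add: Gal_inv)
  moreover have "inv \<tau> \<circ> \<sigma> \<in> H" using assms s by (auto simp: subgrp_def)
  ultimately show "y \<in> \<tau> ` orb H x" unfolding orb_def by blast
qed

lemma Gal_coeff_roots_poly:
  assumes s: "\<sigma> \<in> Gal"
  shows "finite Z \<Longrightarrow> \<sigma> (coeff (roots_poly Z) i) = coeff (roots_poly (\<sigma> ` Z)) i"
proof (induction Z arbitrary: i rule: finite_induct)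
  case empty
  then show ?case using s by (cases i) (auto simp: roots_poly_def Gal_simps)
next
  case (insert a Z)
  have "\<sigma> a \<notin> \<sigma> ` Z" using insert.hyps s by (auto simp: Gal_inj)
  then show ?case using insert s
    by (auto simp: roots_poly_insert coeff_linear_mult Gal_simps simp del: mult_pCons_left split: nat.split)
qed

lemma coeff_orb:
  assumes "subgrp H" "x \<in> N"
  shows "coeff (roots_poly (orb H x)) i \<in> fixf H"
proof -
  have H: "H \<subseteq> Gal" using assms by (simp add: subgrp_def)
  have "coeff (roots_poly (orb H x)) i \<in> N"
    by (intro coeff_roots_poly_subfield subfield_N orb_N H assms)
  moreover have "\<sigma> (coeff (roots_poly (orb H x)) i) = coeff (roots_poly (orb H x)) i" if "\<sigma> \<in> H" for \<sigma>
    using Gal_coeff_roots_poly[of \<sigma> "orb H x" i] finite_orb[OF H] orb_image[OF assms(1) that] H that by auto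
  ultimately show ?thesis by (simp add: fixf_def)
qed

lemma prod_orb:
  assumes "subgrp H" "x \<in> N"
  shows "\<Prod>(orb H x) \<in> fixf H"
proof -
  have H: "H \<subseteq> Gal" using assms by (simp add: subgrp_def)
  have "\<sigma> (\<Prod>(orb H x)) = \<Prod>(orb H x)" if "\<sigma> \<in> H" for \<sigma>
  proof -
    have s: "\<sigma> \<in> Gal" using H that by auto
    have "\<sigma> (\<Prod>(orb H x)) = (\<Prod>y\<in>orb H x. \<sigma> y)" by (rule Gal_prod[OF s])
    also have "\<dots> = \<Prod>(\<sigma> ` orb H x)"
      using s by (subst prod.reindex) (auto simp: inj_on_def Gal_inj)
    finally show ?thesis by (simp add: orb_image[OF assms(1) that])
  qed
  moreover have "\<Prod>(orb H x) \<in> N" using orb_N[OF H assms(2)] subfield_N by (auto intro: subfield_prod)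
  ultimately show ?thesis by (simp add: fixf_def)
qed

lemma finite_order: "\<sigma> \<in> Gal \<Longrightarrow> \<exists>k\<ge>1. \<forall>x\<in>N. (\<sigma> ^^ k) x = x"
proof -
  assume s: "\<sigma> \<in> Gal"
  have pow: "\<sigma> ^^ i \<in> Gal" for i by (induction i) (simp_all only: funpow.simps Gal_id Gal_comp s)
  have "range (\<lambda>i. restrict (\<sigma> ^^ i) N) \<subseteq> (\<lambda>\<sigma>. restrict \<sigma> N) ` Gal" using pow by blast
  then have "finite (range (\<lambda>i. restrict (\<sigma> ^^ i) N))" using finite_level finite_subset by blast
  then have "\<not> inj (\<lambda>i. restrict (\<sigma> ^^ i) N)" using finite_imageD infinite_UNIV_nat by blast
  then obtain i j where ij: "i < j" "restrict (\<sigma> ^^ i) N = restrict (\<sigma> ^^ j) N"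
    unfolding inj_def by (metis linorder_neqE_nat)
  have "(\<sigma> ^^ (j - i)) x = x" if "x \<in> N" for x
  proof -
    have "(\<sigma> ^^ i) ((\<sigma> ^^ (j - i)) x) = (\<sigma> ^^ (i + (j - i))) x" by (simp add: funpow_add)
    also have "\<dots> = (\<sigma> ^^ i) x" using ij that by (simp add: restrict_def fun_eq_iff) metis
    finally show ?thesis using pow[of i] by (simp add: Gal_inj)
  qed
  then show ?thesis using ij by (intro exI[of _ "j - i"]) auto
qed

lemma finite_emb: "H \<subseteq> Gal \<Longrightarrow> M \<subseteq> N \<Longrightarrow> finite (emb H M)"
proof -
  assume H: "H \<subseteq> Gal" and M: "M \<subseteq> N"
  have "emb H M = (\<lambda>e. restrict e M) ` ((\<lambda>\<sigma>. restrict \<sigma> N) ` H)"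
    using M by (auto simp: emb_def image_image restrict_restrict Int_absorb1)
  moreover have "finite ((\<lambda>\<sigma>. restrict \<sigma> N) ` H)"
    using finite_level H by (meson finite_subset image_mono)
  ultimately show ?thesis by simp
qed

lemma emb_comp_bij:
  assumes "subgrp H" "M \<subseteq> N" "\<tau> \<in> H"
  shows "bij_betw (\<lambda>e. restrict (\<tau> \<circ> e) M) (emb H M) (emb H M)"
proof -
  have H: "H \<subseteq> Gal" using assms by (simp add: subgrp_def)
  have t: "\<tau> \<in> Gal" using H assms by auto
  have "inj_on (\<lambda>e. restrict (\<tau> \<circ> e) M) (emb H M)"
  proof (rule inj_onI)
    fix e e' assume e: "e \<in> emb H M" "e' \<in> emb H M" "restrict (\<tau> \<circ> e) M = restrict (\<tau> \<circ> e') M"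
    then have "\<tau> (e x) = \<tau> (e' x)" if "x \<in> M" for x using that by (metis comp_apply restrict_apply')
    then have "e x = e' x" if "x \<in> M" for x using that t by (simp add: Gal_inj)
    then show "e = e'" using e(1,2) by (auto simp: emb_def restrict_def fun_eq_iff)
  qed
  moreover have "(\<lambda>e. restrict (\<tau> \<circ> e) M) ` emb H M \<subseteq> emb H M"
  proof clarify
    fix e assume "e \<in> emb H M"
    then obtain \<sigma> where s: "\<sigma> \<in> H" "e = restrict \<sigma> M" by (auto simp: emb_def)
    then have "restrict (\<tau> \<circ> e) M = restrict (\<tau> \<circ> \<sigma>) M" by auto
    moreover have "\<tau> \<circ> \<sigma> \<in> H" using assms s by (auto simp: subgrp_def)
    ultimately show "restrict (\<tau> \<circ> e) M \<in> emb H M" by (auto simp: emb_def)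
  qed
  ultimately show ?thesis
    using finite_emb[OF H assms(2)] by (auto simp: bij_betw_def endo_inj_surj)
qed

lemma emb_N: "H \<subseteq> Gal \<Longrightarrow> M \<subseteq> N \<Longrightarrow> e \<in> emb H M \<Longrightarrow> y \<in> M \<Longrightarrow> e y \<in> N"
  by (auto simp: emb_def subset_iff Gal_N)

lemma trace_comp:
  assumes "subgrp H" "M \<subseteq> N" "\<tau> \<in> H" "y \<in> M"
  shows "(\<Sum>e\<in>emb H M. \<tau> (e y)) = (\<Sum>e\<in>emb H M. e y)"
proof -
  have "(\<Sum>e\<in>emb H M. e y) = (\<Sum>e\<in>emb H M. restrict (\<tau> \<circ> e) M y)"
    by (rule sum.reindex_bij_betw[OF emb_comp_bij[OF assms(1-3)], symmetric])
  then show ?thesis using assms(4) by simp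
qed

lemma trace_fixf:
  assumes "subgrp H" "M \<subseteq> N" "y \<in> M"
  shows "(\<Sum>e\<in>emb H M. e y) \<in> fixf H"
proof -
  have H: "H \<subseteq> Gal" using assms by (simp add: subgrp_def)
  have "\<tau> (\<Sum>e\<in>emb H M. e y) = (\<Sum>e\<in>emb H M. e y)" if "\<tau> \<in> H" for \<tau>
    using trace_comp[OF assms(1,2) that assms(3)] H that by (auto simp: Gal_sum)
  moreover have "(\<Sum>e\<in>emb H M. e y) \<in> N"
    using emb_N[OF H assms(2) _ assms(3)] by (intro subfield_sum subfield_N) auto
  ultimately show ?thesis by (simp add: fixf_def)
qed

lemma norm_fixf:
  assumes "subgrp H" "M \<subseteq> N" "y \<in> M"
  shows "(\<Prod>e\<in>emb H M. e y) \<in> fixf H"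
proof -
  have H: "H \<subseteq> Gal" using assms by (simp add: subgrp_def)
  have "\<tau> (\<Prod>e\<in>emb H M. e y) = (\<Prod>e\<in>emb H M. e y)" if "\<tau> \<in> H" for \<tau>
  proof -
    have "(\<Prod>e\<in>emb H M. e y) = (\<Prod>e\<in>emb H M. restrict (\<tau> \<circ> e) M y)"
      by (rule prod.reindex_bij_betw[OF emb_comp_bij[OF assms(1,2) that], symmetric])
    moreover have "\<tau> (\<Prod>e\<in>emb H M. e y) = (\<Prod>e\<in>emb H M. \<tau> (e y))"
      using H that by (intro Gal_prod) auto
    ultimately show ?thesis using assms(3) by simp
  qed
  moreover have "(\<Prod>e\<in>emb H M. e y) \<in> N"
    using emb_N[OF H assms(2) _ assms(3)] by (intro subfield_prod subfield_N) auto
  ultimately show ?thesis by (simp add: fixf_def)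
qed

text \<open>For each of the finitely many nontrivial restrictions to \<open>M\<close> a tensor is
  supplied that vanishes there and is outside \<open>\<mm>\<close> at the identity; the product of
  these tensors vanishes at all of them. The set \<open>P\<close> is a multiplicatively closed
  constraint on the pairs, integrality in the applications.\<close>

lemma selector:
  assumes H: "H \<subseteq> Gal" and M: "M \<subseteq> N" and P: "P \<subseteq> UNIV \<times> M" "(1, 1) \<in> P"
    "\<And>x y x' y'. (x, y) \<in> P \<Longrightarrow> (x', y') \<in> P \<Longrightarrow> (x * x', y * y') \<in> P"
    and ex: "\<And>\<sigma> x. \<sigma> \<in> H \<Longrightarrow> x \<in> M \<Longrightarrow> \<sigma> x \<noteq> x \<Longrightarrow>
      \<exists>l. set l \<subseteq> P \<and> eval_pairs l \<sigma> = 0 \<and> eval_pairs l id \<notin> \<mm>"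
  shows "\<exists>l. set l \<subseteq> P \<and> (\<forall>\<sigma>\<in>H. (\<exists>x\<in>M. \<sigma> x \<noteq> x) \<longrightarrow> eval_pairs l \<sigma> = 0) \<and> eval_pairs l id \<notin> \<mm>"
proof -
  define good where "good l e \<longleftrightarrow> (\<forall>\<sigma>\<in>H. e = restrict \<sigma> M \<longrightarrow> eval_pairs l \<sigma> = 0)" for l e
  have res: "eval_pairs l \<sigma> = eval_pairs l \<tau>" if "set l \<subseteq> P" "restrict \<sigma> M = restrict \<tau> M" for l \<sigma> \<tau>
  proof -
    have "\<sigma> y = \<tau> y" if "(x, y) \<in> set l" for x y
      using that \<open>set l \<subseteq> P\<close> P(1) \<open>restrict \<sigma> M = restrict \<tau> M\<close> by (metis (no_types, lifting) SigmaD2 restrict_apply' subsetD)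
    then show ?thesis unfolding eval_pairs_def by (intro arg_cong[of _ _ sum_list] map_cong) auto
  qed
  have "\<exists>l. set l \<subseteq> P \<and> (\<forall>e\<in>S. good l e) \<and> eval_pairs l id \<notin> \<mm>"
    if "finite S" "S \<subseteq> {restrict \<sigma> M |\<sigma>. \<sigma> \<in> H \<and> (\<exists>x\<in>M. \<sigma> x \<noteq> x)}" for S
    using that
  proof (induction S rule: finite_induct)
    case empty
    then show ?case using P(2) one_notin_m
      by (intro exI[of _ "[(1, 1)]"]) (auto simp: eval_pairs_def)
  next
    case (insert e S)
    then obtain l where l: "set l \<subseteq> P" "\<forall>e\<in>S. good l e" "eval_pairs l id \<notin> \<mm>" by blast
    obtain \<sigma> x where s: "e = restrict \<sigma> M" "\<sigma> \<in> H" "x \<in> M" "\<sigma> x \<noteq> x" using insert by blast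
    obtain l' where l': "set l' \<subseteq> P" "eval_pairs l' \<sigma> = 0" "eval_pairs l' id \<notin> \<mm>"
      using ex[OF s(2-4)] by blast
    have g': "good l' e" unfolding good_def using res[OF l'(1)] l'(2) s(1) by metis
    have ev: "eval_pairs (mult_pairs l l') \<tau> = eval_pairs l \<tau> * eval_pairs l' \<tau>" if "\<tau> \<in> H" for \<tau>
      using that H by (intro eval_mult_pairs) (auto simp: Gal_mult)
    have "good (mult_pairs l l') e'" if "e' \<in> insert e S" for e'
      using that l(2) g' ev by (auto simp: good_def)
    moreover have "set (mult_pairs l l') \<subseteq> P" using l(1) l'(1) P(3) by (force simp: set_mult_pairs)
    moreover have "eval_pairs (mult_pairs l l') id \<notin> \<mm>"
      using eval_mult_pairs[of id l l'] notin_m_mult[OF l(3) l'(3)] by simp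
    ultimately show ?case by blast
  qed
  note step = this
  define Bad where "Bad = {restrict \<sigma> M |\<sigma>. \<sigma> \<in> H \<and> (\<exists>x\<in>M. \<sigma> x \<noteq> x)}"
  have "finite Bad"
    using finite_emb[OF H M] by (rule rev_finite_subset) (auto simp: emb_def Bad_def)
  then obtain l where l: "set l \<subseteq> P" "\<forall>e\<in>Bad. good l e" "eval_pairs l id \<notin> \<mm>"
    using step[of Bad] by (auto simp: Bad_def)
  have "eval_pairs l \<sigma> = 0" if "\<sigma> \<in> H" "\<exists>x\<in>M. \<sigma> x \<noteq> x" for \<sigma>
  proof -
    have "restrict \<sigma> M \<in> Bad" using that unfolding Bad_def by blast
    then have "good l (restrict \<sigma> M)" using l(2) by blast
    then show ?thesis using that(1) by (auto simp: good_def)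
  qed
  then show ?thesis using l by blast
qed

lemma integ_N: "integ \<subseteq> N" and integ_R: "x \<in> integ \<Longrightarrow> x \<in> R"
  and integ_Gal: "\<sigma> \<in> Gal \<Longrightarrow> x \<in> integ \<Longrightarrow> \<sigma> x \<in> integ"
  and integ_mult: "x \<in> integ \<Longrightarrow> y \<in> integ \<Longrightarrow> x * y \<in> integ"
  and integ_1: "1 \<in> integ"
proof -
  show "integ \<subseteq> N" by (auto simp: integ_def)
  show "x \<in> integ \<Longrightarrow> x \<in> R" using Gal_id by (force simp: integ_def)
  show "\<sigma> \<in> Gal \<Longrightarrow> x \<in> integ \<Longrightarrow> \<sigma> x \<in> integ"
    using Gal_comp[of _ \<sigma>] by (force simp: integ_def Gal_N)
  show "x \<in> integ \<Longrightarrow> y \<in> integ \<Longrightarrow> x * y \<in> integ"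
    using subfield_N by (auto simp: integ_def Gal_mult intro: R_mult subfield_mult)
  show "1 \<in> integ" using subfield_N by (auto simp: integ_def Gal_1 R_1 subfield_one)
qed

lemma integ_coeff:
  assumes "subgrp H" "x \<in> integ"
  shows "coeff (roots_poly (orb H x)) i \<in> integ \<inter> fixf H"
proof -
  have H: "H \<subseteq> Gal" using assms by (simp add: subgrp_def)
  have "\<sigma> (coeff (roots_poly (orb H x)) i) \<in> R" if "\<sigma> \<in> Gal" for \<sigma>
  proof -
    have "\<sigma> ` orb H x \<subseteq> R" using integ_Gal integ_R assms H that by (auto simp: orb_def)
    then show ?thesis using Gal_coeff_roots_poly[OF that finite_orb[OF H]] coeff_roots_poly_R by simp
  qed
  moreover have "coeff (roots_poly (orb H x)) i \<in> fixf H"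
    using coeff_orb[OF assms(1)] assms(2) integ_N by blast
  ultimately show ?thesis using fixf_N[of H] by (auto simp: integ_def)
qed

text \<open>Take \<open>u = inverse (geom k x)\<close> with one exponent \<open>k\<close> suited to
  all conjugates of \<open>x\<close>. Being a rational expression in \<open>x\<close> over the prime
  field, it commutes with automorphisms and lies in every fixed field that contains
  \<open>x\<close>.\<close>

lemma denominator:
  assumes "x \<in> N"
  shows "\<exists>u\<in>integ. x * u \<in> integ \<and> (\<forall>H. H \<subseteq> Gal \<longrightarrow> x \<in> fixf H \<longrightarrow> u \<in> fixf H) \<and>
    (x \<in> R \<longrightarrow> u \<notin> \<mm>) \<and> (\<forall>\<sigma>\<in>Gal. \<sigma> x \<notin> R \<longrightarrow> \<sigma> u \<in> \<mm>)"
proof -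
  obtain k where k: "k \<ge> 2" "\<And>\<zeta>. \<zeta> \<in> orb Gal x \<Longrightarrow> \<zeta> \<in> R \<Longrightarrow> geom k \<zeta> \<notin> \<mm>"
    using geom_unit_exists[OF finite_orb[of Gal x]] by auto
  define u where "u = inverse (geom k x)"
  have s: "\<sigma> u = inverse (geom k (\<sigma> x))" if "\<sigma> \<in> Gal" for \<sigma>
    using that by (simp add: u_def geom_def Gal_simps)
  have kk: "\<sigma> x \<in> R \<longrightarrow> geom k (\<sigma> x) \<notin> \<mm>" if "\<sigma> \<in> Gal" for \<sigma>
    using k(2) that by (auto simp: orb_def)
  have uN: "u \<in> N" using assms subfield_N by (auto simp: u_def geom_def intro!: subfield_intros)
  have "u \<in> integ" using uN inverse_geom(1)[OF k(1) kk] s by (simp add: integ_def)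
  moreover have "x * u \<in> integ"
    using uN assms inverse_geom(2)[OF k(1) kk] s subfield_N by (auto simp: integ_def Gal_mult subfield_mult)
  moreover have "u \<in> fixf H" if "H \<subseteq> Gal" "x \<in> fixf H" for H
  proof -
    have "\<sigma> u = u" if "\<sigma> \<in> H" for \<sigma>
    proof -
      have "\<sigma> \<in> Gal" "\<sigma> x = x" using that \<open>H \<subseteq> Gal\<close> \<open>x \<in> fixf H\<close> by (auto simp: fixf_def)
      then show ?thesis using s[of \<sigma>] by (simp only: u_def)
    qed
    then show ?thesis using uN by (simp add: fixf_def)
  qed
  moreover have "u \<notin> \<mm>" if "x \<in> R"
    using inverse_geom(3)[OF k(1) kk[OF Gal_id]] that by (simp add: u_def)
  moreover have "\<sigma> u \<in> \<mm>" if "\<sigma> \<in> Gal" "\<sigma> x \<notin> R" for \<sigma>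
    using inverse_geom(4)[OF k(1) kk[OF that(1)] that(2)] s[OF that(1)] by simp
  ultimately show ?thesis by blast
qed

end

section \<open>Decomposition, inertia and ramification groups\<close>

context fin_level
begin

text \<open>This group and the next two consist of automorphisms of the ambient field that are
  tested on \<open>N\<close> only, so they contain every automorphism trivial on \<open>N\<close>.
  One inclusion is enough here, because automorphisms have finite order on \<open>N\<close>.\<close>

definition decomp :: "('a \<Rightarrow> 'a) set" where
  "decomp = {\<sigma> \<in> Gal. \<forall>x\<in>N. x \<in> R \<longrightarrow> \<sigma> x \<in> R}"

definition inertia :: "('a \<Rightarrow> 'a) set" where
  "inertia = {\<sigma> \<in> Gal. \<forall>x\<in>N. x \<in> R \<longrightarrow> \<sigma> x - x \<in> \<mm>}"

definition ramif :: "('a \<Rightarrow> 'a) set" where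
  "ramif = {\<sigma> \<in> Gal. \<forall>x\<in>N. x \<noteq> 0 \<longrightarrow> \<sigma> x / x - 1 \<in> \<mm>}"

lemma Gal_funpow: "\<sigma> \<in> Gal \<Longrightarrow> \<sigma> ^^ k \<in> Gal"
  by (induction k) (simp_all only: funpow.simps Gal_id Gal_comp)

lemma decomp_funpow: "\<sigma> \<in> decomp \<Longrightarrow> x \<in> N \<Longrightarrow> x \<in> R \<Longrightarrow> (\<sigma> ^^ k) x \<in> R"
proof (induction k)
  case (Suc k)
  then have "(\<sigma> ^^ k) x \<in> N" using Gal_funpow Gal_N by (auto simp: decomp_def)
  then show ?case using Suc by (simp add: decomp_def)
qed simp

lemma decomp_R_iff:
  assumes "\<sigma> \<in> decomp" "x \<in> N"
  shows "\<sigma> x \<in> R \<longleftrightarrow> x \<in> R"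
proof
  assume s: "\<sigma> x \<in> R"
  have sG: "\<sigma> \<in> Gal" using assms by (simp add: decomp_def)
  obtain k where k: "k \<ge> 1" "(\<sigma> ^^ k) x = x" using finite_order[OF sG] assms(2) by blast
  then obtain j where j: "k = Suc j" by (cases k) auto
  have "(\<sigma> ^^ j) (\<sigma> x) \<in> R" by (rule decomp_funpow[OF assms(1) Gal_N[OF sG assms(2)] s])
  then show "x \<in> R" using k(2) by (simp add: j funpow_swap1)
next
  assume "x \<in> R"
  then show "\<sigma> x \<in> R" using assms unfolding decomp_def by blast
qed

lemma decomp_m_iff:
  assumes "\<sigma> \<in> decomp" "x \<in> N"
  shows "\<sigma> x \<in> \<mm> \<longleftrightarrow> x \<in> \<mm>"
proof -
  have "\<sigma> \<in> Gal" using assms by (simp add: decomp_def)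
  then show ?thesis
    using decomp_R_iff[OF assms(1) subfield_inverse[OF subfield_N assms(2)]]
    unfolding m_iff by (simp add: Gal_inverse Gal_eq_0)
qed

lemma decomp_subgrp: "subgrp decomp"
proof -
  have "inv \<sigma> \<in> decomp" if s: "\<sigma> \<in> decomp" for \<sigma>
  proof -
    have sG: "\<sigma> \<in> Gal" using s by (simp add: decomp_def)
    have "inv \<sigma> x \<in> R" if "x \<in> N" "x \<in> R" for x
      using decomp_R_iff[OF s, of "inv \<sigma> x"] that Gal_inv[OF sG] Gal_N by simp
    then show ?thesis using Gal_inv[OF sG] by (simp add: decomp_def)
  qed
  moreover have "\<sigma> \<circ> \<tau> \<in> decomp" if "\<sigma> \<in> decomp" "\<tau> \<in> decomp" for \<sigma> \<tau>
    using that Gal_comp[of \<sigma> \<tau>] by (auto simp: decomp_def Gal_N)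
  ultimately show ?thesis using Gal_id by (auto simp: subgrp_def decomp_def)
qed

text \<open>If \<open>\<sigma>\<close> raised the value of \<open>y\<close>, each further
  application would raise it again, as \<open>decomp\<close> preserves \<open>\<mm>\<close>; but
  some power of \<open>\<sigma>\<close> fixes \<open>y\<close>. A lowered value is excluded in the
  same way with \<open>inverse x\<close>.\<close>

lemma decomp_ratio:
  assumes s: "\<sigma> \<in> decomp" and x: "x \<in> N" "x \<noteq> 0"
  shows "\<sigma> x / x \<in> U"
proof (rule ccontr)
  assume nU: "\<sigma> x / x \<notin> U"
  have sG: "\<sigma> \<in> Gal" using s by (simp add: decomp_def)
  obtain k where k: "k \<ge> 1" "(\<sigma> ^^ k) x = x" using finite_order[OF sG] x by blast
  have no: False if y: "y \<in> N" "y \<noteq> 0" "(\<sigma> ^^ k) y = y" "\<sigma> y / y \<in> \<mm>" for y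
  proof -
    have "(\<sigma> ^^ Suc i) y / y \<in> \<mm>" for i
    proof (induction i)
      case (Suc i)
      have "(\<sigma> ^^ Suc i) y / y \<in> N"
        using y Gal_N Gal_funpow[OF sG] subfield_N by (intro subfield_divide) blast+
      then have "\<sigma> ((\<sigma> ^^ Suc i) y / y) \<in> \<mm>" using decomp_m_iff[OF s] Suc by blast
      then have "\<sigma> ((\<sigma> ^^ Suc i) y / y) * (\<sigma> y / y) \<in> \<mm>" using y(4) m_R by (intro m_mult)
      moreover have "\<sigma> ((\<sigma> ^^ Suc i) y / y) * (\<sigma> y / y) = (\<sigma> ^^ Suc (Suc i)) y / y"
        using y(2) sG by (simp add: Gal_divide Gal_eq_0)
      ultimately show ?case by (simp only:)
    qed (use y in simp)
    from this[of "k - 1"] show False using k(1) y one_notin_m by simp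
  qed
  have "\<sigma> x / x \<noteq> 0" using x sG by (simp add: Gal_eq_0)
  from not_U[OF this nU] consider "\<sigma> x / x \<in> \<mm>" | "inverse (\<sigma> x / x) \<in> \<mm>" by blast
  then show False
  proof cases
    case 1
    then show False using no[OF x k(2)] by blast
  next
    case 2
    have "(\<sigma> ^^ k) (inverse x) = inverse x" using k(2) Gal_inverse[OF Gal_funpow[OF sG]] by simp
    moreover have "\<sigma> (inverse x) / inverse x = inverse (\<sigma> x / x)"
      using sG by (simp add: Gal_inverse divide_inverse)
    then have "\<sigma> (inverse x) / inverse x \<in> \<mm>" using 2 by (simp only:)
    ultimately show False using no[of "inverse x"] x subfield_inverse[OF subfield_N] by simp
  qed
qed

lemma inertia_decomp: "inertia \<subseteq> decomp"
proof
  fix \<sigma> assume s: "\<sigma> \<in> inertia"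
  have "\<sigma> x \<in> R" if "x \<in> N" "x \<in> R" for x
  proof -
    have "\<sigma> x - x \<in> \<mm>" using s that by (simp add: inertia_def)
    then have "(\<sigma> x - x) + x \<in> R" using that m_R by (intro R_add)
    then show ?thesis by simp
  qed
  then show "\<sigma> \<in> decomp" using s by (simp add: decomp_def inertia_def)
qed

lemma decomp_Gal: "decomp \<subseteq> Gal" and inertia_Gal: "inertia \<subseteq> Gal" and ramif_Gal: "ramif \<subseteq> Gal"
  by (auto simp: decomp_def inertia_def ramif_def)

lemma ramif_inertia: "ramif \<subseteq> inertia"
proof
  fix \<sigma> assume s: "\<sigma> \<in> ramif"
  have "\<sigma> x - x \<in> \<mm>" if "x \<in> N" "x \<in> R" for x
  proof (cases "x = 0")
    case True
    then show ?thesis using s ramif_Gal by (auto simp: Gal_0 m_0)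
  next
    case False
    then have "(\<sigma> x / x - 1) * x \<in> \<mm>" using s that by (intro m_mult) (auto simp: ramif_def)
    moreover have "(\<sigma> x / x - 1) * x = \<sigma> x - x" using False by (simp add: left_diff_distrib)
    ultimately show ?thesis by (simp only:)
  qed
  then show "\<sigma> \<in> inertia" using s by (simp add: inertia_def ramif_def)
qed

lemma inertia_subgrp: "subgrp inertia"
proof -
  have "inv \<sigma> \<in> inertia" if s: "\<sigma> \<in> inertia" for \<sigma>
  proof -
    have sG: "\<sigma> \<in> Gal" using s by (simp add: inertia_def)
    have "inv \<sigma> \<in> decomp" using decomp_subgrp inertia_decomp s by (auto simp: subgrp_def)
    have "inv \<sigma> x - x \<in> \<mm>" if "x \<in> N" "x \<in> R" for x
    proof -
      have "inv \<sigma> x \<in> N" "inv \<sigma> x \<in> R"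
        using that \<open>inv \<sigma> \<in> decomp\<close> Gal_inv[OF sG] Gal_N by (auto simp: decomp_def)
      then have "\<sigma> (inv \<sigma> x) - inv \<sigma> x \<in> \<mm>" using s by (simp add: inertia_def)
      then show ?thesis using m_uminus[of "x - inv \<sigma> x"] Gal_inv[OF sG] by simp
    qed
    then show ?thesis using Gal_inv[OF sG] by (simp add: inertia_def)
  qed
  moreover have "\<sigma> \<circ> \<tau> \<in> inertia" if s: "\<sigma> \<in> inertia" and t: "\<tau> \<in> inertia" for \<sigma> \<tau>
  proof -
    have G: "\<sigma> \<in> Gal" "\<tau> \<in> Gal" using s t by (auto simp: inertia_def)
    have "\<sigma> (\<tau> x) - x \<in> \<mm>" if x: "x \<in> N" "x \<in> R" for x
    proof -
      have "\<tau> x \<in> N" "\<tau> x \<in> R" using x t G Gal_N inertia_decomp by (auto simp: decomp_def)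
      then have "(\<sigma> (\<tau> x) - \<tau> x) + (\<tau> x - x) \<in> \<mm>" using s t x by (intro m_add) (auto simp: inertia_def)
      then show ?thesis by simp
    qed
    then show ?thesis using Gal_comp[OF G] by (simp add: inertia_def)
  qed
  ultimately show ?thesis using Gal_id m_0 by (auto simp: subgrp_def inertia_def)
qed

lemma ramif_subgrp: "subgrp ramif"
proof -
  have "inv \<sigma> \<in> ramif" if s: "\<sigma> \<in> ramif" for \<sigma>
  proof -
    have sG: "\<sigma> \<in> Gal" using s by (simp add: ramif_def)
    have "inv \<sigma> x / x - 1 \<in> \<mm>" if "x \<in> N" "x \<noteq> 0" for x
    proof -
      define y where "y = inv \<sigma> x"
      have y: "y \<in> N" "y \<noteq> 0" "\<sigma> y = x"
        using that Gal_inv[OF sG] Gal_N by (auto simp: y_def Gal_eq_0)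
      then have 1: "x / y - 1 \<in> \<mm>" using s by (auto simp: ramif_def)
      have "x / y \<in> U" using decomp_ratio[of \<sigma> y] y s ramif_inertia inertia_decomp by auto
      then have "y / x \<in> R" using U_inverse[of "x / y"] by simp
      then have "(- (x / y - 1)) * (y / x) \<in> \<mm>" by (rule m_mult[OF m_uminus[OF 1]])
      moreover have "(- (x / y - 1)) * (y / x) = y / x - 1" using y that by (simp add: field_simps)
      ultimately show ?thesis by (simp add: y_def)
    qed
    then show ?thesis using Gal_inv[OF sG] by (simp add: ramif_def)
  qed
  moreover have "\<sigma> \<circ> \<tau> \<in> ramif" if s: "\<sigma> \<in> ramif" and t: "\<tau> \<in> ramif" for \<sigma> \<tau>
  proof -
    have G: "\<sigma> \<in> Gal" "\<tau> \<in> Gal" using s t by (auto simp: ramif_def)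
    have "\<sigma> (\<tau> x) / x - 1 \<in> \<mm>" if x: "x \<in> N" "x \<noteq> 0" for x
    proof -
      have tx: "\<tau> x \<in> N" "\<tau> x \<noteq> 0" using x G Gal_N by (auto simp: Gal_eq_0)
      have 1: "\<tau> x / x - 1 \<in> \<mm>" "\<sigma> (\<tau> x) / \<tau> x - 1 \<in> \<mm>" using s t x tx by (auto simp: ramif_def)
      have "\<tau> x / x \<in> U" using decomp_ratio[of \<tau> x] x t ramif_inertia inertia_decomp by auto
      then have "(\<sigma> (\<tau> x) / \<tau> x - 1) * (\<tau> x / x) + (\<tau> x / x - 1) \<in> \<mm>"
        using 1 by (intro m_add m_mult) auto
      moreover have "(\<sigma> (\<tau> x) / \<tau> x - 1) * (\<tau> x / x) + (\<tau> x / x - 1) = \<sigma> (\<tau> x) / x - 1"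
        using x tx by (simp add: field_simps)
      ultimately show ?thesis by (simp only:)
    qed
    then show ?thesis using Gal_comp[OF G] by (simp add: ramif_def)
  qed
  ultimately show ?thesis using Gal_id m_0 by (auto simp: subgrp_def ramif_def)
qed

lemma ramif_normal:
  assumes s: "\<sigma> \<in> decomp" and t: "\<tau> \<in> ramif"
  shows "inv \<sigma> \<circ> \<tau> \<circ> \<sigma> \<in> ramif"
proof -
  have G: "\<sigma> \<in> Gal" "\<tau> \<in> Gal" using s t by (auto simp: ramif_def decomp_def)
  have i: "inv \<sigma> \<in> decomp" using s decomp_subgrp by (simp add: subgrp_def)
  have "inv \<sigma> (\<tau> (\<sigma> x)) / x - 1 \<in> \<mm>" if x: "x \<in> N" "x \<noteq> 0" for x
  proof -
    have sx: "\<sigma> x \<in> N" "\<sigma> x \<noteq> 0" using x G Gal_N by (auto simp: Gal_eq_0)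
    then have "\<tau> (\<sigma> x) / \<sigma> x - 1 \<in> \<mm>" "\<tau> (\<sigma> x) / \<sigma> x - 1 \<in> N"
      using t subfield_N Gal_N[OF G(2)] by (auto simp: ramif_def intro: subfield_intros)
    then have "inv \<sigma> (\<tau> (\<sigma> x) / \<sigma> x - 1) \<in> \<mm>" using decomp_m_iff[OF i] by blast
    then show ?thesis using Gal_inv[OF G(1)] by (simp add: Gal_simps)
  qed
  then show ?thesis using G by (simp add: ramif_def Gal_comp Gal_inv)
qed

text \<open>This is normality of \<open>ramif\<close> in \<open>decomp\<close>. It keeps the entry
  \<open>\<sigma> z / z\<close> of \<open>tame_selector\<close> in the ramification field.\<close>

lemma inertia_stable:
  assumes s: "\<sigma> \<in> decomp" and x: "x \<in> fixf ramif"
  shows "\<sigma> x \<in> fixf ramif"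
proof -
  have G: "\<sigma> \<in> Gal" using s by (simp add: decomp_def)
  have "\<tau> (\<sigma> x) = \<sigma> x" if "\<tau> \<in> ramif" for \<tau>
  proof -
    have "(inv \<sigma> \<circ> \<tau> \<circ> \<sigma>) x = x" using ramif_normal[OF s that] x unfolding fixf_def by blast
    then have "\<sigma> (inv \<sigma> (\<tau> (\<sigma> x))) = \<sigma> x" by simp
    then show ?thesis using Gal_inv[OF G] by simp
  qed
  then show ?thesis using x G Gal_N by (auto simp: fixf_def)
qed

text \<open>If \<open>\<sigma>\<close> is outside the decomposition group, some denominator is a
  unit with image in \<open>\<mm>\<close>. Otherwise an integral \<open>x\<close> moved modulo
  \<open>\<mm>\<close> is brought into \<open>integ\<close> by a denominator \<open>u\<close>, and
  one of \<open>u\<close> and \<open>x * u\<close> must be moved as well.\<close>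

lemma inertia_witness_N:
  assumes s: "\<sigma> \<in> Gal" "\<sigma> \<notin> inertia"
  shows "\<exists>x\<in>integ. \<sigma> x - x \<notin> \<mm>"
proof (cases "\<exists>x\<in>N. x \<in> R \<and> \<sigma> x \<notin> R")
  case True
  then obtain x where x: "x \<in> N" "x \<in> R" "\<sigma> x \<notin> R" by blast
  from denominator[OF x(1)] obtain u where u: "u \<in> integ" "u \<notin> \<mm>" "\<sigma> u \<in> \<mm>" using x s by blast
  then have "\<sigma> u - u \<notin> \<mm>" using m_diff[of "\<sigma> u" "\<sigma> u - u"] by auto
  then show ?thesis using u by blast
next
  case False
  then have sR: "\<sigma> x \<in> R" if "x \<in> N" "x \<in> R" for x using that by blast
  obtain x where x: "x \<in> N" "x \<in> R" "\<sigma> x - x \<notin> \<mm>" using s by (auto simp: inertia_def)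
  from denominator[OF x(1)] obtain u where u: "u \<in> integ" "x * u \<in> integ" "u \<notin> \<mm>" using x by blast
  have sd: "\<sigma> \<in> decomp" using s sR by (simp add: decomp_def)
  show ?thesis
  proof (rule ccontr)
    assume "\<not> ?thesis"
    then have 1: "\<sigma> u - u \<in> \<mm>" "\<sigma> x * \<sigma> u - x * u \<in> \<mm>"
      using u s(1) by (auto simp: Gal_mult[OF s(1), symmetric])
    have "(\<sigma> x - x) * \<sigma> u = (\<sigma> x * \<sigma> u - x * u) - (\<sigma> u - u) * x" by (simp add: algebra_simps)
    also have "\<dots> \<in> \<mm>" by (rule m_diff[OF 1(2) m_mult[OF 1(1) x(2)]])
    finally have "(\<sigma> x - x) * \<sigma> u \<in> \<mm>" .
    moreover have "\<sigma> u \<notin> \<mm>" using decomp_m_iff[OF sd] u integ_N by blast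
    ultimately show False using notin_m_mult x(3) by blast
  qed
qed

text \<open>If \<open>\<sigma>\<close> fixed the residues of all coefficients of the orbit polynomial of \<open>x\<close> under
  inertia, whose only residual root is that of \<open>x\<close>, it would fix the residue of \<open>x\<close>.\<close>
lemma inertia_witness:
  assumes s: "\<sigma> \<in> Gal" "\<sigma> \<notin> inertia"
  shows "\<exists>z\<in>integ \<inter> fixf inertia. \<sigma> z - z \<notin> \<mm>"
proof (rule ccontr)
  assume "\<not> ?thesis"
  then have c: "\<sigma> z - z \<in> \<mm>" if "z \<in> integ \<inter> fixf inertia" for z using that by blast
  obtain x where x: "x \<in> integ" "\<sigma> x - x \<notin> \<mm>" using inertia_witness_N[OF s] by blast
  define Z where "Z = orb inertia x"
  define P where "P = roots_poly Z"
  have fin: "finite Z" unfolding Z_def by (rule finite_orb[OF inertia_Gal])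
  have P: "coeff P i \<in> integ \<inter> fixf inertia" for i
    unfolding P_def Z_def by (rule integ_coeff[OF inertia_subgrp x(1)])
  have "poly P x = 0"
    using orb_self[OF inertia_subgrp] fin by (auto simp: P_def Z_def poly_roots_poly)
  then have "\<sigma> (\<Sum>i\<le>degree P. coeff P i * x ^ i) = 0" using s by (simp add: poly_altdef Gal_0)
  then have 0: "(\<Sum>i\<le>degree P. \<sigma> (coeff P i) * \<sigma> x ^ i) = 0" using s by (simp add: Gal_simps)
  have "poly P (\<sigma> x) = (\<Sum>i\<le>degree P. coeff P i * \<sigma> x ^ i) - (\<Sum>i\<le>degree P. \<sigma> (coeff P i) * \<sigma> x ^ i)"
    by (simp add: 0 poly_altdef)
  also have "\<dots> = (\<Sum>i\<le>degree P. - (\<sigma> (coeff P i) - coeff P i) * \<sigma> x ^ i)"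
    by (simp add: sum_subtractf[symmetric] algebra_simps)
  also have "\<dots> \<in> \<mm>"
    using c[OF P] integ_R[OF integ_Gal[OF s(1) x(1)]] by (intro m_sum m_mult m_uminus R_power)
  finally have "poly P (\<sigma> x) \<in> \<mm>" .
  moreover have "poly P (\<sigma> x) \<notin> \<mm>"
    unfolding P_def poly_roots_poly
  proof (rule notin_m_prod)
    fix \<zeta> assume "\<zeta> \<in> Z"
    then obtain \<tau> where t: "\<tau> \<in> inertia" "\<zeta> = \<tau> x" by (auto simp: Z_def orb_def)
    then have "\<zeta> - x \<in> \<mm>" using x integ_N integ_R by (auto simp: inertia_def)
    then have "(\<sigma> x - x) - (\<sigma> x - \<zeta>) \<in> \<mm>" by simp
    then show "\<sigma> x - \<zeta> \<notin> \<mm>" using notin_m_cong x(2) by blast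
  qed
  ultimately show False by blast
qed

text \<open>Multiplicative counterpart of \<open>inertia_witness\<close>, normalised by
  \<open>x ^ n\<close>. If \<open>\<sigma>\<close> changed every nonzero coefficient of the orbit
  polynomial only by a factor congruent to \<open>1\<close>, the normalised value of that polynomial
  at \<open>\<sigma> x\<close> would lie in \<open>\<mm>\<close>; but each factor
  \<open>(\<sigma> x - \<zeta>) / x\<close> is congruent to the unit
  \<open>\<sigma> x / x - 1\<close>.\<close>

lemma ramification_witness:
  assumes s: "\<sigma> \<in> inertia" "\<sigma> \<notin> ramif"
  shows "\<exists>z\<in>fixf ramif. z \<noteq> 0 \<and> \<sigma> z / z - 1 \<notin> \<mm>"
proof (rule ccontr)
  assume "\<not> ?thesis"
  then have c: "\<sigma> z / z - 1 \<in> \<mm>" if "z \<in> fixf ramif" "z \<noteq> 0" for z using that by blast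
  have G: "\<sigma> \<in> Gal" using s by (simp add: inertia_def)
  obtain x where x: "x \<in> N" "x \<noteq> 0" "\<sigma> x / x - 1 \<notin> \<mm>" using s G by (auto simp: ramif_def)
  define Z where "Z = orb ramif x"
  define P where "P = roots_poly Z"
  define n where "n = card Z"
  have fin: "finite Z" unfolding Z_def by (rule finite_orb[OF ramif_Gal])
  have P: "coeff P i \<in> fixf ramif" for i
    unfolding P_def Z_def by (rule coeff_orb[OF ramif_subgrp x(1)])
  have dP: "degree P = n" using fin by (simp add: P_def n_def degree_roots_poly)
  have Z1: "\<zeta> / x - 1 \<in> \<mm>" if "\<zeta> \<in> Z" for \<zeta> using that x by (auto simp: Z_def orb_def ramif_def)
  have ZR: "\<zeta> / x \<in> R" if "\<zeta> \<in> Z" for \<zeta> using R_add[OF m_R[OF Z1[OF that]] R_1] by simp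
  have bound: "coeff P i * x ^ i / x ^ n \<in> R" for i
    unfolding P_def n_def by (rule coeff_roots_poly_bound[OF fin x(2) ZR])
  have sxx: "\<sigma> x / x \<in> R" using decomp_ratio[of \<sigma> x] s inertia_decomp x by blast
  have "poly P x = 0"
    using orb_self[OF ramif_subgrp] fin by (auto simp: P_def Z_def poly_roots_poly)
  then have "\<sigma> (\<Sum>i\<le>n. coeff P i * x ^ i) = 0" using G by (simp add: poly_altdef Gal_0 dP)
  then have 0: "(\<Sum>i\<le>n. \<sigma> (coeff P i) * \<sigma> x ^ i) = 0" using G by (simp add: Gal_simps)
  have "poly P (\<sigma> x) = (\<Sum>i\<le>n. coeff P i * \<sigma> x ^ i) - (\<Sum>i\<le>n. \<sigma> (coeff P i) * \<sigma> x ^ i)"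
    by (simp add: 0 poly_altdef dP)
  also have "\<dots> = (\<Sum>i\<le>n. (coeff P i - \<sigma> (coeff P i)) * \<sigma> x ^ i)"
    by (simp add: sum_subtractf[symmetric] algebra_simps)
  finally have "poly P (\<sigma> x) / x ^ n = (\<Sum>i\<le>n. (coeff P i - \<sigma> (coeff P i)) * \<sigma> x ^ i / x ^ n)"
    by (simp add: sum_divide_distrib)
  also have "\<dots> \<in> \<mm>"
  proof (rule m_sum)
    fix i
    show "(coeff P i - \<sigma> (coeff P i)) * \<sigma> x ^ i / x ^ n \<in> \<mm>"
    proof (cases "coeff P i = 0")
      case False
      have "- (\<sigma> (coeff P i) / coeff P i - 1) * ((coeff P i * x ^ i / x ^ n) * (\<sigma> x / x) ^ i) \<in> \<mm>"
        using c[OF P False] bound sxx by (intro m_mult m_uminus R_mult R_power)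
      moreover have "- (\<sigma> (coeff P i) / coeff P i - 1) * ((coeff P i * x ^ i / x ^ n) * (\<sigma> x / x) ^ i)
        = (coeff P i - \<sigma> (coeff P i)) * \<sigma> x ^ i / x ^ n"
        using False x(2) by (simp add: field_simps power_divide)
      ultimately show ?thesis by (simp only:)
    qed (use G in \<open>simp add: Gal_0 m_0\<close>)
  qed
  finally have "poly P (\<sigma> x) / x ^ n \<in> \<mm>" .
  moreover have "poly P (\<sigma> x) / x ^ n = (\<Prod>\<zeta>\<in>Z. (\<sigma> x - \<zeta>) / x)"
    by (simp add: P_def poly_roots_poly n_def prod_dividef)
  moreover have "(\<Prod>\<zeta>\<in>Z. (\<sigma> x - \<zeta>) / x) \<notin> \<mm>"
  proof (rule notin_m_prod)
    fix \<zeta> assume "\<zeta> \<in> Z"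
    then have "(\<sigma> x / x - 1) - (\<sigma> x - \<zeta>) / x \<in> \<mm>" using Z1 by (simp add: diff_divide_distrib)
    then show "(\<sigma> x - \<zeta>) / x \<notin> \<mm>" using notin_m_cong x(3) by blast
  qed
  ultimately show False by simp
qed

end

section \<open>Selectors and values\<close>

context fin_level
begin

lemma fixf_power: "H \<subseteq> Gal \<Longrightarrow> x \<in> fixf H \<Longrightarrow> x ^ n \<in> fixf H"
  by (rule subfield_power[OF fixf_subfield])

lemma integ_power: "x \<in> integ \<Longrightarrow> x ^ n \<in> integ"
  by (induction n) (auto intro: integ_1 integ_mult)

lemma integ_prod: "(\<And>i. i \<in> A \<Longrightarrow> f i \<in> integ) \<Longrightarrow> prod f A \<in> integ"
  by (induction A rule: infinite_finite_induct) (auto intro: integ_1 integ_mult)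

text \<open>The orbit polynomial \<open>P\<close> of \<open>\<sigma> z\<close> under inertia, read
  as the tensor of its coefficients with the powers of \<open>z\<close>, evaluates at
  \<open>e\<close> to the value of \<open>P\<close> at \<open>e z\<close>. It vanishes for
  \<open>e = \<sigma>\<close>, and at the identity every factor is congruent to
  \<open>z - \<sigma> z\<close>, which is outside \<open>\<mm>\<close>.\<close>

lemma inertia_selector:
  "\<exists>l. set l \<subseteq> (integ \<inter> fixf inertia) \<times> (integ \<inter> fixf inertia) \<and>
     (\<forall>\<sigma>\<in>Gal. (\<exists>x\<in>fixf inertia. \<sigma> x \<noteq> x) \<longrightarrow> eval_pairs l \<sigma> = 0) \<and> eval_pairs l id \<notin> \<mm>"
proof (rule selector)
  let ?A = "integ \<inter> fixf inertia"
  have A1: "1 \<in> ?A" using integ_1 fixf_subfield[OF inertia_Gal] by (auto intro: subfield_one)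
  have Am: "x * y \<in> ?A" if "x \<in> ?A" "y \<in> ?A" for x y
    using that integ_mult fixf_subfield[OF inertia_Gal] by (auto intro: subfield_mult)
  show "(1, 1) \<in> ?A \<times> ?A" using A1 by simp
  show "\<And>x y x' y'. (x, y) \<in> ?A \<times> ?A \<Longrightarrow> (x', y') \<in> ?A \<times> ?A \<Longrightarrow> (x * x', y * y') \<in> ?A \<times> ?A"
    using Am by simp
  fix \<sigma> x assume s: "\<sigma> \<in> Gal" "x \<in> fixf inertia" "\<sigma> x \<noteq> x"
  then have "\<sigma> \<notin> inertia" by (auto simp: fixf_def)
  from inertia_witness[OF s(1) this] obtain z where z: "z \<in> ?A" "\<sigma> z - z \<notin> \<mm>" by blast
  define Z where "Z = orb inertia (\<sigma> z)"
  define P where "P = roots_poly Z"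
  have fin: "finite Z" unfolding Z_def by (rule finite_orb[OF inertia_Gal])
  have sz: "\<sigma> z \<in> integ" using z s by (auto intro: integ_Gal)
  have P: "coeff P i \<in> ?A" for i
    unfolding P_def Z_def by (rule integ_coeff[OF inertia_subgrp sz])
  define l where "l = map (\<lambda>j. (coeff P j, z ^ j)) [0..<Suc (degree P)]"
  have ev: "eval_pairs l e = poly P (e z)" if "\<And>j. e (z ^ j) = e z ^ j" for e
    unfolding l_def eval_pairs_def poly_altdef
    by (simp add: o_def that interv_sum_list_conv_sum_set_nat atLeast0LessThan lessThan_Suc_atMost del: upt_Suc)
  have zp: "z ^ j \<in> ?A" for j using z by (auto intro: integ_power fixf_power[OF inertia_Gal])
  have "set l \<subseteq> ?A \<times> ?A" using P zp by (auto simp: l_def)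
  moreover have "eval_pairs l \<sigma> = 0"
    using ev[of \<sigma>] s(1) orb_self[OF inertia_subgrp] fin by (auto simp: Gal_power P_def Z_def poly_roots_poly)
  moreover have "poly P z \<notin> \<mm>"
    unfolding P_def poly_roots_poly
  proof (rule notin_m_prod)
    fix \<zeta> assume "\<zeta> \<in> Z"
    then obtain \<tau> where t: "\<tau> \<in> inertia" "\<zeta> = \<tau> (\<sigma> z)" by (auto simp: Z_def orb_def)
    then have "\<zeta> - \<sigma> z \<in> \<mm>" using sz integ_N integ_R by (auto simp: inertia_def)
    then have "(\<sigma> z - z) - (\<zeta> - z) \<in> \<mm>" using m_uminus[of "\<zeta> - \<sigma> z"] by simp
    then have "\<zeta> - z \<notin> \<mm>" using notin_m_cong z(2) by blast
    then show "z - \<zeta> \<notin> \<mm>" using m_uminus[of "z - \<zeta>"] by auto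
  qed
  then have "eval_pairs l id \<notin> \<mm>" using ev[of id] by simp
  ultimately show "\<exists>l. set l \<subseteq> ?A \<times> ?A \<and> eval_pairs l \<sigma> = 0 \<and> eval_pairs l id \<notin> \<mm>" by blast
qed (use fixf_N in auto)

text \<open>The tensor \<open>(1 / z) \<otimes> z - (\<sigma> z / z) \<otimes> 1\<close> vanishes at
  \<open>\<sigma>\<close> and equals \<open>1 - \<sigma> z / z\<close> at the identity. Its entries
  need not be integral, so only \<open>x * y\<close> is required to be in \<open>R\<close>; as
  inertia preserves values, \<open>x * \<sigma> y\<close> is then in \<open>R\<close> too.\<close>

lemma tame_selector:
  "\<exists>l. set l \<subseteq> {(x, y). x \<in> fixf ramif \<and> y \<in> fixf ramif \<and> y \<noteq> 0 \<and> x * y \<in> R} \<and>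
     (\<forall>\<sigma>\<in>inertia. (\<exists>x\<in>fixf ramif. \<sigma> x \<noteq> x) \<longrightarrow> eval_pairs l \<sigma> = 0) \<and> eval_pairs l id \<notin> \<mm>"
proof (rule selector)
  let ?P = "{(x, y). x \<in> fixf ramif \<and> y \<in> fixf ramif \<and> y \<noteq> 0 \<and> x * y \<in> R}"
  note sub = fixf_subfield[OF ramif_Gal]
  show "(1, 1) \<in> ?P" using sub R_1 by (auto intro: subfield_one)
  show "(x * x', y * y') \<in> ?P" if "(x, y) \<in> ?P" "(x', y') \<in> ?P" for x y x' y'
    using that R_mult[of "x * y" "x' * y'"] sub by (auto intro: subfield_mult simp: ac_simps)
  fix \<sigma> x assume s: "\<sigma> \<in> inertia" "x \<in> fixf ramif" "\<sigma> x \<noteq> x"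
  then have "\<sigma> \<notin> ramif" by (auto simp: fixf_def)
  from ramification_witness[OF s(1) this] obtain z where
    z: "z \<in> fixf ramif" "z \<noteq> 0" "\<sigma> z / z - 1 \<notin> \<mm>" by blast
  have sd: "\<sigma> \<in> decomp" using s inertia_decomp by blast
  then have G: "\<sigma> \<in> Gal" by (simp add: decomp_def)
  define l where "l = [(1 / z, z), (- (\<sigma> z / z), 1)]"
  have zN: "z \<in> N" using z fixf_N by blast
  have "\<sigma> z / z \<in> R" using decomp_ratio[OF sd zN z(2)] by blast
  then have "- (\<sigma> z / z) \<in> R" by (rule R_uminus)
  then have "set l \<subseteq> ?P"
    using z inertia_stable[OF sd z(1)] sub by (auto simp: l_def R_1 intro: subfield_intros)
  moreover have "eval_pairs l \<sigma> = 0" using G by (simp add: l_def eval_pairs_def Gal_1)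
  moreover have "eval_pairs l id \<notin> \<mm>"
    using z m_uminus[of "1 - \<sigma> z / z"] by (auto simp: l_def eval_pairs_def)
  ultimately show "\<exists>l. set l \<subseteq> ?P \<and> eval_pairs l \<sigma> = 0 \<and> eval_pairs l id \<notin> \<mm>" by blast
qed (use fixf_N inertia_Gal in auto)

section \<open>Trace duality and the tame ramification index\<close>

lemma eval_pairs_restrict:
  "set l \<subseteq> UNIV \<times> M \<Longrightarrow> eval_pairs l (restrict \<sigma> M) = eval_pairs l \<sigma>"
  by (induction l) (auto simp: eval_pairs_def)

lemma emb_id: "subgrp H \<Longrightarrow> restrict id M \<in> emb H M"
  by (auto simp: emb_def subgrp_def)

text \<open>Every embedding other than the identity contributes zero. Exponent \<open>1\<close>
  gives trace duality, exponent \<open>p\<close> its Frobenius twist.\<close>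

lemma selector_collapse:
  assumes H: "subgrp H" and M: "M \<subseteq> N" and l: "set l \<subseteq> UNIV \<times> M"
    and sel: "\<forall>\<sigma>\<in>H. (\<exists>x\<in>M. \<sigma> x \<noteq> x) \<longrightarrow> eval_pairs l \<sigma> = 0" and n: "n > 0"
  shows "(\<Sum>e\<in>emb H M. f e * eval_pairs l e ^ n) = f (restrict id M) * eval_pairs l id ^ n"
proof -
  have "eval_pairs l e = 0" if e: "e \<in> emb H M - {restrict id M}" for e
  proof -
    obtain \<sigma> where s: "\<sigma> \<in> H" "e = restrict \<sigma> M" "e \<noteq> restrict id M" using e unfolding emb_def by blast
    then have "\<exists>x\<in>M. \<sigma> x \<noteq> x" by (metis id_apply restrict_ext)
    then show ?thesis using sel s(1) eval_pairs_restrict[OF l] s(2) by simp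
  qed
  moreover have "finite (emb H M)" using H by (intro finite_emb M) (simp add: subgrp_def)
  ultimately have "(\<Sum>e\<in>emb H M. f e * eval_pairs l e ^ n) =
    (\<Sum>e\<in>{restrict id M}. f e * eval_pairs l e ^ n)"
    using emb_id[OF H] n by (intro sum.mono_neutral_right) auto
  then show ?thesis using eval_pairs_restrict[OF l] by simp
qed

text \<open>Interchange the sums. The formula recovers \<open>t\<close> from traces up to a factor
  outside \<open>\<mm>\<close>, so with integral first entries these traces cannot all be small
  compared with \<open>t\<close>.\<close>

lemma selector_trace:
  assumes H: "subgrp H" and M: "M \<subseteq> N" and l: "set l \<subseteq> UNIV \<times> M"
    and sel: "\<forall>\<sigma>\<in>H. (\<exists>x\<in>M. \<sigma> x \<noteq> x) \<longrightarrow> eval_pairs l \<sigma> = 0"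
    and t: "t \<in> M" and mult: "\<And>y. y \<in> M \<Longrightarrow> t * y \<in> M"
  shows "(\<Sum>(x, y)\<leftarrow>l. x * (\<Sum>e\<in>emb H M. e (t * y))) = t * eval_pairs l id"
proof -
  have "e t * e y = e (t * y)" if "e \<in> emb H M" "y \<in> M" for e y
    using that t mult H by (auto simp: emb_def subgrp_def Gal_mult subset_iff)
  then have "(\<Sum>(x, y)\<leftarrow>l. x * (\<Sum>e\<in>emb H M. e (t * y))) = (\<Sum>e\<in>emb H M. e t * eval_pairs l e)"
    using l
    by (induction l)
       (auto simp: eval_pairs_def sum.distrib sum_distrib_left distrib_left mult.left_commute intro!: sum.cong)
  also have "\<dots> = t * eval_pairs l id"
    using selector_collapse[OF H M l sel, of 1 "\<lambda>e. e t"] t by simp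
  finally show ?thesis .
qed

text \<open>If the tame ramification index vanished in the residue field, every
  \<open>\<Sum>\<^sub>e e y / y\<close> would lie in the maximal ideal: it is a sum over the values of a character.\<close>
lemma tame_index: "of_nat (card (emb inertia (fixf ramif))) \<notin> \<mm>"
proof
  let ?M = "fixf ramif"
  let ?E = "emb inertia ?M"
  assume n: "of_nat (card ?E) \<in> \<mm>"
  have fin: "finite ?E" by (rule finite_emb[OF inertia_Gal fixf_N])
  have ratio: "e y / y \<in> R" if ey: "e \<in> ?E" "y \<in> ?M" "y \<noteq> 0" for e y
  proof -
    obtain \<sigma> where "\<sigma> \<in> decomp" "e y = \<sigma> y" using ey inertia_decomp by (auto simp: emb_def)
    moreover have "y \<in> N" using ey fixf_N by blast
    ultimately show ?thesis using decomp_ratio[of \<sigma> y] ey by simp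
  qed
  have char: "(\<Sum>e\<in>?E. e y / y) \<in> \<mm>" if y: "y \<in> ?M" "y \<noteq> 0" for y
  proof (cases "\<exists>\<tau>\<in>inertia. \<tau> y / y - 1 \<notin> \<mm>")
    case True
    then obtain \<tau> where t: "\<tau> \<in> inertia" "\<tau> y / y - 1 \<notin> \<mm>" by blast
    have tG: "\<tau> \<in> Gal" using t inertia_Gal by blast
    define T where "T = (\<Sum>e\<in>?E. e y / y)"
    have yN: "y \<in> N" using y fixf_N by blast
    have TR: "T \<in> R" unfolding T_def using ratio y by (intro R_sum)
    have "T \<in> N" unfolding T_def
      using emb_N[OF inertia_Gal fixf_N _ y(1)] yN subfield_N by (intro subfield_sum subfield_divide) auto
    then have "\<tau> T - T \<in> \<mm>" using t TR by (simp add: inertia_def)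
    \<comment> \<open>Applying \<open>\<tau>\<close> permutes the numerators and replaces the
      denominator \<open>y\<close> by \<open>\<tau> y\<close>.\<close>
    moreover have "\<tau> T = T * y / \<tau> y"
    proof -
      have "\<tau> T = (\<Sum>e\<in>?E. \<tau> (e y)) / \<tau> y"
        unfolding T_def using tG by (simp add: Gal_sum Gal_divide sum_divide_distrib)
      also have "\<dots> = (\<Sum>e\<in>?E. e y) / \<tau> y" by (simp add: trace_comp[OF inertia_subgrp fixf_N t(1) y(1)])
      also have "\<dots> = T * y / \<tau> y" using y by (simp add: T_def sum_divide_distrib[symmetric])
      finally show ?thesis .
    qed
    ultimately have "(T * y / \<tau> y - T) * (\<tau> y / y) \<in> \<mm>"
      using decomp_ratio[of \<tau> y] t inertia_decomp yN y by (intro m_mult) auto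
    moreover have "(T * y / \<tau> y - T) * (\<tau> y / y) = - (T * (\<tau> y / y - 1))"
      using y tG by (simp add: field_simps Gal_eq_0)
    ultimately have "- (T * (\<tau> y / y - 1)) \<in> \<mm>" by (simp only:)
    then have "T * (\<tau> y / y - 1) \<in> \<mm>" using m_uminus by fastforce
    then show ?thesis using notin_m_mult t(2) unfolding T_def by blast
  next
    case False
    have "(\<Sum>e\<in>?E. e y / y - 1) \<in> \<mm>"
      using False y by (intro m_sum) (auto simp: emb_def)
    moreover have "(\<Sum>e\<in>?E. e y / y - 1) = (\<Sum>e\<in>?E. e y / y) - of_nat (card ?E)"
      by (simp add: sum_subtractf)
    ultimately show ?thesis using n m_add by fastforce
  qed
  obtain l where l: "set l \<subseteq> {(x, y). x \<in> ?M \<and> y \<in> ?M \<and> y \<noteq> 0 \<and> x * y \<in> R}"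
    "\<And>\<sigma>. \<sigma> \<in> inertia \<Longrightarrow> \<exists>x\<in>?M. \<sigma> x \<noteq> x \<Longrightarrow> eval_pairs l \<sigma> = 0" "eval_pairs l id \<notin> \<mm>"
    using tame_selector by auto
  have lM: "set l \<subseteq> UNIV \<times> ?M" using l(1) by auto
  have "1 \<in> ?M" by (rule subfield_one[OF fixf_subfield[OF ramif_Gal]])
  \<comment> \<open>Trace duality for \<open>t = 1\<close> expresses an element outside
    \<open>\<mm>\<close> through the traces of the \<open>y\<close>, which are small by
    \<open>char\<close>.\<close>
  from selector_trace[OF inertia_subgrp fixf_N lM _ this] l(2)
  have "(\<Sum>(x, y)\<leftarrow>l. x * (\<Sum>e\<in>?E. e y)) = eval_pairs l id" by simp
  moreover have "(\<Sum>(x, y)\<leftarrow>l. x * (\<Sum>e\<in>?E. e y)) \<in> \<mm>"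
  proof (rule m_sum_list, clarify)
    fix x y assume "(x, y) \<in> set l"
    then have xy: "y \<in> ?M" "y \<noteq> 0" "x * y \<in> R" using l(1) by auto
    have "x * y * (\<Sum>e\<in>?E. e y / y) \<in> \<mm>" by (rule m_mult2[OF xy(3) char[OF xy(1,2)]])
    then show "x * (\<Sum>e\<in>?E. e y) \<in> \<mm>" using xy(2) by (simp add: sum_divide_distrib[symmetric])
  qed
  ultimately show False using l(3) by simp
qed

section \<open>Values of the decomposition, inertia and ramification fields\<close>

lemma decomposition_separator:
  "\<exists>w\<in>integ \<inter> fixf decomp. w \<notin> \<mm> \<and> (\<forall>\<sigma>\<in>Gal. \<sigma> \<notin> decomp \<longrightarrow> \<sigma> w \<in> \<mm>)"
proof -
  define S where "S = {restrict \<sigma> N |\<sigma>. \<sigma> \<in> Gal \<and> \<sigma> \<notin> decomp}"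
  have fin: "finite S" using finite_level by (rule rev_finite_subset) (auto simp: S_def)
  have "\<exists>u\<in>integ. u \<notin> \<mm> \<and> e u \<in> \<mm>" if "e \<in> S" for e
  proof -
    obtain \<sigma> where s: "e = restrict \<sigma> N" "\<sigma> \<in> Gal" "\<sigma> \<notin> decomp" using \<open>e \<in> S\<close> by (auto simp: S_def)
    then obtain x where x: "x \<in> N" "x \<in> R" "\<sigma> x \<notin> R" by (auto simp: decomp_def)
    from denominator[OF x(1)] obtain u where "u \<in> integ" "u \<notin> \<mm>" "\<sigma> u \<in> \<mm>" using x s by blast
    then show ?thesis using s(1) integ_N by auto
  qed
  then obtain u where u: "\<And>e. e \<in> S \<Longrightarrow> u e \<in> integ \<and> u e \<notin> \<mm> \<and> e (u e) \<in> \<mm>" by metis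
  \<comment> \<open>One factor for each restriction outside \<open>decomp\<close>: it is a unit that
    this restriction maps into \<open>\<mm>\<close>.\<close>
  define w0 where "w0 = prod u S"
  have w0: "w0 \<notin> \<mm>" unfolding w0_def using u by (intro notin_m_prod) blast
  have w0i: "w0 \<in> integ"
    unfolding w0_def using u by (intro integ_prod) blast
  have sw0: "\<sigma> w0 \<in> \<mm>" if s: "\<sigma> \<in> Gal" "\<sigma> \<notin> decomp" for \<sigma>
  proof -
    have e: "restrict \<sigma> N \<in> S" using s by (auto simp: S_def)
    have "(\<Prod>e\<in>S. \<sigma> (u e)) \<in> \<mm>"
    proof (rule m_prod[OF fin e])
      show "\<sigma> (u (restrict \<sigma> N)) \<in> \<mm>" using u[OF e] integ_N by auto
      show "\<sigma> (u i) \<in> R" if "i \<in> S" for i using u[OF that] integ_R integ_Gal s by blast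
    qed
    then show ?thesis using s by (simp add: w0_def Gal_prod)
  qed
  \<comment> \<open>The orbit product is invariant under \<open>decomp\<close>; its factor
    \<open>w0\<close> keeps the images under the other automorphisms in
    \<open>\<mm>\<close>.\<close>
  define w where "w = \<Prod>(orb decomp w0)"
  have fo: "finite (orb decomp w0)" by (rule finite_orb[OF decomp_Gal])
  have w0N: "w0 \<in> N" "w0 \<noteq> 0" using w0i integ_N w0 m_0 by auto
  have "\<zeta> \<notin> \<mm>" if "\<zeta> \<in> orb decomp w0" for \<zeta>
    using that decomp_m_iff w0 w0N by (auto simp: orb_def)
  then have 1: "w \<notin> \<mm>" unfolding w_def by (intro notin_m_prod) auto
  have oi: "\<zeta> \<in> integ" if "\<zeta> \<in> orb decomp w0" for \<zeta>
    using that w0i integ_Gal decomp_Gal by (auto simp: orb_def)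
  then have "w \<in> integ"
    unfolding w_def by (rule integ_prod)
  moreover have "w \<in> fixf decomp" unfolding w_def by (rule prod_orb[OF decomp_subgrp w0N(1)])
  moreover have "\<sigma> w \<in> \<mm>" if s: "\<sigma> \<in> Gal" "\<sigma> \<notin> decomp" for \<sigma>
  proof -
    have "(\<Prod>\<zeta>\<in>orb decomp w0. \<sigma> \<zeta>) \<in> \<mm>"
    proof (rule m_prod[OF fo orb_self[OF decomp_subgrp]])
      show "\<sigma> w0 \<in> \<mm>" by (rule sw0[OF s])
      show "\<sigma> i \<in> R" if "i \<in> orb decomp w0" for i using oi[OF that] s integ_R integ_Gal by blast
    qed
    then show ?thesis using s by (simp add: w_def Gal_prod)
  qed
  ultimately show ?thesis using 1 by blast
qed

text \<open>Multiplying \<open>x\<close> by a power of the unit \<open>w\<close> of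
  \<open>decomposition_separator\<close> keeps its value, but a suitable power gives all conjugates
  by automorphisms outside \<open>decomp\<close> a different value. The Newton polygon of the orbit
  polynomial over \<open>K\<close> then has a segment of length one for the value of
  \<open>x\<close>, which is therefore a value of \<open>K\<close>.\<close>

lemma decomposition_value:
  assumes x: "x \<in> fixf decomp" "x \<noteq> 0"
  shows "\<exists>a\<in>K. x / a \<in> U"
proof -
  obtain w where w: "w \<in> integ" "w \<in> fixf decomp" "w \<notin> \<mm>" "\<And>\<sigma>. \<sigma> \<in> Gal \<Longrightarrow> \<sigma> \<notin> decomp \<Longrightarrow> \<sigma> w \<in> \<mm>"
    using decomposition_separator by auto
  have wU: "w \<in> U" using w integ_R by auto
  then have w0: "w \<noteq> 0" using m_0 by auto
  have wN: "w \<in> N" "x \<in> N" using w x fixf_N by auto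
  define z where "z k = x * w ^ k" for k
  define S where "S = {restrict \<sigma> N |\<sigma>. \<sigma> \<in> Gal \<and> \<sigma> \<notin> decomp}"
  have fin: "finite S" using finite_level by (rule rev_finite_subset) (auto simp: S_def)
  have zN: "z k \<in> N" for k using wN subfield_N by (auto simp: z_def intro: subfield_intros)
  define bad where "bad e = {k. e (z k) / z k \<in> U}" for e
  have "finite (bad e)" if "e \<in> S" for e
  proof -
    obtain \<sigma> where s: "e = restrict \<sigma> N" "\<sigma> \<in> Gal" "\<sigma> \<notin> decomp" using \<open>e \<in> S\<close> by (auto simp: S_def)
    have swm: "\<sigma> w / w \<in> \<mm>"
      unfolding divide_inverse using w(4)[OF s(2,3)] U_inverse[OF wU] by (intro m_mult) auto
    \<comment> \<open>Each \<open>\<sigma>\<close> outside \<open>decomp\<close> excludes at most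
      one exponent, since \<open>\<sigma> w / w\<close> has positive value.\<close>
    have False if "k < j" "k \<in> bad e" "j \<in> bad e" for k j
    proof -
      have U: "\<sigma> (z j) / z j \<in> U" "\<sigma> (z k) / z k \<in> U" using that s zN by (auto simp: bad_def)
      have "j = k + (j - k)" using that by simp
      then have "z j = z k * w ^ (j - k)" by (simp add: z_def power_add[symmetric] mult.assoc)
      then have "(\<sigma> (z j) / z j) / (\<sigma> (z k) / z k) = (\<sigma> w / w) ^ (j - k)"
        using s x w0 by (simp add: z_def Gal_simps power_divide)
      moreover have "(\<sigma> w / w) ^ (j - k) \<in> \<mm>" using swm that by (intro m_power) auto
      ultimately show False using U_divide[OF U] by simp
    qed
    then have "j = k" if "k \<in> bad e" "j \<in> bad e" for k j using that by (metis linorder_neqE_nat)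
    then have "bad e \<subseteq> {SOME k. k \<in> bad e}" by (metis insertI1 someI subsetI)
    then show ?thesis by (rule finite_subset) simp
  qed
  then have "finite (\<Union>(bad ` S))" using fin by simp
  then obtain k where k: "k \<notin> \<Union>(bad ` S)" using ex_new_if_finite[OF infinite_UNIV_nat] by blast
  let ?z = "z k"
  have z0: "?z \<noteq> 0" using x w0 by (simp add: z_def)
  define Z where "Z = orb Gal ?z"
  have sepZ: "\<zeta> / ?z \<in> \<mm> \<or> ?z / \<zeta> \<in> \<mm>" if "\<zeta> \<in> Z" "\<zeta> \<noteq> ?z" for \<zeta>
  proof -
    obtain \<sigma> where s: "\<sigma> \<in> Gal" "\<zeta> = \<sigma> ?z" using \<open>\<zeta> \<in> Z\<close> by (auto simp: Z_def orb_def)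
    have "?z \<in> fixf decomp"
      using x(1) w(2) fixf_subfield[OF decomp_Gal] by (auto simp: z_def intro: subfield_intros)
    then have "\<sigma> \<notin> decomp" using \<open>\<zeta> \<noteq> ?z\<close> s by (auto simp: fixf_def)
    then have "restrict \<sigma> N \<in> S" using s by (auto simp: S_def)
    then have "\<zeta> / ?z \<notin> U" using k zN s by (auto simp: bad_def)
    moreover have "\<zeta> / ?z \<noteq> 0" using z0 s by (simp add: Gal_eq_0)
    ultimately have "\<zeta> / ?z \<in> \<mm> \<or> inverse (\<zeta> / ?z) \<in> \<mm>" using not_U by blast
    then show ?thesis by simp
  qed
  have Zf: "finite Z" "?z \<in> Z" "0 \<notin> Z"
    using finite_orb orb_self[OF subgrp_Gal] z0 by (auto simp: Z_def orb_def Gal_eq_0)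
  from isolated_root_value[OF Zf sepZ] obtain i where
    i: "coeff (roots_poly Z) i / coeff (roots_poly Z) (Suc i) / ?z \<in> U" by blast
  define a where "a = coeff (roots_poly Z) i / coeff (roots_poly Z) (Suc i)"
  have "coeff (roots_poly Z) j \<in> K" for j
    using coeff_orb[OF subgrp_Gal zN] by (simp add: Z_def fixf_Gal)
  then have aK: "a \<in> K" using subfield_K by (auto simp: a_def intro: subfield_divide)
  have "inverse (a / ?z) * inverse (w ^ k) \<in> U"
    using i by (intro U_mult U_inverse U_power wU) (simp add: a_def)
  moreover have "inverse (a / ?z) * inverse (w ^ k) = x / a" using w0 by (simp add: z_def field_simps)
  ultimately have "x / a \<in> U" by (simp only:)
  then show ?thesis using aK by blast
qed

text \<open>All \<open>e x\<close> have the value of \<open>x\<close>, so the trace of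
  \<open>x * y\<close> down to the decomposition field has at least that value; by trace duality
  equality holds for some \<open>y\<close>.\<close>

lemma inertia_value:
  assumes x: "x \<in> fixf inertia" "x \<noteq> 0"
  shows "\<exists>a\<in>K. x / a \<in> U"
proof -
  let ?M = "fixf inertia"
  let ?E = "emb decomp ?M"
  obtain l where l: "set l \<subseteq> (integ \<inter> ?M) \<times> (integ \<inter> ?M)"
    "\<And>\<sigma>. \<sigma> \<in> Gal \<Longrightarrow> \<exists>x\<in>?M. \<sigma> x \<noteq> x \<Longrightarrow> eval_pairs l \<sigma> = 0" "eval_pairs l id \<notin> \<mm>"
    using inertia_selector by auto
  have lM: "set l \<subseteq> UNIV \<times> ?M" using l(1) by auto
  have xN: "x \<in> N" using x fixf_N by blast
  have mult: "e (x * y) = e x * e y" if "e \<in> ?E" "y \<in> ?M" for e y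
  proof -
    have "x * y \<in> ?M" using x that fixf_subfield[OF inertia_Gal] by (auto intro: subfield_mult)
    then show ?thesis using that x decomp_Gal by (auto simp: emb_def Gal_mult)
  qed
  have eq: "(\<Sum>(u, y)\<leftarrow>l. u * (\<Sum>e\<in>?E. e (x * y))) = x * eval_pairs l id"
    using l(2) decomp_Gal x(1) fixf_subfield[OF inertia_Gal]
    by (intro selector_trace decomp_subgrp fixf_N lM) (auto intro: subfield_mult)
  have "\<exists>(u, y)\<in>set l. (\<Sum>e\<in>?E. e (x * y)) / x \<notin> \<mm>"
  proof (rule ccontr)
    assume a: "\<not> ?thesis"
    have "(\<Sum>(u, y)\<leftarrow>l. u * ((\<Sum>e\<in>?E. e (x * y)) / x)) \<in> \<mm>"
    proof (rule m_sum_list, clarify)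
      fix u y assume uy: "(u, y) \<in> set l"
      then have "u \<in> R" using l(1) integ_R by auto
      moreover have "(\<Sum>e\<in>?E. e (x * y)) / x \<in> \<mm>" using a uy by blast
      ultimately show "u * ((\<Sum>e\<in>?E. e (x * y)) / x) \<in> \<mm>" by (rule m_mult2)
    qed
    moreover have "(\<Sum>(u, y)\<leftarrow>l. u * ((\<Sum>e\<in>?E. e (x * y)) / x)) = (\<Sum>(u, y)\<leftarrow>l. u * (\<Sum>e\<in>?E. e (x * y))) / x"
      by (induction l) (auto simp: add_divide_distrib)
    ultimately show False using l(3) x eq by simp
  qed
  then obtain u y where uy: "(u, y) \<in> set l" "(\<Sum>e\<in>?E. e (x * y)) / x \<notin> \<mm>" by blast
  then have y: "y \<in> integ" "y \<in> ?M" using l(1) by auto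
  define t where "t = (\<Sum>e\<in>?E. e (x * y))"
  have "t / x = (\<Sum>e\<in>?E. (e x / x) * e y)"
    using y by (simp add: t_def mult sum_divide_distrib)
  also have "\<dots> \<in> R"
  proof (rule R_sum)
    fix e assume "e \<in> ?E"
    then obtain \<sigma> where s: "\<sigma> \<in> decomp" "e x = \<sigma> x" "e y = \<sigma> y" using x y by (auto simp: emb_def)
    have "\<sigma> x / x \<in> R" using decomp_ratio[OF s(1) xN x(2)] by blast
    moreover have "\<sigma> y \<in> R" using integ_R[OF integ_Gal[of \<sigma> y]] y s decomp_Gal by blast
    ultimately show "(e x / x) * e y \<in> R" unfolding s by (rule R_mult)
  qed
  finally have tU: "t / x \<in> U" using uy(2) by (simp add: t_def)
  have "x * y \<in> ?M" using x y fixf_subfield[OF inertia_Gal] by (auto intro: subfield_mult)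
  then have "t \<in> fixf decomp" unfolding t_def by (rule trace_fixf[OF decomp_subgrp fixf_N])
  moreover have "t \<noteq> 0" using tU m_0 by auto
  ultimately obtain a where a: "a \<in> K" "t / a \<in> U" using decomposition_value by blast
  have "inverse (t / x) * (t / a) \<in> U" by (intro U_mult U_inverse tU a)
  moreover have "inverse (t / x) * (t / a) = x / a" using \<open>t \<noteq> 0\<close> by simp
  ultimately have "x / a \<in> U" by (simp only:)
  then show ?thesis using a(1) by blast
qed

text \<open>Take the norm down to the inertia field; all conjugates under \<open>inertia\<close>
  have the same value.\<close>

lemma tame_value:
  assumes x: "x \<in> fixf ramif" "x \<noteq> 0"
  shows "\<exists>a\<in>fixf inertia. x ^ card (emb inertia (fixf ramif)) / a \<in> U"
proof -
  let ?E = "emb inertia (fixf ramif)"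
  define a where "a = (\<Prod>e\<in>?E. e x)"
  have "a \<in> fixf inertia" unfolding a_def by (rule norm_fixf[OF inertia_subgrp fixf_N x(1)])
  moreover have "(\<Prod>e\<in>?E. e x / x) \<in> U"
  proof (rule U_prod)
    fix e assume "e \<in> ?E"
    then obtain \<sigma> where "\<sigma> \<in> decomp" "e x = \<sigma> x" using x inertia_decomp by (auto simp: emb_def)
    moreover have "x \<in> N" using x fixf_N by blast
    ultimately show "e x / x \<in> U" using decomp_ratio[of \<sigma> x] x by simp
  qed
  then have "inverse (\<Prod>e\<in>?E. e x / x) \<in> U" by (rule U_inverse)
  moreover have "(\<Prod>e\<in>?E. e x / x) = a / x ^ card ?E" by (simp add: prod_dividef a_def)
  ultimately show ?thesis by (intro bexI[of _ a]) auto
qed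

end

section \<open>Frobenius modulo a divisor of p\<close>

context val_ring
begin

definition cgr :: "'a \<Rightarrow> 'a \<Rightarrow> 'a \<Rightarrow> bool" where
  "cgr d x y \<longleftrightarrow> (\<exists>c\<in>R. x - y = d * c)"

lemma cgr_refl: "cgr d x x"
  by (auto simp: cgr_def intro!: bexI[of _ 0] R_0)

lemma cgr_sym: "cgr d x y \<Longrightarrow> cgr d y x"
proof -
  assume "cgr d x y"
  then obtain c where "c \<in> R" "x - y = d * c" by (auto simp: cgr_def)
  then have "y - x = d * (- c)" by (simp add: algebra_simps)
  then show ?thesis unfolding cgr_def using R_uminus[OF \<open>c \<in> R\<close>] by blast
qed

lemma cgr_add: "cgr d x y \<Longrightarrow> cgr d x' y' \<Longrightarrow> cgr d (x + x') (y + y')"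
proof -
  assume "cgr d x y" "cgr d x' y'"
  then obtain c c' where "c \<in> R" "x - y = d * c" "c' \<in> R" "x' - y' = d * c'" by (auto simp: cgr_def)
  then have "(x + x') - (y + y') = d * (c + c')" by (simp add: algebra_simps)
  then show ?thesis using R_add[OF \<open>c \<in> R\<close> \<open>c' \<in> R\<close>] by (auto simp: cgr_def)
qed

lemma cgr_trans [trans]: "cgr d x y \<Longrightarrow> cgr d y z \<Longrightarrow> cgr d x z"
  using cgr_add[of d x y y z] by (simp add: cgr_def)

lemma cgr_eq_trans [trans]: "cgr d x y \<Longrightarrow> y = z \<Longrightarrow> cgr d x z"
  and eq_cgr_trans [trans]: "x = y \<Longrightarrow> cgr d y z \<Longrightarrow> cgr d x z"
  by simp_all

lemma cgr_mult: "cgr d x y \<Longrightarrow> z \<in> R \<Longrightarrow> cgr d (z * x) (z * y)"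
proof -
  assume "cgr d x y" "z \<in> R"
  then obtain c where c: "c \<in> R" "x - y = d * c" by (auto simp: cgr_def)
  then have "z * x - z * y = d * (z * c)" by (simp add: right_diff_distrib[symmetric])
  then show ?thesis using R_mult[OF \<open>z \<in> R\<close> c(1)] by (auto simp: cgr_def)
qed

lemma cgr_sum: "(\<And>i. i \<in> A \<Longrightarrow> cgr d (f i) (g i)) \<Longrightarrow> cgr d (sum f A) (sum g A)"
  by (induction A rule: infinite_finite_induct) (auto intro: cgr_refl cgr_add)

lemma cgr_sum_list:
  "(\<And>x. x \<in> set l \<Longrightarrow> cgr d (f x) (g x)) \<Longrightarrow> cgr d (sum_list (map f l)) (sum_list (map g l))"
  by (induction l) (auto intro: cgr_refl cgr_add)

lemma cgr_divide:
  assumes "cgr d x (y * u)" "u \<in> U"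
  shows "cgr d (x / u) y"
proof -
  have "inverse u \<in> R" using U_inverse[OF assms(2)] by blast
  from cgr_mult[OF assms(1) this] have "cgr d (inverse u * x) (inverse u * (y * u))" .
  moreover have "u \<noteq> 0" using assms(2) m_0 by auto
  then have "inverse u * x = x / u" "inverse u * (y * u) = y" by (auto simp: field_simps)
  ultimately show ?thesis by (simp only:)
qed

text \<open>A modulus \<open>d\<close> dividing the residue characteristic \<open>p\<close>, so that Frobenius is additive
  modulo \<open>d\<close>; \<open>d = 0\<close> is allowed in characteristic \<open>p\<close>.\<close>
definition fmod :: "nat \<Rightarrow> 'a \<Rightarrow> bool" where
  "fmod p d \<longleftrightarrow> prime p \<and> (\<exists>r\<in>R. of_nat p = d * r)"

lemma frobenius_add:
  assumes d: "fmod p d" and x: "x \<in> R" and y: "y \<in> R"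
  shows "cgr d ((x + y) ^ p) (x ^ p + y ^ p)"
proof -
  have p: "prime p" using d by (simp add: fmod_def)
  then have p0: "p > 0" by (simp add: prime_gt_0_nat)
  obtain r where r: "r \<in> R" "of_nat p = d * r" using d by (auto simp: fmod_def)
  define f where "f k = of_nat (p choose k) * x ^ k * y ^ (p - k)" for k
  have "(x + y) ^ p = (\<Sum>k\<le>p. f k)" unfolding f_def by (rule binomial_ring)
  also have "\<dots> = f 0 + f p + (\<Sum>k\<in>{..p} - {0, p}. f k)"
    using p0 by (subst sum.subset_diff[of "{0, p}"]) auto
  finally have "(x + y) ^ p - (x ^ p + y ^ p) = (\<Sum>k\<in>{..p} - {0, p}. f k)" using p0 by (simp add: f_def)
  also have "\<dots> = (\<Sum>k\<in>{..p} - {0, p}. d * (r * of_nat ((p choose k) div p) * x ^ k * y ^ (p - k)))"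
  proof (rule sum.cong[OF refl])
    fix k assume "k \<in> {..p} - {0, p}"
    then have "p dvd (p choose k)" using p by (intro dvd_choose_prime) auto
    then have "p choose k = p * ((p choose k) div p)" by simp
    then have "of_nat (p choose k) = d * r * of_nat ((p choose k) div p)" by (metis of_nat_mult r(2))
    then show "f k = d * (r * of_nat ((p choose k) div p) * x ^ k * y ^ (p - k))"
      by (simp add: f_def ac_simps)
  qed
  also have "\<dots> = d * (\<Sum>k\<in>{..p} - {0, p}. r * of_nat ((p choose k) div p) * x ^ k * y ^ (p - k))"
    by (simp add: sum_distrib_left)
  finally show ?thesis
    unfolding cgr_def using r x y
    by (intro bexI[of _ "\<Sum>k\<in>{..p} - {0, p}. r * of_nat ((p choose k) div p) * x ^ k * y ^ (p - k)"] R_sum R_mult R_power R_of_nat)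
qed

lemma frobenius_sum:
  assumes d: "fmod p d" and "\<And>i. i \<in> A \<Longrightarrow> f i \<in> R"
  shows "cgr d (sum f A ^ p) (\<Sum>i\<in>A. f i ^ p)"
  using assms(2)
proof (induction A rule: infinite_finite_induct)
  case (insert a A)
  have "cgr d (sum f (insert a A) ^ p) (f a ^ p + sum f A ^ p)"
    using insert frobenius_add[OF d, of "f a" "sum f A"] by (simp add: R_sum)
  also have "cgr d (f a ^ p + sum f A ^ p) (f a ^ p + (\<Sum>i\<in>A. f i ^ p))"
    using insert by (intro cgr_add cgr_refl) auto
  finally show ?case using insert by simp
qed (use d in \<open>auto simp: fmod_def prime_gt_0_nat power_0_left intro: cgr_refl\<close>)

lemma frobenius_sum_list:
  assumes d: "fmod p d" and "\<And>i. i \<in> set l \<Longrightarrow> f i \<in> R"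
  shows "cgr d (sum_list (map f l) ^ p) (\<Sum>i\<leftarrow>l. f i ^ p)"
  using assms(2)
proof (induction l)
  case (Cons a l)
  have "cgr d (sum_list (map f (a # l)) ^ p) (f a ^ p + sum_list (map f l) ^ p)"
    using Cons frobenius_add[OF d, of "f a" "sum_list (map f l)"] by (simp add: R_sum_list)
  also have "cgr d (f a ^ p + sum_list (map f l) ^ p) (f a ^ p + (\<Sum>i\<leftarrow>l. f i ^ p))"
    using Cons by (intro cgr_add cgr_refl) auto
  finally show ?case by simp
qed (use d in \<open>auto simp: fmod_def prime_gt_0_nat power_0_left intro: cgr_refl\<close>)

text \<open>\<open>DRvr\<close> without the completion: \<open>d = p\<close> in mixed
  characteristic; in characteristic \<open>p\<close> all nonzero \<open>d\<close> in
  \<open>K\<close>, or \<open>d = 0\<close> for the trivial valuation.\<close>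

definition Fr :: "'a set \<Rightarrow> 'a \<Rightarrow> nat \<Rightarrow> bool" where
  "Fr F d p \<longleftrightarrow> (\<forall>a\<in>F. a \<in> R \<longrightarrow> (\<exists>b\<in>F. b \<in> R \<and> cgr d (b ^ p) a))"

lemma cgr_quotient:
  assumes "cgr d x y" "is_subfield F" "d \<in> F" "x \<in> F" "y \<in> F"
  shows "\<exists>c\<in>F. c \<in> R \<and> x - y = d * c"
proof (cases "d = 0")
  case True
  then show ?thesis using assms by (auto simp: cgr_def intro!: bexI[of _ 0] R_0 subfield_zero)
next
  case False
  obtain c where "c \<in> R" "x - y = d * c" using assms by (auto simp: cgr_def)
  moreover have "(x - y) / d \<in> F" using assms by (intro subfield_divide subfield_diff)
  ultimately show ?thesis using False by (intro bexI[of _ "(x - y) / d"]) auto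
qed

end

section \<open>Ascent and descent of Frobenius through the inertia and ramification fields\<close>

context fin_level
begin

text \<open>Trace duality, twisted by Frobenius.\<close>
lemma frobenius_up:
  assumes d: "fmod p d" and H: "subgrp H" and M: "M \<subseteq> N" "is_subfield M"
    and l: "set l \<subseteq> M \<times> M"
    and sel: "\<forall>\<sigma>\<in>H. (\<exists>x\<in>M. \<sigma> x \<noteq> x) \<longrightarrow> eval_pairs l \<sigma> = 0" "eval_pairs l id \<notin> \<mm>"
    and int: "\<And>x y \<sigma>. (x, y) \<in> set l \<Longrightarrow> \<sigma> \<in> H \<Longrightarrow> x * \<sigma> y \<in> R"
    and a: "a \<in> M" "\<And>\<sigma>. \<sigma> \<in> H \<Longrightarrow> \<sigma> a \<in> R"
    and root: "\<And>x y. (x, y) \<in> set l \<Longrightarrow>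
      \<exists>b\<in>M. b \<in> R \<and> cgr d (b ^ p) (x ^ p * (\<Sum>e\<in>emb H M. e (a * y ^ p)))"
  shows "\<exists>b\<in>M. b \<in> R \<and> cgr d (b ^ p) a"
proof -
  let ?E = "emb H M"
  let ?T = "\<lambda>y. \<Sum>e\<in>?E. e (a * y ^ p)"
  define \<epsilon> where "\<epsilon> = eval_pairs l id"
  have p: "p > 0" using d by (simp add: fmod_def prime_gt_0_nat)
  have HG: "H \<subseteq> Gal" using H by (simp add: subgrp_def)
  have lM: "set l \<subseteq> UNIV \<times> M" using l by auto
  have M2: "a * y ^ p \<in> M" if "y \<in> M" for y using that a M(2) by (intro subfield_mult subfield_power)
  have "eval_pairs l id \<in> R"
    using int[of _ _ id] H unfolding eval_pairs_def
    by (intro R_sum_list) (auto simp: subgrp_def)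
  then have eU: "\<epsilon> \<in> U" using sel by (simp add: \<epsilon>_def)
  have eM: "\<epsilon> \<in> M"
  proof -
    have "eval_pairs l' id \<in> M" if "set l' \<subseteq> M \<times> M" for l'
      using that M(2) by (induction l') (auto simp: eval_pairs_def intro: subfield_intros)
    then show ?thesis using l by (simp add: \<epsilon>_def)
  qed
  \<comment> \<open>The selector still isolates the identity after raising to the power
    \<open>p\<close>; expanding each power modulo \<open>d\<close> produces the traces of
    \<open>a * y ^ p\<close>.\<close>
  have "a * \<epsilon> ^ p = (\<Sum>e\<in>?E. e a * eval_pairs l e ^ p)"
    using selector_collapse[OF H M(1) lM sel(1) p, of "\<lambda>e. e a"] a by (simp add: \<epsilon>_def)
  also have "cgr d \<dots> (\<Sum>e\<in>?E. e a * (\<Sum>(x, y)\<leftarrow>l. x ^ p * e (y ^ p)))"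
  proof (intro cgr_sum cgr_mult)
    fix e assume "e \<in> ?E"
    then obtain \<sigma> where s: "\<sigma> \<in> H" "e = restrict \<sigma> M" by (auto simp: emb_def)
    have ey: "e y = \<sigma> y" "e (y ^ p) = \<sigma> y ^ p" if "y \<in> M" for y
      using that s HG subfield_power[OF M(2) that] by (auto simp: Gal_power)
    show "e a \<in> R" using a s by simp
    have "cgr d (sum_list (map (\<lambda>(x, y). x * \<sigma> y) l) ^ p) (\<Sum>i\<leftarrow>l. (case i of (x, y) \<Rightarrow> x * \<sigma> y) ^ p)"
      using int s(1) by (intro frobenius_sum_list[OF d]) auto
    moreover have "(\<Sum>i\<leftarrow>l. (case i of (x, y) \<Rightarrow> x * \<sigma> y) ^ p) = (\<Sum>(x, y)\<leftarrow>l. x ^ p * e (y ^ p))"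
      using lM ey by (intro arg_cong[of _ _ sum_list] map_cong) (auto simp: power_mult_distrib)
    moreover have "sum_list (map (\<lambda>(x, y). x * \<sigma> y) l) = eval_pairs l e"
      using eval_pairs_restrict[OF lM, of \<sigma>] s by (simp add: eval_pairs_def)
    ultimately show "cgr d (eval_pairs l e ^ p) (\<Sum>(x, y)\<leftarrow>l. x ^ p * e (y ^ p))" by simp
  qed
  also have "(\<Sum>e\<in>?E. e a * (\<Sum>(x, y)\<leftarrow>l. x ^ p * e (y ^ p))) = (\<Sum>(x, y)\<leftarrow>l. x ^ p * ?T y)"
  proof -
    have "e a * e (y ^ p) = e (a * y ^ p)" if "e \<in> ?E" "y \<in> M" for e y
      using that a HG M2 subfield_power[OF M(2)] by (auto simp: emb_def Gal_mult subset_iff)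
    then show ?thesis using lM
      by (induction l)
         (auto simp: sum.distrib sum_distrib_left distrib_left mult.left_commute intro!: sum.cong)
  qed
  finally have 1: "cgr d (a * \<epsilon> ^ p) (\<Sum>(x, y)\<leftarrow>l. x ^ p * ?T y)" .
  have "\<exists>b. \<forall>i\<in>set l. b i \<in> M \<and> b i \<in> R \<and> cgr d (b i ^ p) (fst i ^ p * ?T (snd i))"
    using root by (intro bchoice) force
  then obtain b where b: "\<And>i. i \<in> set l \<Longrightarrow> b i \<in> M \<and> b i \<in> R \<and> cgr d (b i ^ p) (fst i ^ p * ?T (snd i))"
    by blast
  \<comment> \<open>Frobenius is additive modulo \<open>d\<close>, so the sum of the approximate
    roots is an approximate root of the sum.\<close>
  define s where "s = sum_list (map b l)"
  have sR: "s \<in> R" unfolding s_def using b by (intro R_sum_list) auto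
  have sM: "s \<in> M"
    unfolding s_def using b M(2) by (induction l) (auto intro: subfield_intros)
  have "cgr d (s ^ p) (\<Sum>i\<leftarrow>l. b i ^ p)"
    unfolding s_def using b by (intro frobenius_sum_list[OF d]) auto
  also have "cgr d \<dots> (\<Sum>(x, y)\<leftarrow>l. x ^ p * ?T y)"
    using b by (intro cgr_sum_list) (auto simp: case_prod_unfold)
  also have "cgr d \<dots> (a * \<epsilon> ^ p)" by (rule cgr_sym[OF 1])
  finally have "cgr d ((s / \<epsilon>) ^ p) a"
    unfolding power_divide by (rule cgr_divide[OF _ U_power[OF eU]])
  moreover have "s / \<epsilon> \<in> R"
    unfolding divide_inverse using sR U_inverse[OF eU] by (intro R_mult) auto
  moreover have "s / \<epsilon> \<in> M" by (rule subfield_divide[OF M(2) sM eM])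
  ultimately show ?thesis by blast
qed

text \<open>An integral \<open>a\<close> may have non-integral conjugates. Multiplying by
  \<open>u ^ p\<close>, rather than by \<open>u\<close>, puts it into \<open>integ\<close> and is
  undone by dividing the root by \<open>u\<close>; the traces then lie in
  \<open>K \<inter> R\<close>, where \<open>FK\<close> provides roots.\<close>

lemma inertia_frobenius_up:
  assumes d: "fmod p d" and FK: "Fr K d p"
  shows "Fr (fixf inertia) d p"
  unfolding Fr_def
proof (intro ballI impI)
  let ?M = "fixf inertia"
  note sub = fixf_subfield[OF inertia_Gal]
  fix a assume a: "a \<in> ?M" "a \<in> R"
  have p: "p > 0" using d by (simp add: fmod_def prime_gt_0_nat)
  obtain l where l: "set l \<subseteq> (integ \<inter> ?M) \<times> (integ \<inter> ?M)"
    "\<forall>\<sigma>\<in>Gal. (\<exists>x\<in>?M. \<sigma> x \<noteq> x) \<longrightarrow> eval_pairs l \<sigma> = 0" "eval_pairs l id \<notin> \<mm>"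
    using inertia_selector by auto
  have "a \<in> N" using a fixf_N by blast
  from denominator[OF this] obtain u where
    u: "u \<in> integ" "a * u \<in> integ" "u \<in> ?M" "u \<notin> \<mm>" using a inertia_Gal by blast
  have uU: "u \<in> U" using u integ_R by blast
  obtain q where q: "p = Suc q" using p by (cases p) auto
  have au: "a * u ^ p \<in> integ" 
    using integ_mult[OF u(2) integ_power[OF u(1), of q]] by (simp add: q mult.assoc)
  have auM: "a * u ^ p \<in> ?M" using a(1) u(3) sub by (auto intro: subfield_mult subfield_power)
  have "\<exists>b\<in>?M. b \<in> R \<and> cgr d (b ^ p) (a * u ^ p)"
  proof (rule frobenius_up[OF d subgrp_Gal fixf_N sub _ l(2,3) _ auM])
    show "set l \<subseteq> ?M \<times> ?M" using l(1) by auto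
    show "\<sigma> (a * u ^ p) \<in> R" if "\<sigma> \<in> Gal" for \<sigma> using integ_R integ_Gal[OF that au] by blast
    fix x y assume "(x, y) \<in> set l"
    then have xy: "x \<in> integ" "x \<in> ?M" "y \<in> integ" "y \<in> ?M" using l(1) by auto
    show "x * \<sigma> y \<in> R" if "\<sigma> \<in> Gal" for \<sigma>
      using xy integ_R integ_Gal[OF that] by (intro R_mult) auto
    define t where "t = (\<Sum>e\<in>emb Gal ?M. e (a * u ^ p * y ^ p))"
    have yM: "a * u ^ p * y ^ p \<in> ?M" using auM xy sub by (auto intro: subfield_mult subfield_power)
    have "t \<in> K" using trace_fixf[OF subgrp_Gal fixf_N yM] by (simp add: t_def fixf_Gal)
    moreover have "t \<in> R"
      unfolding t_def
    proof (rule R_sum)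
      fix e assume "e \<in> emb Gal ?M"
      then obtain \<sigma> where "\<sigma> \<in> Gal" "e = restrict \<sigma> ?M" by (auto simp: emb_def)
      then show "e (a * u ^ p * y ^ p) \<in> R"
        using yM integ_R[OF integ_Gal[of \<sigma>]] integ_mult[OF au integ_power[OF xy(3)]] by simp
    qed
    ultimately obtain b where b: "b \<in> K" "b \<in> R" "cgr d (b ^ p) t" using FK by (auto simp: Fr_def)
    have "cgr d ((x * b) ^ p) (x ^ p * t)"
      using cgr_mult[OF b(3) R_power[OF integ_R[OF xy(1)]]] by (simp add: power_mult_distrib)
    moreover have "x * b \<in> ?M" using fixf_K[OF inertia_Gal] b xy sub by (auto intro: subfield_mult)
    moreover have "x * b \<in> R" using b integ_R[OF xy(1)] by (intro R_mult)
    ultimately show "\<exists>b\<in>?M. b \<in> R \<and> cgr d (b ^ p) (x ^ p * (\<Sum>e\<in>emb Gal ?M. e (a * u ^ p * y ^ p)))"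
      unfolding t_def by blast
  qed
  then obtain b where b: "b \<in> ?M" "b \<in> R" "cgr d (b ^ p) (a * u ^ p)" by blast
  have "cgr d ((b / u) ^ p) a" unfolding power_divide by (rule cgr_divide[OF b(3) U_power[OF uU]])
  moreover have "b / u \<in> R" unfolding divide_inverse using b U_inverse[OF uU] by (intro R_mult) auto
  moreover have "b / u \<in> ?M" using b u sub by (intro subfield_divide)
  ultimately show "\<exists>b\<in>?M. b \<in> R \<and> cgr d (b ^ p) a" by blast
qed

text \<open>Inertia preserves \<open>R\<close>, so \<open>a\<close> causes no difficulty, but the
  first entries of the selector may fail to be integral. Only the product of \<open>x ^ p\<close>
  with the trace \<open>c\<close> is known to be integral; its root is left as a hypothesis, to be
  discharged according to the type of the valuation.\<close>

lemma tame_frobenius_up: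
  assumes d: "fmod p d"
    and root: "\<And>c x. c \<in> fixf inertia \<Longrightarrow> x \<in> fixf ramif \<Longrightarrow> x ^ p * c \<in> R \<Longrightarrow>
      \<exists>b\<in>fixf ramif. b \<in> R \<and> cgr d (b ^ p) (x ^ p * c)"
  shows "Fr (fixf ramif) d p"
  unfolding Fr_def
proof (intro ballI impI)
  let ?M = "fixf ramif"
  note sub = fixf_subfield[OF ramif_Gal]
  fix a assume a: "a \<in> ?M" "a \<in> R"
  obtain l where l: "set l \<subseteq> {(x, y). x \<in> ?M \<and> y \<in> ?M \<and> y \<noteq> 0 \<and> x * y \<in> R}"
    "\<forall>\<sigma>\<in>inertia. (\<exists>x\<in>?M. \<sigma> x \<noteq> x) \<longrightarrow> eval_pairs l \<sigma> = 0" "eval_pairs l id \<notin> \<mm>"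
    using tame_selector by auto
  have aN: "a \<in> N" using a fixf_N by blast
  have aR: "\<sigma> a \<in> R" if "\<sigma> \<in> inertia" for \<sigma> using that inertia_decomp a aN by (auto simp: decomp_def)
  show "\<exists>b\<in>?M. b \<in> R \<and> cgr d (b ^ p) a"
  proof (rule frobenius_up[OF d inertia_subgrp fixf_N sub _ l(2,3) _ a(1)])
    show "\<sigma> a \<in> R" if "\<sigma> \<in> inertia" for \<sigma> by (rule aR[OF that])
    show "set l \<subseteq> ?M \<times> ?M" using l(1) by auto
    fix x y assume "(x, y) \<in> set l"
    then have xy: "x \<in> ?M" "y \<in> ?M" "y \<noteq> 0" "x * y \<in> R" using l(1) by auto
    have yN: "y \<in> N" using xy fixf_N by blast
    show int: "x * \<sigma> y \<in> R" if s: "\<sigma> \<in> inertia" for \<sigma>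
    proof -
      have "\<sigma> y / y \<in> R" using decomp_ratio[of \<sigma> y] s inertia_decomp yN xy by blast
      from R_mult[OF xy(4) this] show ?thesis using xy by simp
    qed
    define t where "t = (\<Sum>e\<in>emb inertia ?M. e (a * y ^ p))"
    have yM: "a * y ^ p \<in> ?M" using a xy sub by (auto intro: subfield_mult subfield_power)
    have "x ^ p * t = (\<Sum>e\<in>emb inertia ?M. x ^ p * e (a * y ^ p))" by (simp add: t_def sum_distrib_left)
    also have "\<dots> \<in> R"
    proof (rule R_sum)
      fix e assume "e \<in> emb inertia ?M"
      then obtain \<sigma> where s: "\<sigma> \<in> inertia" "e = restrict \<sigma> ?M" by (auto simp: emb_def)
      then have "\<sigma> \<in> Gal" using inertia_Gal by blast
      then have "x ^ p * e (a * y ^ p) = \<sigma> a * (x * \<sigma> y) ^ p"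
        using s(2) yM by (simp add: Gal_mult Gal_power power_mult_distrib)
      also have "\<dots> \<in> R" by (intro R_mult R_power aR int s)
      finally show "x ^ p * e (a * y ^ p) \<in> R" .
    qed
    finally have "x ^ p * t \<in> R" .
    moreover have "t \<in> fixf inertia" unfolding t_def by (rule trace_fixf[OF inertia_subgrp fixf_N yM])
    ultimately show "\<exists>b\<in>?M. b \<in> R \<and> cgr d (b ^ p) (x ^ p * (\<Sum>e\<in>emb inertia ?M. e (a * y ^ p)))"
      using root xy unfolding t_def by blast
  qed
qed

text \<open>Modulo \<open>d\<close>, the \<open>p\<close>-th power of the trace of
  \<open>\<eta> * b\<close> is the sum of the \<open>e (\<eta> * b) ^ p\<close>, then
  \<open>a\<close> times the sum of the \<open>e \<eta> ^ p\<close>, then \<open>a\<close> times the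
  \<open>p\<close>-th power of the trace of \<open>\<eta>\<close>. The weight \<open>\<eta>\<close>
  makes the conjugates of \<open>b\<close> and of the error \<open>c\<close> integral.\<close>

lemma frobenius_down:
  assumes d: "fmod p d" "d \<in> K" and H: "subgrp H" and M: "M \<subseteq> N" "is_subfield M"
    and a: "a \<in> R" "\<And>\<sigma>. \<sigma> \<in> H \<Longrightarrow> \<sigma> a = a" and b: "b \<in> M" "c \<in> M" "b ^ p = a + d * c"
    and \<eta>: "\<eta> \<in> M" "\<And>\<sigma>. \<sigma> \<in> H \<Longrightarrow> \<sigma> \<eta> \<in> R" "\<And>\<sigma>. \<sigma> \<in> H \<Longrightarrow> \<sigma> (\<eta> * b) \<in> R"
      "\<And>\<sigma>. \<sigma> \<in> H \<Longrightarrow> \<sigma> (\<eta> * c) \<in> R" "(\<Sum>e\<in>emb H M. e \<eta>) \<notin> \<mm>"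
  shows "\<exists>b\<in>fixf H. b \<in> R \<and> cgr d (b ^ p) a"
proof -
  let ?E = "emb H M"
  have HG: "H \<subseteq> Gal" using H by (simp add: subgrp_def)
  have E: "e \<in> ?E \<Longrightarrow> \<exists>\<sigma>\<in>H. e = restrict \<sigma> M" for e by (auto simp: emb_def)
  have bM: "\<eta> * b \<in> M" using \<eta> b M by (intro subfield_mult)
  define s where "s = (\<Sum>e\<in>?E. e (\<eta> * b))"
  define t where "t = (\<Sum>e\<in>?E. e \<eta>)"
  have eR: "e \<eta> \<in> R" "e (\<eta> * b) \<in> R" if "e \<in> ?E" for e
    using E[OF that] \<eta> bM by auto
  have sR: "s \<in> R" "t \<in> R" unfolding s_def t_def using eR by (auto intro: R_sum)
  have tU: "t \<in> U" using sR \<eta>(5) by (simp add: t_def)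
  obtain q where q: "p = Suc q" using d by (cases p) (auto simp: fmod_def)
  have "cgr d (s ^ p) (\<Sum>e\<in>?E. e (\<eta> * b) ^ p)"
    unfolding s_def using eR by (intro frobenius_sum[OF d(1)]) auto
  also have "cgr d \<dots> (\<Sum>e\<in>?E. a * e \<eta> ^ p)"
  proof (rule cgr_sum)
    fix e assume "e \<in> ?E"
    then obtain \<sigma> where s: "\<sigma> \<in> H" "e = restrict \<sigma> M" using E by blast
    have G: "\<sigma> \<in> Gal" using s HG by blast
    have "e (\<eta> * b) ^ p - a * e \<eta> ^ p = \<sigma> \<eta> ^ p * (\<sigma> (b ^ p) - a)"
      using s(2) \<eta>(1) bM G by (simp add: Gal_mult Gal_power power_mult_distrib right_diff_distrib)
    also have "\<sigma> (b ^ p) = a + d * \<sigma> c"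
      unfolding b(3) using a(2)[OF s(1)] G d(2) by (simp add: Gal_add Gal_mult Gal_fix)
    \<comment> \<open>One factor \<open>\<sigma> \<eta>\<close> is spent on
      \<open>\<sigma> c\<close>, which need not be integral by itself.\<close>
    also have "\<sigma> \<eta> ^ p * (a + d * \<sigma> c - a) = d * (\<sigma> \<eta> ^ q * \<sigma> (\<eta> * c))"
      using G by (simp add: q Gal_mult ac_simps)
    finally show "cgr d (e (\<eta> * b) ^ p) (a * e \<eta> ^ p)"
      unfolding cgr_def using \<eta> s by (intro bexI[of _ "\<sigma> \<eta> ^ q * \<sigma> (\<eta> * c)"] R_mult R_power) auto
  qed
  also have "(\<Sum>e\<in>?E. a * e \<eta> ^ p) = a * (\<Sum>e\<in>?E. e \<eta> ^ p)" by (simp add: sum_distrib_left)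
  also have "cgr d \<dots> (a * t ^ p)"
    unfolding t_def using eR by (intro cgr_mult a cgr_sym[OF frobenius_sum[OF d(1)]]) auto
  finally have "cgr d ((s / t) ^ p) a"
    unfolding power_divide by (rule cgr_divide[OF _ U_power[OF tU]])
  moreover have "s / t \<in> R" unfolding divide_inverse using sR U_inverse[OF tU] by (intro R_mult) auto
  moreover have "s / t \<in> fixf H"
    unfolding s_def t_def
    by (intro subfield_divide fixf_subfield HG trace_fixf H M bM \<eta>)
  ultimately show ?thesis by blast
qed

text \<open>From the ramification field to the inertia field the weight is \<open>1\<close>, whose
  trace is the tame index. From there to \<open>K\<close>, a common denominator \<open>t\<close> of
  the root and of the error is multiplied by an entry \<open>y\<close> of the selector; by
  \<open>selector_trace\<close> the traces of these products are not all in
  \<open>\<mm>\<close>.\<close>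

lemma tame_frobenius_down:
  assumes d: "fmod p d" "d \<in> K" and a: "a \<in> K" "a \<in> R" and b: "b \<in> fixf ramif" "b \<in> R" "cgr d (b ^ p) a"
  shows "\<exists>b\<in>K. b \<in> R \<and> cgr d (b ^ p) a"
proof -
  let ?M = "fixf inertia" and ?L = "fixf ramif"
  have subM: "is_subfield ?M" and subL: "is_subfield ?L"
    by (rule fixf_subfield[OF inertia_Gal], rule fixf_subfield[OF ramif_Gal])
  have "\<exists>c\<in>?L. c \<in> R \<and> b ^ p - a = d * c"
    using fixf_K[OF ramif_Gal] a b d subL by (intro cgr_quotient) (auto intro: subfield_power)
  then obtain c where c: "c \<in> ?L" "c \<in> R" "b ^ p = a + d * c" by (auto simp: algebra_simps)
  have dR: "\<sigma> x \<in> R" if "\<sigma> \<in> inertia" "x \<in> ?L" "x \<in> R" for \<sigma> x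
    using that inertia_decomp fixf_N by (auto simp: decomp_def)
  have "\<exists>b\<in>?M. b \<in> R \<and> cgr d (b ^ p) a"
  proof (rule frobenius_down[OF d inertia_subgrp fixf_N subL a(2) _ b(1) c(1,3), of 1])
    show 1: "1 \<in> ?L" using subL by (rule subfield_one)
    have "(\<Sum>e\<in>emb inertia ?L. e 1) = (\<Sum>e\<in>emb inertia ?L. 1)"
      using 1 inertia_Gal by (intro sum.cong) (auto simp: emb_def Gal_1)
    then show "(\<Sum>e\<in>emb inertia ?L. e 1) \<notin> \<mm>" using tame_index by simp
    show "\<sigma> a = a" if "\<sigma> \<in> inertia" for \<sigma> using that a inertia_Gal by (auto simp: Gal_fix)
    show "\<sigma> 1 \<in> R" "\<sigma> (1 * b) \<in> R" "\<sigma> (1 * c) \<in> R" if "\<sigma> \<in> inertia" for \<sigma>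
      using dR[OF that] 1 R_1 b c by auto
  qed
  then obtain b' where b': "b' \<in> ?M" "b' \<in> R" "cgr d (b' ^ p) a" by blast
  have "\<exists>c\<in>?M. c \<in> R \<and> b' ^ p - a = d * c"
    using fixf_K[OF inertia_Gal] a b' d subM by (intro cgr_quotient) (auto intro: subfield_power)
  then obtain c' where c': "c' \<in> ?M" "c' \<in> R" "b' ^ p = a + d * c'" by (auto simp: algebra_simps)
  obtain l where l: "set l \<subseteq> (integ \<inter> ?M) \<times> (integ \<inter> ?M)"
    "\<forall>\<sigma>\<in>Gal. (\<exists>x\<in>?M. \<sigma> x \<noteq> x) \<longrightarrow> eval_pairs l \<sigma> = 0" "eval_pairs l id \<notin> \<mm>"
    using inertia_selector by auto
  have lM: "set l \<subseteq> UNIV \<times> ?M" using l(1) by auto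
  have N: "b' \<in> N" "c' \<in> N" using b' c' fixf_N by auto
  from denominator[OF N(1)] obtain u where
    u: "u \<in> integ" "b' * u \<in> integ" "u \<in> ?M" "u \<notin> \<mm>" using b' inertia_Gal by blast
  from denominator[OF N(2)] obtain w where
    w: "w \<in> integ" "c' * w \<in> integ" "w \<in> ?M" "w \<notin> \<mm>" using c' inertia_Gal by blast
  define t where "t = u * w"
  have t: "t \<in> integ" "t * b' \<in> integ" "t * c' \<in> integ" "t \<in> ?M" "t \<notin> \<mm>"
    using integ_mult[OF u(1) w(1)] integ_mult[OF u(2) w(1)] integ_mult[OF u(1) w(2)]
      notin_m_mult[OF u(4) w(4)] subfield_mult[OF subM u(3) w(3)]
    by (simp_all add: t_def ac_simps)
  have "(\<Sum>(x, y)\<leftarrow>l. x * (\<Sum>e\<in>emb Gal ?M. e (t * y))) = t * eval_pairs l id"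
    using t subM by (intro selector_trace subgrp_Gal fixf_N lM l(2)) (auto intro: subfield_mult)
  then have "(\<Sum>(x, y)\<leftarrow>l. x * (\<Sum>e\<in>emb Gal ?M. e (t * y))) \<notin> \<mm>"
    using notin_m_mult[OF t(5) l(3)] by simp
  then have "\<exists>(x, y)\<in>set l. x * (\<Sum>e\<in>emb Gal ?M. e (t * y)) \<notin> \<mm>"
    using m_sum_list[of l "\<lambda>(x, y). x * (\<Sum>e\<in>emb Gal ?M. e (t * y))"] by auto
  then obtain x y where xy: "(x, y) \<in> set l" "x * (\<Sum>e\<in>emb Gal ?M. e (t * y)) \<notin> \<mm>" by blast
  then have y: "x \<in> integ" "y \<in> integ" "y \<in> ?M" using l(1) by auto
  have tr: "(\<Sum>e\<in>emb Gal ?M. e (t * y)) \<notin> \<mm>" using xy(2) m_mult2 integ_R[OF y(1)] by blast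
  have "\<exists>b\<in>fixf Gal. b \<in> R \<and> cgr d (b ^ p) a"
  proof (rule frobenius_down[OF d subgrp_Gal fixf_N subM a(2) _ b'(1) c'(1,3) _ _ _ _ tr])
    show "\<sigma> a = a" if "\<sigma> \<in> Gal" for \<sigma> using that a(1) by (rule Gal_fix)
    show "t * y \<in> ?M" using t y subM by (intro subfield_mult)
    have "t * y \<in> integ" "t * y * b' \<in> integ" "t * y * c' \<in> integ"
      using integ_mult[OF t(1) y(2)] integ_mult[OF t(2) y(2)] integ_mult[OF t(3) y(2)]
      by (simp_all add: ac_simps)
    then show "\<sigma> (t * y) \<in> R" "\<sigma> (t * y * b') \<in> R" "\<sigma> (t * y * c') \<in> R" if "\<sigma> \<in> Gal" for \<sigma>
      using that integ_Gal integ_R by blast+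
  qed
  then show ?thesis by (simp add: fixf_Gal)
qed

text \<open>An integral \<open>x\<close> is first multiplied by its denominator \<open>u\<close>;
  the product of the conjugates of \<open>x * u\<close> lies in \<open>K\<close> and is an integral
  multiple of \<open>x\<close>.\<close>

lemma cofinal_K:
  assumes "x \<in> N" "x \<noteq> 0"
  shows "\<exists>d\<in>K. d \<noteq> 0 \<and> d / x \<in> R"
proof (cases "x \<in> R")
  case False
  then have "1 / x \<in> R" using R_total[of x] by (auto simp: divide_inverse)
  then show ?thesis using subfield_one[OF subfield_K] by (intro bexI[of _ 1]) auto
next
  case True
  from denominator[OF assms(1)] obtain u where u: "u \<in> integ" "x * u \<in> integ" "u \<notin> \<mm>" using True by blast
  define Z where "Z = orb Gal (x * u)"
  have fin: "finite Z" "x * u \<in> Z" using orb_self[OF subgrp_Gal] finite_orb by (auto simp: Z_def)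
  have "\<Prod>Z \<in> K" using prod_orb[OF subgrp_Gal, of "x * u"] u integ_N by (auto simp: Z_def fixf_Gal)
  moreover have "\<Prod>Z = x * (u * \<Prod>(Z - {x * u}))" using fin by (simp add: prod.remove mult.assoc)
  moreover have "u * \<Prod>(Z - {x * u}) \<in> R"
    using u integ_R integ_Gal by (intro R_mult R_prod) (auto simp: Z_def orb_def)
  moreover have "x * u \<noteq> 0" using assms u m_0 by auto
  then have "\<Prod>Z \<noteq> 0" using fin by (auto simp: Z_def orb_def Gal_eq_0)
  ultimately show ?thesis using assms(2) by (intro bexI[of _ "\<Prod>Z"]) auto
qed

lemma ramification_value:
  assumes "x \<in> fixf ramif" "x \<noteq> 0"
  shows "\<exists>n. of_nat n \<notin> \<mm> \<and> (\<exists>a\<in>K. x ^ n / a \<in> U)"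
proof -
  let ?n = "card (emb inertia (fixf ramif))"
  obtain a where a: "a \<in> fixf inertia" "x ^ ?n / a \<in> U" using tame_value[OF assms] by blast
  then have "a \<noteq> 0" using m_0 by auto
  then obtain c where c: "c \<in> K" "a / c \<in> U" using inertia_value[OF a(1)] by blast
  have "x ^ ?n / a * (a / c) \<in> U" by (rule U_mult[OF a(2) c(2)])
  then have "x ^ ?n / c \<in> U" using \<open>a \<noteq> 0\<close> by simp
  then show ?thesis using tame_index c by blast
qed

end

section \<open>The ramification field as a union of finite levels\<close>

context valued_ext
begin

text \<open>By Galois theory, this is the normal closure of \<open>K(B)\<close>.\<close>
definition level :: "'a set \<Rightarrow> 'a set" where
  "level B = {y \<in> W. \<forall>\<sigma>\<in>Gal. (\<forall>b\<in>B. \<forall>\<tau>\<in>Gal. \<sigma> (\<tau> b) = \<tau> b) \<longrightarrow> \<sigma> y = y}"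

text \<open>This is \<open>fixf ramif\<close> at the level \<open>N\<close>, written without the
  locale so that monotonicity in \<open>N\<close> is visible.\<close>

definition tamef :: "'a set \<Rightarrow> 'a set" where
  "tamef N = {x \<in> N. \<forall>\<sigma>\<in>Gal. (\<forall>y\<in>N. y \<noteq> 0 \<longrightarrow> \<sigma> y / y - 1 \<in> \<mm>) \<longrightarrow> \<sigma> x = x}"

lemma level_base: "B \<subseteq> W \<Longrightarrow> B \<subseteq> level B"
  using Gal_id by (force simp: level_def)

lemma level_mono: "B \<subseteq> B' \<Longrightarrow> level B \<subseteq> level B'"
  by (auto simp: level_def)

lemma tamef_mono: "N \<subseteq> N' \<Longrightarrow> tamef N \<subseteq> tamef N'"
  by (auto simp: tamef_def)

lemma fin_level_level:
  assumes B: "finite B" "B \<subseteq> W"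
  shows "fin_level K R (level B)"
proof
  show "is_subfield (level B)"
    using subfield_W
    by (intro subfieldI) (auto simp: level_def Gal_simps intro: subfield_intros)
  show "K \<subseteq> level B" using K_sub_W by (auto simp: level_def Gal_fix)
  show "level B \<subseteq> W" by (auto simp: level_def)
  show "\<sigma> x \<in> level B" if s: "\<sigma> \<in> Gal" and x: "x \<in> level B" for \<sigma> x
  proof -
    have "\<tau> (\<sigma> x) = \<sigma> x" if t: "\<tau> \<in> Gal" "\<forall>b\<in>B. \<forall>\<rho>\<in>Gal. \<tau> (\<rho> b) = \<rho> b" for \<tau>
    proof -
      have "inv \<sigma> \<circ> (\<tau> \<circ> \<sigma>) \<in> Gal" using s t by (intro Gal_comp Gal_inv(1))
      moreover have "(inv \<sigma> \<circ> (\<tau> \<circ> \<sigma>)) (\<rho> b) = \<rho> b" if "b \<in> B" "\<rho> \<in> Gal" for b \<rho>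
        using t(2)[rule_format, OF that(1) Gal_comp[OF s that(2)]] Gal_inv[OF s] by simp
      ultimately have "(inv \<sigma> \<circ> (\<tau> \<circ> \<sigma>)) x = x" using x unfolding level_def by blast
      then have "\<sigma> (inv \<sigma> (\<tau> (\<sigma> x))) = \<sigma> x" by simp
      then show ?thesis using Gal_inv[OF s] by simp
    qed
    then show ?thesis using x s Gal_W by (auto simp: level_def)
  qed
  \<comment> \<open>An automorphism acts on \<open>level B\<close> according to its permutation of
    the finite set \<open>O'\<close> of conjugates of \<open>B\<close>, and there are finitely many
    maps from \<open>O'\<close> to itself.\<close>
  define O' where "O' = (\<Union>b\<in>B. {\<tau> b |\<tau>. \<tau> \<in> Gal})"
  have fin: "finite O'" unfolding O'_def using B(1) finite_orbit by blast
  have "(\<lambda>\<sigma>. restrict \<sigma> O') ` Gal \<subseteq> O' \<rightarrow>\<^sub>E O'"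
  proof
    fix f assume "f \<in> (\<lambda>\<sigma>. restrict \<sigma> O') ` Gal"
    then obtain \<sigma> where s: "\<sigma> \<in> Gal" "f = restrict \<sigma> O'" by blast
    have "\<sigma> y \<in> O'" if "y \<in> O'" for y
    proof -
      obtain b \<tau> where "b \<in> B" "\<tau> \<in> Gal" "y = \<tau> b" using \<open>y \<in> O'\<close> by (auto simp: O'_def)
      then have "\<sigma> y = (\<sigma> \<circ> \<tau>) b" "\<sigma> \<circ> \<tau> \<in> Gal" using s by (auto intro: Gal_comp)
      then show ?thesis using \<open>b \<in> B\<close> unfolding O'_def by blast
    qed
    then show "f \<in> O' \<rightarrow>\<^sub>E O'" using s by auto
  qed
  then have fin2: "finite ((\<lambda>\<sigma>. restrict \<sigma> O') ` Gal)" by (rule finite_subset) (intro finite_PiE fin)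
  have same: "restrict \<sigma> (level B) = restrict \<sigma>' (level B)"
    if s: "\<sigma> \<in> Gal" "\<sigma>' \<in> Gal" "restrict \<sigma> O' = restrict \<sigma>' O'" for \<sigma> \<sigma>'
  proof (rule restrict_ext)
    fix x assume x: "x \<in> level B"
    have "inv \<sigma> \<circ> \<sigma>' \<in> Gal" using s by (intro Gal_comp Gal_inv(1))
    moreover have "(inv \<sigma> \<circ> \<sigma>') (\<tau> b) = \<tau> b" if "b \<in> B" "\<tau> \<in> Gal" for b \<tau>
    proof -
      have "\<tau> b \<in> O'" using that by (auto simp: O'_def)
      then have "\<sigma>' (\<tau> b) = \<sigma> (\<tau> b)" using s(3) by (metis restrict_apply')
      then show ?thesis using Gal_inv[OF s(1)] by simp
    qed
    ultimately have "(inv \<sigma> \<circ> \<sigma>') x = x" using x unfolding level_def by blast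
    then have "\<sigma> (inv \<sigma> (\<sigma>' x)) = \<sigma> x" by simp
    then show "\<sigma> x = \<sigma>' x" using Gal_inv[OF s(1)] by simp
  qed
  define F where "F e = restrict (SOME \<sigma>. \<sigma> \<in> Gal \<and> restrict \<sigma> O' = e) (level B)" for e
  have "restrict \<sigma> (level B) = F (restrict \<sigma> O')" if "\<sigma> \<in> Gal" for \<sigma>
  proof -
    have "\<exists>\<tau>. \<tau> \<in> Gal \<and> restrict \<tau> O' = restrict \<sigma> O'" using that by blast
    from someI_ex[OF this] show ?thesis unfolding F_def using that by (intro same) auto
  qed
  then have "(\<lambda>\<sigma>. restrict \<sigma> (level B)) ` Gal = F ` (\<lambda>\<sigma>. restrict \<sigma> O') ` Gal"
    by (auto simp: image_image)
  then show "finite ((\<lambda>\<sigma>. restrict \<sigma> (level B)) ` Gal)" using fin2 by simp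
qed

lemma tamef_eq: "fin_level K R N \<Longrightarrow> tamef N = fin_level.fixf N (fin_level.ramif K R N)"
  by (auto simp: tamef_def fin_level.fixf_def fin_level.ramif_def)

lemma vle_iff: "x \<noteq> 0 \<Longrightarrow> vle R x y \<longleftrightarrow> y / x \<in> R"
  using R_0 by (auto simp: vle_def)

lemma vless_iff: "x \<noteq> 0 \<Longrightarrow> vless R x y \<longleftrightarrow> y / x \<in> \<mm>"
  using R_0 m_0 R_total[of "y / x"] by (auto simp: vless_def vle_def m_iff)

text \<open>A function that fixes the finite-level ramification fields is given by
  a ramification automorphism on every element, by means of the orbit polynomial.\<close>
lemma ram_field_eq: "ram_field K R = (\<Union>B\<in>{B. finite B \<and> B \<subseteq> W}. tamef (level B))"
proof (intro equalityI subsetI)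
  fix x assume "x \<in> (\<Union>B\<in>{B. finite B \<and> B \<subseteq> W}. tamef (level B))"
  then obtain B where B: "finite B" "B \<subseteq> W" "x \<in> tamef (level B)" by blast
  have lW: "level B \<subseteq> W" by (auto simp: level_def)
  then have xW: "x \<in> W" using B by (auto simp: tamef_def)
  have "\<sigma> x = x" if "\<sigma> \<in> ram_group K R" for \<sigma>
  proof -
    have s: "\<sigma> \<in> rel_auts W K" "\<And>y. y \<in> W \<Longrightarrow> y \<noteq> 0 \<Longrightarrow> vless R y (\<sigma> y - y)"
      using that by (auto simp: ram_group_def)
    obtain \<tau> where t: "\<tau> \<in> Gal" "\<And>x. x \<in> W \<Longrightarrow> \<tau> x = \<sigma> x" using rel_auts_W_extend[OF s(1)] by blast
    have "\<tau> y / y - 1 \<in> \<mm>" if "y \<in> level B" "y \<noteq> 0" for y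
    proof -
      have "y \<in> W" using that lW by blast
      then have "(\<tau> y - y) / y \<in> \<mm>" using s(2)[of y] vless_iff[OF that(2)] t that by simp
      then show ?thesis using that by (simp add: diff_divide_distrib)
    qed
    then have "\<tau> x = x" using B(3) t(1) by (auto simp: tamef_def)
    then show ?thesis using t xW by simp
  qed
  then show "x \<in> ram_field K R" using xW by (simp add: ram_field_def)
next
  let ?L = "\<Union>B\<in>{B. finite B \<and> B \<subseteq> W}. tamef (level B)"
  fix x assume x: "x \<in> ram_field K R"
  have sub: "is_subfield (tamef (level B))" "K \<subseteq> tamef (level B)" if "finite B" "B \<subseteq> W" for B
  proof -
    interpret fin_level K R "level B" using that by (rule fin_level_level)
    show "is_subfield (tamef (level B))" "K \<subseteq> tamef (level B)"
      using tamef_eq[OF fin_level_axioms] fixf_subfield[OF ramif_Gal] fixf_K[OF ramif_Gal] by auto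
  qed
  have L: "is_subfield ?L"
  proof (rule subfieldI)
    have two: "\<exists>B. finite B \<and> B \<subseteq> W \<and> u \<in> tamef (level B) \<and> v \<in> tamef (level B)"
      if uv: "u \<in> ?L" "v \<in> ?L" for u v
    proof -
      obtain B B' where B: "finite B" "B \<subseteq> W" "u \<in> tamef (level B)" 
        "finite B'" "B' \<subseteq> W" "v \<in> tamef (level B')" using uv by blast
      then show ?thesis
        using tamef_mono[OF level_mono, of B "B \<union> B'"] tamef_mono[OF level_mono, of B' "B \<union> B'"]
        by (intro exI[of _ "B \<union> B'"]) auto
    qed
    have "1 \<in> tamef (level {})" using sub(1)[of "{}"] by (simp add: subfield_one)
    then show "1 \<in> ?L" by blast
    fix u v assume uv: "u \<in> ?L" "v \<in> ?L"
    then obtain B where B: "finite B" "B \<subseteq> W" "u \<in> tamef (level B)" "v \<in> tamef (level B)"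
      using two[OF uv] by blast
    have "u - v \<in> tamef (level B)" "u * v \<in> tamef (level B)"
      using B(3,4) sub(1)[OF B(1,2)] by (simp_all add: subfield_diff subfield_mult)
    then show "u - v \<in> ?L" "u * v \<in> ?L" using B(1,2) by blast+
  next
    fix u assume "u \<in> ?L"
    then obtain B where B: "finite B" "B \<subseteq> W" "u \<in> tamef (level B)" by blast
    then have "inverse u \<in> tamef (level B)"
      using sub(1)[OF B(1,2)] by (simp add: subfield_inverse)
    then show "inverse u \<in> ?L" using B(1,2) by blast
  qed
  have KL: "K \<subseteq> ?L" using sub(2)[of "{}"] by auto
  have xW: "x \<in> W" using x by (simp add: ram_field_def)
  show "x \<in> ?L"
  \<comment> \<open>It suffices that each automorphism over \<open>?L\<close> belongs to
    \<open>ram_group\<close>, whose elements fix \<open>x\<close>.\<close>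
  proof (rule separable_fixed[OF L KL])
    show "separable_over ?L x"
      using xW KL by (auto simp: sep_closure_def separable_over_def intro: poly_over_mono)
    fix \<sigma> assume s: "\<sigma> \<in> rel_auts UNIV ?L"
    then have G: "\<sigma> \<in> Gal" using rel_auts_mono[OF KL] by blast
    have "\<sigma> ` W = W"
    proof (intro equalityI subsetI)
      fix y assume "y \<in> W"
      then have "inv \<sigma> y \<in> W" "y = \<sigma> (inv \<sigma> y)" using Gal_inv[OF G] Gal_W by auto
      then show "y \<in> \<sigma> ` W" by blast
    qed (use Gal_W[OF G] in blast)
    then have "\<sigma> \<in> rel_auts W K"
      using G by (auto simp: rel_auts_def bij_betw_def intro: inj_on_subset)
    moreover have "vless R y (\<sigma> y - y)" if y: "y \<in> W" "y \<noteq> 0" for y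
    proof -
      have B: "finite {y}" "{y} \<subseteq> W" using y by auto
      interpret fin_level K R "level {y}" by (rule fin_level_level[OF B])
      have yN: "y \<in> level {y}" using level_base[OF B(2)] by blast
      define P where "P = roots_poly (orb ramif y)"
      have fin: "finite (orb ramif y)" by (rule finite_orb[OF ramif_Gal])
      have cL: "coeff P i \<in> ?L" for i
        using coeff_orb[OF ramif_subgrp yN, of i] tamef_eq[OF fin_level_axioms] B unfolding P_def by blast
      then have c: "\<sigma> (coeff P i) = coeff P i" for i
        using s cL[of i] unfolding rel_auts_def by blast
      have "poly P y = 0"
        unfolding P_def poly_roots_poly using fin orb_self[OF ramif_subgrp, of y] by auto
      then have "\<sigma> (\<Sum>i\<le>degree P. coeff P i * y ^ i) = 0" using G by (simp add: poly_altdef Gal_0)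
      then have "poly P (\<sigma> y) = 0" using G c by (simp add: poly_altdef Gal_simps)
      then obtain \<tau> where t: "\<tau> \<in> ramif" "\<sigma> y = \<tau> y"
        using fin by (auto simp: P_def poly_roots_poly orb_def)
      then have "\<sigma> y / y - 1 \<in> \<mm>" using yN y(2) by (auto simp: ramif_def)
      then show ?thesis using y by (simp add: vless_iff diff_divide_distrib)
    qed
    ultimately have "\<sigma> \<in> ram_group K R" by (simp add: ram_group_def)
    then show "\<sigma> x = x" using x by (simp add: ram_field_def)
  qed
qed

lemma ram_field_tower: "is_subfield (ram_field K R)" "K \<subseteq> ram_field K R" "ram_field K R \<subseteq> W"
proof -
  show LW: "ram_field K R \<subseteq> W" by (auto simp: ram_field_def)
  show KL: "K \<subseteq> ram_field K R"
    using K_sub_W by (auto simp: ram_field_def ram_group_def rel_auts_def)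
  show "is_subfield (ram_field K R)"
  proof (rule subring_is_subfield[OF KL])
    fix x y assume xy: "x \<in> ram_field K R" "y \<in> ram_field K R"
    have "\<sigma> (x - y) = x - y \<and> \<sigma> (x * y) = x * y" if s: "\<sigma> \<in> ram_group K R" for \<sigma>
    proof -
      have xyW: "x \<in> W" "y \<in> W" using xy LW by auto
      obtain \<tau> where t: "\<tau> \<in> Gal" "\<And>x. x \<in> W \<Longrightarrow> \<tau> x = \<sigma> x"
        using rel_auts_W_extend[of \<sigma>] s by (auto simp: ram_group_def)
      have "\<tau> x = x" "\<tau> y = y" using t(2) xyW xy s by (auto simp: ram_field_def)
      moreover have "\<sigma> (x - y) = \<tau> (x - y)" "\<sigma> (x * y) = \<tau> (x * y)"
        using t(2)[OF subfield_diff[OF subfield_W xyW]] t(2)[OF subfield_mult[OF subfield_W xyW]]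
        by simp_all
      ultimately show ?thesis using t(1) by (simp add: Gal_diff Gal_mult)
    qed
    then show "x - y \<in> ram_field K R" "x * y \<in> ram_field K R"
      using xy subfield_W by (auto simp: ram_field_def intro: subfield_diff subfield_mult)
  qed
qed

lemma ram_field_level:
  assumes "x \<in> ram_field K R"
  shows "\<exists>N. fin_level K R N \<and> x \<in> fin_level.fixf N (fin_level.ramif K R N) \<and>
    fin_level.fixf N (fin_level.ramif K R N) \<subseteq> ram_field K R"
proof -
  obtain B where B: "finite B" "B \<subseteq> W" "x \<in> tamef (level B)" using assms ram_field_eq by auto
  have "tamef (level B) \<subseteq> ram_field K R" using B ram_field_eq by blast
  then show ?thesis using fin_level_level[OF B(1,2)] B(3) tamef_eq by metis
qed

lemma cofinal:
  assumes "x \<in> W" "x \<noteq> 0"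
  shows "\<exists>d\<in>K. d \<noteq> 0 \<and> d / x \<in> R"
proof -
  interpret fin_level K R "level {x}" by (rule fin_level_level) (use assms in auto)
  show ?thesis using level_base[of "{x}"] assms by (intro cofinal_K) auto
qed

text \<open>Cofinality applied to \<open>inverse x\<close> bounds the value of \<open>x\<close> from
  below by a value of \<open>K\<close>.\<close>

lemma trivial_W: "K \<subseteq> R \<Longrightarrow> W \<subseteq> R"
proof
  fix x assume K: "K \<subseteq> R" and x: "x \<in> W"
  show "x \<in> R"
  proof (cases "x = 0")
    case False
    have "inverse x \<in> W" using x subfield_W by (rule subfield_inverse[rotated])
    then obtain d where d: "d \<in> K" "d \<noteq> 0" "d / inverse x \<in> R" using cofinal False by fastforce
    have "inverse d \<in> R" using K d subfield_inverse[OF subfield_K] by blast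
    from R_mult[OF this d(3)] show ?thesis using d by (simp add: field_simps)
  qed (simp add: R_0)
qed

section \<open>Transfer of Frobenius between \<open>K\<close> and its ramification field\<close>

lemma Fr_down:
  assumes d: "fmod p d" "d \<in> K" and L: "Fr (ram_field K R) d p"
  shows "Fr K d p"
  unfolding Fr_def
proof (intro ballI impI)
  fix a assume a: "a \<in> K" "a \<in> R"
  then obtain b where b: "b \<in> ram_field K R" "b \<in> R" "cgr d (b ^ p) a"
    using L ram_field_tower by (auto simp: Fr_def)
  obtain N where "fin_level K R N" and bN: "b \<in> fin_level.fixf N (fin_level.ramif K R N)"
    using ram_field_level[OF b(1)] by blast
  then interpret fin_level K R N by simp
  show "\<exists>b\<in>K. b \<in> R \<and> cgr d (b ^ p) a" by (rule tame_frobenius_down[OF d a bN b(2,3)])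
qed

lemma Fr_nonintegral:
  assumes "d \<notin> R" "p > 0" "is_subfield F"
  shows "Fr F d p"
  unfolding Fr_def
proof (intro ballI impI)
  fix a assume a: "a \<in> R"
  have d: "d \<noteq> 0" "inverse d \<in> R" using assms notin_R m_R by blast+
  have "0 ^ p - a = d * (- a * inverse d)" using assms d by (simp add: power_0_left)
  moreover have "- a * inverse d \<in> R" using a d by (intro R_mult R_uminus)
  ultimately have "cgr d (0 ^ p) a" unfolding cgr_def by blast
  then show "\<exists>b\<in>F. b \<in> R \<and> cgr d (b ^ p) a"
    using subfield_zero[OF assms(3)] R_0 by blast
qed

lemma Fr_up:
  assumes d: "fmod p d"
    and root: "\<And>N c x. fin_level K R N \<Longrightarrow> c \<in> fin_level.fixf N (fin_level.inertia K R N) \<Longrightarrow>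
      x \<in> fin_level.fixf N (fin_level.ramif K R N) \<Longrightarrow> c \<noteq> 0 \<Longrightarrow> x \<noteq> 0 \<Longrightarrow> x ^ p * c \<in> R \<Longrightarrow>
      \<exists>b\<in>fin_level.fixf N (fin_level.ramif K R N). b \<in> R \<and> cgr d (b ^ p) (x ^ p * c)"
  shows "Fr (ram_field K R) d p"
  unfolding Fr_def
proof (intro ballI impI)
  fix a assume a: "a \<in> ram_field K R" "a \<in> R"
  obtain N where N: "fin_level K R N" and aN: "a \<in> fin_level.fixf N (fin_level.ramif K R N)"
    and NL: "fin_level.fixf N (fin_level.ramif K R N) \<subseteq> ram_field K R"
    using ram_field_level[OF a(1)] by blast
  interpret fin_level K R N by (rule N)
  have p: "p > 0" using d by (simp add: fmod_def prime_gt_0_nat)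
  have "Fr (fixf ramif) d p"
  proof (rule tame_frobenius_up[OF d])
    fix c x assume *: "c \<in> fixf inertia" "x \<in> fixf ramif" "x ^ p * c \<in> R"
    show "\<exists>b\<in>fixf ramif. b \<in> R \<and> cgr d (b ^ p) (x ^ p * c)"
    proof (cases "c = 0 \<or> x = 0")
      case True
      then have "cgr d (0 ^ p) (x ^ p * c)" using p by (auto simp: power_0_left cgr_refl)
      then show ?thesis using subfield_zero[OF fixf_subfield[OF ramif_Gal]] R_0 by blast
    qed (use root[OF N *(1,2)] * in blast)
  qed
  then show "\<exists>b\<in>ram_field K R. b \<in> R \<and> cgr d (b ^ p) a"
    using aN NL a(2) unfolding Fr_def by blast
qed

text \<open>A \<open>p\<close>-th root up to a relative error \<open>d * r\<close> remains good
  after multiplication by \<open>x ^ p\<close>, even when \<open>c\<close> is not integral.\<close>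

lemma root_of_multiple:
  assumes b: "b ^ p = x ^ p * c * (1 + d * r)" and "d \<in> R" "r \<in> R" "x ^ p * c \<in> R" "p > 0"
  shows "b \<in> R \<and> cgr d (b ^ p) (x ^ p * c)"
proof -
  have "b ^ p \<in> R"
    unfolding b by (rule R_mult[OF assms(4) R_add[OF R_1 R_mult[OF assms(2,3)]]])
  then have "b \<in> R" using R_power_iff assms by blast
  moreover have "b ^ p - x ^ p * c = d * (x ^ p * c * r)" by (simp add: b algebra_simps)
  then have "cgr d (b ^ p) (x ^ p * c)" unfolding cgr_def using R_mult[OF assms(4,3)] by blast
  ultimately show ?thesis by blast
qed

text \<open>The value of \<open>c\<close> is that of some \<open>k\<close> in \<open>K\<close>, so
  Frobenius modulo \<open>d * k\<close> gives a root of an integral \<open>c\<close> with relative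
  error a multiple of \<open>d\<close>. This change of modulus is why the hypothesis speaks of all
  nonzero moduli.\<close>

lemma Fr_up_equal:
  assumes p: "prime p" "of_nat p = (0::'a)" and K: "\<And>d. d \<in> K \<Longrightarrow> d \<noteq> 0 \<Longrightarrow> Fr K d p"
    and d: "d \<in> K" "d \<noteq> 0"
  shows "Fr (ram_field K R) d p"
proof (cases "d \<in> R")
  case False
  then show ?thesis using p ram_field_tower by (intro Fr_nonintegral) (auto simp: prime_gt_0_nat)
next
  case True
  have fm: "fmod p d'" for d' using p R_0 by (auto simp: fmod_def)
  have p0: "p > 0" using p by (simp add: prime_gt_0_nat)
  show ?thesis
  proof (rule Fr_up[OF fm])
    fix N c x assume "fin_level K R N" and c: "c \<in> fin_level.fixf N (fin_level.inertia K R N)"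
      and x: "x \<in> fin_level.fixf N (fin_level.ramif K R N)" and nz: "c \<noteq> 0" "x \<noteq> 0" "x ^ p * c \<in> R"
    then interpret fin_level K R N by simp
    have sub: "is_subfield (fixf inertia)" "is_subfield (fixf ramif)"
      using fixf_subfield[OF inertia_Gal] fixf_subfield[OF ramif_Gal] by auto
    have int: "\<exists>g\<in>fixf inertia. \<exists>r\<in>R. g ^ p = c * (1 + d * r)"
      if c: "c \<in> fixf inertia" "c \<noteq> 0" "c \<in> R" for c
    proof -
      obtain k where k: "k \<in> K" "c / k \<in> U" using inertia_value[OF c(1,2)] by blast
      then have k0: "k \<noteq> 0" using m_0 by auto
      have "Fr (fixf inertia) (d * k) p"
        using d k k0 subfield_K by (intro inertia_frobenius_up[OF fm] K) (auto intro: subfield_mult)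
      then obtain g where g: "g \<in> fixf inertia" "cgr (d * k) (g ^ p) c" using c by (auto simp: Fr_def)
      then obtain r where r: "r \<in> R" "g ^ p - c = d * k * r" by (auto simp: cgr_def)
      have "k / c \<in> R" using U_inverse[OF k(2)] by simp
      then have "(k / c) * r \<in> R" using r by (intro R_mult)
      moreover have "g ^ p = c * (1 + d * ((k / c) * r))" using r(2) c by (simp add: field_simps)
      ultimately show ?thesis using g by blast
    qed
    have "\<exists>g\<in>fixf inertia. \<exists>r\<in>R. g ^ p = c * (1 + d * r)"
    proof (cases "c \<in> R")
      case True
      then show ?thesis using int c nz by blast
    next
      case False
      then have ic: "inverse c \<in> R" using notin_R m_R by blast
      obtain q where q: "p = Suc q" using p0 by (cases p) auto
      \<comment> \<open>The integral element \<open>inverse c ^ q\<close> differs from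
        \<open>c\<close> by a \<open>p\<close>-th power.\<close>
      have e: "c * inverse c ^ p = inverse c ^ q" using nz by (simp add: q)
      have "inverse c ^ q \<in> fixf inertia" using c sub by (intro subfield_power subfield_inverse)
      moreover have "inverse c ^ q \<in> R" "inverse c ^ q \<noteq> 0" using ic nz by (auto intro: R_power)
      ultimately obtain g r where g: "g \<in> fixf inertia" "r \<in> R" "g ^ p = inverse c ^ q * (1 + d * r)"
        using int by blast
      have "(g * c) ^ p = (c * inverse c ^ p) * c ^ p * (1 + d * r)"
        unfolding e power_mult_distrib g(3) by simp
      also have "\<dots> = c * (1 + d * r)" using nz by (simp add: power_inverse)
      finally have "(g * c) ^ p = c * (1 + d * r)" .
      moreover have "g * c \<in> fixf inertia" using g c sub by (intro subfield_mult)
      ultimately show ?thesis using g(2) by blast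
    qed
    then obtain g r where g: "g \<in> fixf inertia" "r \<in> R" "g ^ p = c * (1 + d * r)" by blast
    have "(g * x) ^ p = x ^ p * c * (1 + d * r)" by (simp add: power_mult_distrib g(3))
    from root_of_multiple[OF this True g(2) nz(3) p0]
    have "g * x \<in> R \<and> cgr d ((g * x) ^ p) (x ^ p * c)" .
    moreover have "g * x \<in> fixf ramif"
      using g x sub fixf_anti[OF ramif_inertia] by (auto intro: subfield_mult)
    ultimately show "\<exists>b\<in>fixf ramif. b \<in> R \<and> cgr d (b ^ p) (x ^ p * c)" by blast
  qed
qed

text \<open>The valuation is trivial on the separable closure, so \<open>c\<close> is integral and
  has an exact \<open>p\<close>-th root.\<close>

lemma Fr_up_trivial:
  assumes p: "prime p" "of_nat p = (0::'a)" and K: "K \<subseteq> R" "Fr K 0 p"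
  shows "Fr (ram_field K R) 0 p"
proof (rule Fr_up)
  show fm: "fmod p 0" using p R_0 by (auto simp: fmod_def)
  have p0: "p > 0" using p by (simp add: prime_gt_0_nat)
  fix N c x assume "fin_level K R N" and c: "c \<in> fin_level.fixf N (fin_level.inertia K R N)"
    and x: "x \<in> fin_level.fixf N (fin_level.ramif K R N)" and nz: "c \<noteq> 0" "x \<noteq> 0" "x ^ p * c \<in> R"
  then interpret fin_level K R N by simp
  have "c \<in> R" using c fixf_N N_sub_W trivial_W[OF K(1)] by blast
  then obtain g where g: "g \<in> fixf inertia" "g ^ p = c"
    using inertia_frobenius_up[OF fm K(2)] c by (auto simp: Fr_def cgr_def)
  have "(g * x) ^ p = x ^ p * c * (1 + 0 * 0)" by (simp add: power_mult_distrib g(2))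
  from root_of_multiple[OF this R_0 R_0 nz(3) p0]
  have "g * x \<in> R \<and> cgr 0 ((g * x) ^ p) (x ^ p * c)" .
  moreover have "g * x \<in> fixf ramif"
    using g x fixf_subfield[OF ramif_Gal] fixf_anti[OF ramif_inertia] by (auto intro: subfield_mult)
  ultimately show "\<exists>b\<in>fixf ramif. b \<in> R \<and> cgr 0 (b ^ p) (x ^ p * c)" by blast
qed

end

section \<open>Elements of equal value\<close>

context val_ring
begin

text \<open>Equality of values; as \<open>0\<close> is not a unit, it holds between nonzero elements
  only.\<close>

definition eqv :: "'a \<Rightarrow> 'a \<Rightarrow> bool" where
  "eqv x y \<longleftrightarrow> x / y \<in> U"

lemma eqv_nz: "eqv x y \<Longrightarrow> x \<noteq> 0 \<and> y \<noteq> 0"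
  using m_0 by (auto simp: eqv_def)

lemma eqv_refl: "x \<noteq> 0 \<Longrightarrow> eqv x x"
  using R_1 one_notin_m by (simp add: eqv_def)

lemma eqv_sym: "eqv x y \<Longrightarrow> eqv y x"
  using U_inverse[of "x / y"] by (simp only: eqv_def inverse_divide)

lemma eqv_trans [trans]: "eqv x y \<Longrightarrow> eqv y z \<Longrightarrow> eqv x z"
  using U_mult[of "x / y" "y / z"] eqv_nz[of x y] by (simp add: eqv_def)

lemma eqv_mult: "eqv x y \<Longrightarrow> eqv x' y' \<Longrightarrow> eqv (x * x') (y * y')"
  using U_mult[of "x / y" "x' / y'"] by (simp add: eqv_def)

lemma eqv_inverse: "eqv x y \<Longrightarrow> eqv (inverse x) (inverse y)"
  using U_inverse[of "x / y"] by (simp add: eqv_def divide_inverse mult.commute)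

lemma eqv_divide: "eqv x y \<Longrightarrow> eqv x' y' \<Longrightarrow> eqv (x / x') (y / y')"
  unfolding divide_inverse by (intro eqv_mult eqv_inverse)

lemma eqv_power: "eqv x y \<Longrightarrow> eqv (x ^ n) (y ^ n)"
  using U_power[of "x / y" n] by (simp add: eqv_def power_divide)

lemma eqv_R: "eqv x y \<Longrightarrow> x \<in> R \<longleftrightarrow> y \<in> R"
  using R_mult[of "x / y" y] R_mult[of "y / x" x] eqv_sym[of x y] eqv_nz[of x y]
  by (auto simp: eqv_def)

lemma eqv_m: "eqv x y \<Longrightarrow> x \<in> \<mm> \<longleftrightarrow> y \<in> \<mm>"
  using eqv_R[OF eqv_inverse, of x y] eqv_nz[of x y] by (simp add: m_iff)

text \<open>Bezout in the natural numbers: an integer outside \<open>\<mm>\<close> is prime to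
  \<open>p\<close>.\<close>

lemma prime_to_p:
  assumes "prime p" "of_nat p \<in> \<mm>" "of_nat n \<notin> \<mm>"
  shows "\<exists>s t. n * s = Suc (p * t)"
proof -
  have "\<not> p dvd n"
  proof
    assume "p dvd n"
    then obtain k where "n = p * k" by blast
    then have "of_nat n = of_nat p * (of_nat k :: 'a)" by simp
    then show False using m_mult[OF assms(2) R_of_nat[of k]] assms(3) by simp
  qed
  then have "coprime n p" using assms(1) prime_imp_coprime[of p n] by (simp add: coprime_commute)
  moreover have "n \<noteq> 0" using \<open>\<not> p dvd n\<close> by (metis dvd_0_right)
  ultimately obtain s t where "n * s = p * t + 1"
    using bezout_nat[of n p] by (auto simp: coprime_iff_gcd_eq_1)
  then show ?thesis by auto
qed

lemma eqv_root:
  assumes "n * s = Suc (p * t)" "eqv (c ^ n) (g ^ p)"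
  shows "eqv c ((g ^ s / c ^ t) ^ p)"
proof -
  have "n > 0" using assms(1) by (cases n) auto
  then have c: "c \<noteq> 0" using eqv_nz[OF assms(2)] by auto
  have "eqv ((c ^ n) ^ s) ((g ^ p) ^ s)" by (rule eqv_power[OF assms(2)])
  moreover have "(c ^ n) ^ s = c * (c ^ t) ^ p"
    using assms(1) by (simp add: power_mult[symmetric] mult.commute[of t])
  moreover have "(g ^ p) ^ s = (g ^ s) ^ p" by (simp add: power_mult[symmetric] mult.commute)
  ultimately have "eqv (c * (c ^ t) ^ p / (c ^ t) ^ p) ((g ^ s) ^ p / (c ^ t) ^ p)"
    using c by (metis eqv_divide eqv_refl power_not_zero)
  then show ?thesis using c by (simp add: power_divide)
qed

end

section \<open>Values divisible by p\<close>

context val_ring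
begin

lemma cgr_eqv:
  assumes "cgr d (b ^ p) x" "d / x \<in> \<mm>" "x \<noteq> 0"
  shows "eqv (b ^ p) x"
proof -
  obtain c where c: "c \<in> R" "b ^ p - x = d * c" using assms by (auto simp: cgr_def)
  have "b ^ p / x = 1 + d / x * c" using c(2) assms(3) by (simp add: field_simps)
  moreover have "d / x * c \<in> \<mm>" by (rule m_mult[OF assms(2) c(1)])
  then have "1 + d / x * c \<in> U" using notin_m_add[OF one_notin_m] m_R R_add[OF R_1] by blast
  ultimately show ?thesis by (simp only: eqv_def)
qed

text \<open>Below the value of \<open>p\<close>, a root modulo \<open>p\<close> has exactly the
  right value; larger values are lowered by dividing by \<open>\<pi> ^ p\<close>, with
  \<open>n\<close> bounding the number of steps. Only values in the convex hull of that of
  \<open>p\<close> are reached.\<close>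

lemma hull_divisible:
  assumes F: "is_subfield F" "of_nat p \<in> F" "Fr F (of_nat p) p"
    and \<pi>: "\<pi> \<in> F" "eqv (\<pi> ^ p) (of_nat p)"
  shows "h \<in> F \<Longrightarrow> h \<in> R \<Longrightarrow> h \<noteq> 0 \<Longrightarrow> of_nat p ^ n / h \<in> R \<Longrightarrow> \<exists>g\<in>F. eqv h (g ^ p)"
proof (induction n arbitrary: h)
  case 0
  then have "eqv h 1" by (auto simp: eqv_def notin_m divide_inverse)
  then show ?case using subfield_one[OF F(1)] by (intro bexI[of _ 1]) auto
next
  case (Suc n)
  let ?p = "of_nat p :: 'a"
  have nz: "?p \<noteq> 0" "\<pi> \<noteq> 0 \<or> p = 0" using eqv_nz[OF \<pi>(2)] by (auto simp: power_0_left)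
  then have \<pi>0: "\<pi> \<noteq> 0" by auto
  show ?case
  proof (cases "h / ?p \<in> R")
    case True
    define h' where "h' = h / \<pi> ^ p"
    have e: "eqv h' (h / ?p)"
      unfolding h'_def by (intro eqv_divide eqv_refl Suc.prems \<pi>)
    then have "h' \<in> R" "h' \<noteq> 0" using True eqv_R eqv_nz by blast+
    moreover have "h' \<in> F" unfolding h'_def using Suc.prems(1) \<pi>(1) F(1) by (intro subfield_divide subfield_power)
    moreover have "?p ^ n / h' \<in> R"
    proof -
      have "eqv (?p ^ n / h') (?p ^ n / (h / ?p))" using nz by (intro eqv_divide eqv_refl e) simp
      moreover have "?p ^ n / (h / ?p) = ?p ^ Suc n / h" by simp
      ultimately show ?thesis using Suc.prems(4) eqv_R by metis
    qed
    ultimately obtain g where g: "g \<in> F" "eqv h' (g ^ p)" using Suc.IH by blast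
    have "eqv (h' * \<pi> ^ p) (g ^ p * \<pi> ^ p)" using \<pi>0 by (intro eqv_mult g eqv_refl) simp
    then have "eqv h ((g * \<pi>) ^ p)" using \<pi>0 by (simp add: h'_def power_mult_distrib)
    then show ?thesis using g \<pi>(1) F(1) by (intro bexI[of _ "g * \<pi>"] subfield_mult)
  next
    case False
    then have m: "?p / h \<in> \<mm>" using notin_R[of "h / ?p"] by simp
    obtain b where b: "b \<in> F" "cgr ?p (b ^ p) h" using F(3) Suc.prems by (auto simp: Fr_def)
    then have "eqv h (b ^ p)" using eqv_sym[OF cgr_eqv[OF _ m Suc.prems(3)]] by blast
    then show ?thesis using b by blast
  qed
qed

end

context valued_ext
begin

lemma ram_field_value:
  assumes "x \<in> ram_field K R" "x \<noteq> 0" and p: "prime p" "of_nat p \<in> \<mm>"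
  shows "\<exists>n s t. \<exists>a\<in>K. n * s = Suc (p * t) \<and> eqv (x ^ n) a"
proof -
  obtain N where "fin_level K R N" and xN: "x \<in> fin_level.fixf N (fin_level.ramif K R N)"
    using ram_field_level[OF assms(1)] by blast
  then interpret fin_level K R N by simp
  from ramification_value[OF xN assms(2)] obtain n a where
    "of_nat n \<notin> \<mm>" "a \<in> K" "eqv (x ^ n) a" by (auto simp: eqv_def)
  then show ?thesis using prime_to_p[OF p] by blast
qed

text \<open>If \<open>p\<close> divides \<open>x ^ p * c\<close>, zero is a root. Otherwise this
  product has value below that of \<open>p\<close>, whereas \<open>c\<close> itself may lie outside
  the convex hull of \<open>p\<close>. The \<open>n\<close>-th power of the product,
  \<open>n\<close> being the tame index, has the value of an element of the inertia field, to which
  \<open>hull_divisible\<close> applies. Hence the value of \<open>c\<close> is divisible by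
  \<open>p\<close>, and \<open>c\<close> is a \<open>p\<close>-th power times a unit of the inertia
  field.\<close>

lemma Fr_up_mixed:
  assumes p: "prime p" "of_nat p \<in> \<mm>" and FK: "Fr K (of_nat p) p"
    and \<pi>: "\<pi> \<in> K" "eqv (\<pi> ^ p) (of_nat p)"
  shows "Fr (ram_field K R) (of_nat p) p"
proof (rule Fr_up)
  let ?p = "of_nat p :: 'a"
  show fm: "fmod p ?p" using p R_1 by (auto simp: fmod_def)
  have p0: "p > 0" using p by (simp add: prime_gt_0_nat)
  have P0: "?p \<noteq> 0" using eqv_nz[OF \<pi>(2)] by blast
  fix N c x assume "fin_level K R N" and c: "c \<in> fin_level.fixf N (fin_level.inertia K R N)"
    and x: "x \<in> fin_level.fixf N (fin_level.ramif K R N)" and nz: "c \<noteq> 0" "x \<noteq> 0" "x ^ p * c \<in> R"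
  then interpret fin_level K R N by simp
  note subM = fixf_subfield[OF inertia_Gal] and subL = fixf_subfield[OF ramif_Gal]
  have FM: "Fr (fixf inertia) ?p p" by (rule inertia_frobenius_up[OF fm FK])
  show "\<exists>b\<in>fixf ramif. b \<in> R \<and> cgr ?p (b ^ p) (x ^ p * c)"
  proof (cases "x ^ p * c / ?p \<in> R")
    case True
    have "0 ^ p - x ^ p * c = ?p * (- (x ^ p * c / ?p))" using p0 P0 by (simp add: power_0_left)
    then have "cgr ?p (0 ^ p) (x ^ p * c)" unfolding cgr_def using R_uminus[OF True] by blast
    then show ?thesis using subfield_zero[OF subL] R_0 by blast
  next
    case False
    then have "?p / (x ^ p * c) \<in> \<mm>" using notin_R[of "x ^ p * c / ?p"] by simp
    then have m: "?p / (x ^ p * c) \<in> R" by (rule m_R)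
    define n where "n = card (emb inertia (fixf ramif))"
    obtain s t where st: "n * s = Suc (p * t)" using prime_to_p[OF p tame_index] by (auto simp: n_def)
    obtain a where a: "a \<in> fixf inertia" "eqv (x ^ n) a"
      using tame_value[OF x nz(2)] by (auto simp: eqv_def n_def)
    have a0: "a \<noteq> 0" using eqv_nz[OF a(2)] by blast
    \<comment> \<open>As \<open>a\<close> has the value of \<open>x ^ n\<close>, this is an element
      of the inertia field with the value of \<open>(x ^ p * c) ^ n\<close>.\<close>
    define h where "h = c ^ n * a ^ p"
    have "eqv (c ^ n * (x ^ n) ^ p) h" unfolding h_def using nz by (intro eqv_mult eqv_refl eqv_power a) simp
    moreover have "c ^ n * (x ^ n) ^ p = (x ^ p * c) ^ n"
      by (simp add: power_mult_distrib power_mult[symmetric] mult.commute)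
    ultimately have e: "eqv ((x ^ p * c) ^ n) h" by simp
    have hR: "h \<in> R" using eqv_R[OF e] R_power[OF nz(3)] by blast
    have h0: "h \<noteq> 0" using eqv_nz[OF e] by blast
    have "eqv (?p ^ n / (x ^ p * c) ^ n) (?p ^ n / h)" using P0 by (intro eqv_divide eqv_refl e) simp
    moreover have "?p ^ n / (x ^ p * c) ^ n \<in> R" using R_power[OF m, of n] by (simp add: power_divide)
    ultimately have hn: "?p ^ n / h \<in> R" using eqv_R by blast
    have hM: "h \<in> fixf inertia" unfolding h_def using a c subM by (intro subfield_mult subfield_power)
    have \<pi>M: "\<pi> \<in> fixf inertia" using \<pi>(1) fixf_K[OF inertia_Gal] by blast
    obtain g where g: "g \<in> fixf inertia" "eqv h (g ^ p)"
      using hull_divisible[OF subM subfield_of_nat[OF subM] FM \<pi>M \<pi>(2) hM hR h0 hn] by blast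
    have "eqv (h / a ^ p) (g ^ p / a ^ p)" using a0 by (intro eqv_divide g eqv_refl) simp
    then have "eqv (c ^ n) ((g / a) ^ p)" using a0 by (simp add: h_def power_divide)
    from eqv_root[OF st this] have ec: "eqv c (((g / a) ^ s / c ^ t) ^ p)" .
    define f where "f = (g / a) ^ s / c ^ t"
    have fM: "f \<in> fixf inertia" unfolding f_def using g a c subM by (intro subfield_divide subfield_power)
    have ef: "eqv c (f ^ p)" using ec by (simp add: f_def)
    have f0: "f \<noteq> 0" using eqv_nz[OF ef] p0 by (auto simp: power_0_left)
    have cf: "c / f ^ p \<in> fixf inertia" using fM c subM by (intro subfield_divide subfield_power)
    have "c / f ^ p \<in> R" using ef by (simp add: eqv_def)
    then obtain b where b: "b \<in> fixf inertia" "b \<in> R" "cgr ?p (b ^ p) (c / f ^ p)"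
      using FM cf by (auto simp: Fr_def)
    \<comment> \<open>\<open>f * x\<close> is integral because its \<open>p\<close>-th power has the
      value of \<open>x ^ p * c\<close>; multiplying by it turns the root of the unit
      \<open>c / f ^ p\<close> into one of \<open>x ^ p * c\<close>.\<close>
    have "eqv (x ^ p * c) (x ^ p * f ^ p)" using nz by (intro eqv_mult eqv_refl ef) simp
    then have "(f * x) ^ p \<in> R" using eqv_R nz(3) by (simp add: power_mult_distrib mult.commute)
    then have fxR: "f * x \<in> R" using R_power_iff[OF p0] by blast
    have "cgr ?p ((f * x) ^ p * b ^ p) ((f * x) ^ p * (c / f ^ p))"
      by (rule cgr_mult[OF b(3) R_power[OF fxR]])
    moreover have "(f * x) ^ p * (c / f ^ p) = x ^ p * c" using f0 by (simp add: power_mult_distrib)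
    ultimately have "cgr ?p ((f * x * b) ^ p) (x ^ p * c)" by (simp add: power_mult_distrib)
    moreover have "f * x * b \<in> R" by (rule R_mult[OF fxR b(2)])
    moreover have "f * x * b \<in> fixf ramif"
      using fM b(1) x fixf_anti[OF ramif_inertia] by (intro subfield_mult[OF subL]) auto
    ultimately show ?thesis by blast
  qed
qed

section \<open>Completions\<close>

definition DRvr_at :: "'a set \<Rightarrow> nat \<Rightarrow> bool" where
  "DRvr_at F p \<longleftrightarrow> (\<forall>a\<in>compl_val_ring F R. \<exists>b\<in>compl_val_ring F R. \<exists>c\<in>compl_val_ring F R.
     null_net F R (\<lambda>i. b i ^ p - a i - of_nat p * c i))"

lemma cauchy_net_iff:
  "cauchy_net F R a \<longleftrightarrow> (\<forall>c\<in>net_index F. a c \<in> F) \<and>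
     (\<forall>d\<in>net_index F. \<exists>c0\<in>net_index F. \<forall>c\<in>net_index F. \<forall>c'\<in>net_index F.
        c / c0 \<in> R \<and> c' / c0 \<in> R \<longrightarrow> (a c - a c') / d \<in> \<mm>)"
  unfolding cauchy_net_def by (auto simp: net_index_def vle_iff vless_iff)

lemma null_net_iff:
  "null_net F R a \<longleftrightarrow>
     (\<forall>d\<in>net_index F. \<exists>c0\<in>net_index F. \<forall>c\<in>net_index F. c / c0 \<in> R \<longrightarrow> a c / d \<in> \<mm>)"
  unfolding null_net_def by (auto simp: net_index_def vle_iff vless_iff)

lemma compl_val_ring_iff:
  "a \<in> compl_val_ring F R \<longleftrightarrow> cauchy_net F R a \<and>
     (\<exists>c0\<in>net_index F. \<forall>c\<in>net_index F. c / c0 \<in> R \<longrightarrow> a c \<in> R)"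
  unfolding compl_val_ring_def by (auto simp: net_index_def vle_iff)

lemma net_index_upper:
  assumes "c0 \<in> net_index F" "c1 \<in> net_index F"
  shows "\<exists>c\<in>net_index F. \<forall>x. x / c \<in> R \<longrightarrow> x / c0 \<in> R \<and> x / c1 \<in> R"
proof -
  have *: "x / u \<in> R" if "v / u \<in> R" "x / v \<in> R" "v \<noteq> 0" for x u v
    using R_mult[OF that(1,2)] that(3) by simp
  have nz: "c0 \<noteq> 0" "c1 \<noteq> 0" using assms by (auto simp: net_index_def)
  have "c1 / c0 \<in> R \<or> c0 / c1 \<in> R" using R_total[of "c1 / c0"] by simp
  then show ?thesis using * nz assms by blast
qed

lemma net_index_self: "c \<in> net_index F \<Longrightarrow> c / c \<in> R"
  using R_1 by (simp add: net_index_def)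

lemma const_compl_val_ring:
  assumes "is_subfield F" "a \<in> F" "a \<in> R"
  shows "(\<lambda>_. a) \<in> compl_val_ring F R"
proof -
  have "1 \<in> net_index F" using assms(1) by (simp add: net_index_def subfield_one)
  then show ?thesis using assms m_0 by (auto simp: compl_val_ring_iff cauchy_net_iff)
qed

text \<open>Apply the condition to a constant net and evaluate the resulting nets at one
  sufficiently large index.\<close>

lemma DRvr_at_approx:
  assumes D: "DRvr_at F p" and F: "is_subfield F" and a: "a \<in> F" "a \<in> R" and d: "d \<in> F" "d \<noteq> 0"
  shows "\<exists>b\<in>F. b \<in> R \<and> (\<exists>c\<in>R. (b ^ p - a - of_nat p * c) / d \<in> \<mm>)"
proof -
  obtain b c where bc: "b \<in> compl_val_ring F R" "c \<in> compl_val_ring F R"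
    "null_net F R (\<lambda>i. b i ^ p - a - of_nat p * c i)"
    using D[unfolded DRvr_at_def, rule_format, OF const_compl_val_ring[OF F a]] by auto
  obtain c1 where c1: "c1 \<in> net_index F" "\<And>i. i \<in> net_index F \<Longrightarrow> i / c1 \<in> R \<Longrightarrow> b i \<in> R"
    using bc(1) by (auto simp: compl_val_ring_iff)
  obtain c2 where c2: "c2 \<in> net_index F" "\<And>i. i \<in> net_index F \<Longrightarrow> i / c2 \<in> R \<Longrightarrow> c i \<in> R"
    using bc(2) by (auto simp: compl_val_ring_iff)
  have "d \<in> net_index F" using d by (simp add: net_index_def)
  then obtain c3 where c3: "c3 \<in> net_index F"
    "\<And>i. i \<in> net_index F \<Longrightarrow> i / c3 \<in> R \<Longrightarrow> (b i ^ p - a - of_nat p * c i) / d \<in> \<mm>"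
    using bc(3) unfolding null_net_iff by blast
  obtain u where u: "u \<in> net_index F" "\<And>x. x / u \<in> R \<Longrightarrow> x / c1 \<in> R \<and> x / c2 \<in> R"
    using net_index_upper[OF c1(1) c2(1)] by blast
  obtain w where w: "w \<in> net_index F" "\<And>x. x / w \<in> R \<Longrightarrow> x / u \<in> R \<and> x / c3 \<in> R"
    using net_index_upper[OF u(1) c3(1)] by blast
  have "w / w \<in> R" by (rule net_index_self[OF w(1)])
  then have "b w \<in> R" "c w \<in> R" "(b w ^ p - a - of_nat p * c w) / d \<in> \<mm>"
    using w u c1 c2 c3 by blast+
  moreover have "b w \<in> F" using bc(1) w(1) by (auto simp: compl_val_ring_iff cauchy_net_iff)
  ultimately show ?thesis by blast
qed

text \<open>A Cauchy net is eventually constant modulo \<open>p\<close>, so a root of one late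
  member serves as a constant net \<open>b\<close>, and \<open>c\<close> absorbs the whole
  remainder. Conversely, an error smaller than \<open>p\<close> is absorbed into the multiple of
  \<open>p\<close>.\<close>

lemma DRvr_at_mixed:
  assumes F: "is_subfield F" and p: "prime p" "of_nat p \<in> \<mm>" "of_nat p \<noteq> (0::'a)"
  shows "DRvr_at F p \<longleftrightarrow> Fr F (of_nat p) p"
proof
  let ?p = "of_nat p :: 'a"
  have pF: "?p \<in> F" by (rule subfield_of_nat[OF F])
  {
    assume D: "DRvr_at F p"
    show "Fr F ?p p"
      unfolding Fr_def
    proof (intro ballI impI)
      fix a assume a: "a \<in> F" "a \<in> R"
      from DRvr_at_approx[OF D F a pF p(3)] obtain b c where
        b: "b \<in> F" "b \<in> R" "c \<in> R" "(b ^ p - a - ?p * c) / ?p \<in> \<mm>" by blast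
      have "b ^ p - a = ?p * (c + (b ^ p - a - ?p * c) / ?p)" using p(3) by (simp add: field_simps)
      moreover have "c + (b ^ p - a - ?p * c) / ?p \<in> R" using b m_R by (intro R_add) auto
      ultimately have "cgr ?p (b ^ p) a" unfolding cgr_def by blast
      then show "\<exists>b\<in>F. b \<in> R \<and> cgr ?p (b ^ p) a" using b by blast
    qed
  next
    assume Fr: "Fr F ?p p"
    show "DRvr_at F p"
      unfolding DRvr_at_def
    proof
      fix a assume "a \<in> compl_val_ring F R"
      then have aF: "\<And>i. i \<in> net_index F \<Longrightarrow> a i \<in> F"
        and cau: "\<And>d. d \<in> net_index F \<Longrightarrow> \<exists>c0\<in>net_index F. \<forall>c\<in>net_index F. \<forall>c'\<in>net_index F.
          c / c0 \<in> R \<and> c' / c0 \<in> R \<longrightarrow> (a c - a c') / d \<in> \<mm>"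
        and ex: "\<exists>c0\<in>net_index F. \<forall>c\<in>net_index F. c / c0 \<in> R \<longrightarrow> a c \<in> R"
        by (auto simp: compl_val_ring_iff cauchy_net_iff)
      have pI: "?p \<in> net_index F" using pF p by (simp add: net_index_def)
      obtain c1 where c1: "c1 \<in> net_index F" "\<And>i. i \<in> net_index F \<Longrightarrow> i / c1 \<in> R \<Longrightarrow> a i \<in> R"
        using ex by blast
      obtain c2 where c2: "c2 \<in> net_index F" "\<And>i j. i \<in> net_index F \<Longrightarrow> j \<in> net_index F \<Longrightarrow>
        i / c2 \<in> R \<Longrightarrow> j / c2 \<in> R \<Longrightarrow> (a i - a j) / ?p \<in> \<mm>" using cau[OF pI] by blast
      obtain u where u: "u \<in> net_index F" "\<And>x. x / u \<in> R \<Longrightarrow> x / c1 \<in> R \<and> x / c2 \<in> R"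
        using net_index_upper[OF c1(1) c2(1)] by blast
      have uu: "u / c1 \<in> R" "u / c2 \<in> R" using u(2)[OF net_index_self[OF u(1)]] by auto
      have "a u \<in> R" using c1 u uu by blast
      then obtain b where b: "b \<in> F" "b \<in> R" "cgr ?p (b ^ p) (a u)"
        using Fr aF[OF u(1)] by (auto simp: Fr_def)
      then obtain r where r: "r \<in> R" "b ^ p - a u = ?p * r" by (auto simp: cgr_def)
      \<comment> \<open>With this choice the net that has to be null is identically zero;
        integrality and the Cauchy property remain.\<close>
      define c where "c i = (b ^ p - a i) / ?p" for i
      have cR: "c i \<in> R" if i: "i \<in> net_index F" "i / u \<in> R" for i
      proof -
        have "(a u - a i) / ?p \<in> \<mm>" using c2(2)[OF u(1) i(1)] u(2)[OF i(2)] uu by blast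
        then have "r + (a u - a i) / ?p \<in> R" using r m_R by (intro R_add) auto
        moreover have "c i = (b ^ p - a u) / ?p + (a u - a i) / ?p"
          by (simp add: c_def diff_divide_distrib)
        then have "c i = r + (a u - a i) / ?p" using r(2) p(3) by simp
        ultimately show ?thesis by (simp only:)
      qed
      have "cauchy_net F R c"
        unfolding cauchy_net_iff
      proof (intro conjI ballI)
        fix i assume "i \<in> net_index F"
        then show "c i \<in> F" unfolding c_def using b aF pF F by (intro subfield_divide subfield_diff subfield_power)
      next
        fix d assume "d \<in> net_index F"
        then have "?p * d \<in> net_index F" using pI F by (auto simp: net_index_def subfield_mult)
        from cau[OF this] obtain c0 where c0: "c0 \<in> net_index F"
          "\<And>i j. i \<in> net_index F \<Longrightarrow> j \<in> net_index F \<Longrightarrow> i / c0 \<in> R \<Longrightarrow> j / c0 \<in> R \<Longrightarrow>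
            (a i - a j) / (?p * d) \<in> \<mm>" by blast
        have "(c i - c j) / d \<in> \<mm>"
          if "i \<in> net_index F" "j \<in> net_index F" "i / c0 \<in> R" "j / c0 \<in> R" for i j
        proof -
          have "(c i - c j) / d = (a j - a i) / (?p * d)"
            by (simp add: c_def diff_divide_distrib[symmetric])
          then show ?thesis using c0(2) that by (simp only:)
        qed
        then show "\<exists>c0\<in>net_index F. \<forall>i\<in>net_index F. \<forall>j\<in>net_index F.
          i / c0 \<in> R \<and> j / c0 \<in> R \<longrightarrow> (c i - c j) / d \<in> \<mm>" using c0(1) by blast
      qed
      then have "c \<in> compl_val_ring F R" unfolding compl_val_ring_iff using cR u(1) by blast
      moreover have "null_net F R (\<lambda>i. b ^ p - a i - ?p * c i)"
        unfolding null_net_iff using p(3) m_0 u(1) by (auto simp: c_def)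
      ultimately show "\<exists>b\<in>compl_val_ring F R. \<exists>c\<in>compl_val_ring F R.
          null_net F R (\<lambda>i. b i ^ p - a i - ?p * c i)"
        using const_compl_val_ring[OF F b(1,2)] by (intro bexI[of _ "\<lambda>_. b"] bexI[of _ c])
    qed
  }
qed

text \<open>With \<open>p\<close> zero the condition says that \<open>p\<close>-th powers are dense.
  Approximate roots \<open>b i\<close> of a Cauchy net \<open>a i\<close> form a Cauchy net again,
  because \<open>(b i - b j) ^ p\<close> equals \<open>b i ^ p - b j ^ p\<close>.\<close>

lemma DRvr_at_equal:
  assumes F: "is_subfield F" and p: "prime p" "of_nat p = (0::'a)"
  shows "DRvr_at F p \<longleftrightarrow>
    (\<forall>a\<in>F. a \<in> R \<longrightarrow> (\<forall>d\<in>F. d \<noteq> 0 \<longrightarrow> (\<exists>b\<in>F. b \<in> R \<and> (b ^ p - a) / d \<in> \<mm>)))"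
    (is "_ \<longleftrightarrow> ?S")
proof
  assume D: "DRvr_at F p"
  then show ?S using DRvr_at_approx[OF D F] p(2) by fastforce
next
  assume S: ?S
  have p0: "p > 0" using p by (simp add: prime_gt_0_nat)
  have frob: "(x - y) ^ p = x ^ p - y ^ p" if "x \<in> R" "y \<in> R" for x y :: 'a
  proof -
    have "fmod p 0" using p R_0 by (auto simp: fmod_def)
    from frobenius_add[OF this R_diff[OF that] that(2)] show ?thesis by (auto simp: cgr_def)
  qed
  show "DRvr_at F p"
    unfolding DRvr_at_def
  proof
    fix a assume "a \<in> compl_val_ring F R"
    then have aF: "\<And>i. i \<in> net_index F \<Longrightarrow> a i \<in> F"
      and cau: "\<And>d. d \<in> net_index F \<Longrightarrow> \<exists>c0\<in>net_index F. \<forall>c\<in>net_index F. \<forall>c'\<in>net_index F.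
        c / c0 \<in> R \<and> c' / c0 \<in> R \<longrightarrow> (a c - a c') / d \<in> \<mm>"
      and ex: "\<exists>c0\<in>net_index F. \<forall>c\<in>net_index F. c / c0 \<in> R \<longrightarrow> a c \<in> R"
      by (auto simp: compl_val_ring_iff cauchy_net_iff)
    obtain c1 where c1: "c1 \<in> net_index F" "\<And>i. i \<in> net_index F \<Longrightarrow> i / c1 \<in> R \<Longrightarrow> a i \<in> R"
      using ex by blast
    \<comment> \<open>The index itself serves as the required precision, so that
      \<open>b i ^ p\<close> approaches \<open>a i\<close> along the net.\<close>
    have "\<exists>b. b \<in> F \<and> b \<in> R \<and> (i \<in> net_index F \<longrightarrow> a i \<in> R \<longrightarrow> (b ^ p - a i) / i \<in> \<mm>)" for i
    proof (cases "i \<in> net_index F \<and> a i \<in> R")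
      case True
      then show ?thesis using S aF by (fastforce simp: net_index_def)
    next
      case False
      then show ?thesis using subfield_zero[OF F] R_0 by blast
    qed
    then obtain b where b: "\<And>i. b i \<in> F" "\<And>i. b i \<in> R"
      "\<And>i. i \<in> net_index F \<Longrightarrow> a i \<in> R \<Longrightarrow> (b i ^ p - a i) / i \<in> \<mm>" by metis
    have near: "(b i ^ p - a i) / d \<in> \<mm>" if "i \<in> net_index F" "i / c1 \<in> R" "i / d \<in> R" for i d
    proof -
      have "(b i ^ p - a i) / i * (i / d) \<in> \<mm>" using b(3) c1(2) that by (intro m_mult) auto
      then show ?thesis using that by (simp add: net_index_def)
    qed
    have "cauchy_net F R b"
      unfolding cauchy_net_iff
    proof (intro conjI ballI)
      fix d assume d: "d \<in> net_index F"
      \<comment> \<open>A bound by \<open>d\<close> on \<open>b i - b j\<close> amounts to a bound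
        by \<open>d ^ p\<close> on its \<open>p\<close>-th power.\<close>
      then have dp: "d ^ p \<in> net_index F" using F by (simp add: net_index_def subfield_power)
      obtain c0 where c0: "c0 \<in> net_index F" "\<And>i j. i \<in> net_index F \<Longrightarrow> j \<in> net_index F \<Longrightarrow>
        i / c0 \<in> R \<Longrightarrow> j / c0 \<in> R \<Longrightarrow> (a i - a j) / d ^ p \<in> \<mm>" using cau[OF dp] by blast
      obtain u where u: "u \<in> net_index F" "\<And>x. x / u \<in> R \<Longrightarrow> x / c0 \<in> R \<and> x / c1 \<in> R"
        using net_index_upper[OF c0(1) c1(1)] by blast
      obtain w where w: "w \<in> net_index F" "\<And>x. x / w \<in> R \<Longrightarrow> x / u \<in> R \<and> x / d ^ p \<in> R"
        using net_index_upper[OF u(1) dp] by blast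
      have "(b i - b j) / d \<in> \<mm>"
        if ij: "i \<in> net_index F" "j \<in> net_index F" "i / w \<in> R" "j / w \<in> R" for i j
      proof -
        have 1: "(b i ^ p - a i) / d ^ p \<in> \<mm>" "(b j ^ p - a j) / d ^ p \<in> \<mm>"
          using near ij w u by blast+
        have 2: "(a i - a j) / d ^ p \<in> \<mm>" using c0 ij w u by blast
        have "((b i - b j) / d) ^ p = (b i ^ p - a i) / d ^ p - (b j ^ p - a j) / d ^ p + (a i - a j) / d ^ p"
          unfolding power_divide frob[OF b(2) b(2)] by (simp add: diff_divide_distrib)
        also have "\<dots> \<in> \<mm>" by (intro m_add m_diff 1 2)
        finally show ?thesis using notin_m_power by blast
      qed
      then show "\<exists>c0\<in>net_index F. \<forall>i\<in>net_index F. \<forall>j\<in>net_index F.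
          i / c0 \<in> R \<and> j / c0 \<in> R \<longrightarrow> (b i - b j) / d \<in> \<mm>" using w(1) by blast
    qed (use b in auto)
    then have "b \<in> compl_val_ring F R" unfolding compl_val_ring_iff using b c1(1) by blast
    moreover have "null_net F R (\<lambda>i. b i ^ p - a i - of_nat p * 0)"
      unfolding null_net_iff
    proof
      fix d assume "d \<in> net_index F"
      then obtain u where u: "u \<in> net_index F" "\<And>x. x / u \<in> R \<Longrightarrow> x / c1 \<in> R \<and> x / d \<in> R"
        using net_index_upper[OF c1(1)] by blast
      show "\<exists>c0\<in>net_index F. \<forall>c\<in>net_index F. c / c0 \<in> R \<longrightarrow> (b c ^ p - a c - of_nat p * 0) / d \<in> \<mm>"
        using near u by auto
    qed
    ultimately show "\<exists>b\<in>compl_val_ring F R. \<exists>c\<in>compl_val_ring F R.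
        null_net F R (\<lambda>i. b i ^ p - a i - of_nat p * c i)"
      using const_compl_val_ring[OF F subfield_zero[OF F] R_0]
      by (intro bexI[of _ b] bexI[of _ "\<lambda>_. 0"])
  qed
qed

text \<open>Moduli in \<open>K\<close> are cofinal among those in \<open>F\<close>, and the element
  \<open>\<pi>\<close> of positive value turns divisibility by a modulus into the strict inequality
  required of nets.\<close>

lemma DRvr_at_nontrivial:
  assumes F: "is_subfield F" "K \<subseteq> F" "F \<subseteq> W" and p: "prime p" "of_nat p = (0::'a)" and K: "\<not> K \<subseteq> R"
  shows "DRvr_at F p \<longleftrightarrow> (\<forall>d\<in>K. d \<noteq> 0 \<longrightarrow> Fr F d p)"
proof
  assume "DRvr_at F p"
  then have S: "\<And>a d. a \<in> F \<Longrightarrow> a \<in> R \<Longrightarrow> d \<in> F \<Longrightarrow> d \<noteq> 0 \<Longrightarrow> \<exists>b\<in>F. b \<in> R \<and> (b ^ p - a) / d \<in> \<mm>"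
    using DRvr_at_equal[OF F(1) p] by blast
  show "\<forall>d\<in>K. d \<noteq> 0 \<longrightarrow> Fr F d p"
    unfolding Fr_def
  proof (intro ballI impI)
    fix d a assume *: "d \<in> K" "d \<noteq> 0" "a \<in> F" "a \<in> R"
    then obtain b where b: "b \<in> F" "b \<in> R" "(b ^ p - a) / d \<in> \<mm>" using S F(2) by blast
    then have "cgr d (b ^ p) a"
      unfolding cgr_def using *(2) m_R by (intro bexI[of _ "(b ^ p - a) / d"]) auto
    then show "\<exists>b\<in>F. b \<in> R \<and> cgr d (b ^ p) a" using b by blast
  qed
next
  assume Fr: "\<forall>d\<in>K. d \<noteq> 0 \<longrightarrow> Fr F d p"
  obtain k where k: "k \<in> K" "k \<notin> R" using K by blast
  define \<pi> where "\<pi> = inverse k"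
  have \<pi>: "\<pi> \<in> K" "\<pi> \<noteq> 0" "\<pi> \<in> \<mm>"
    using k subfield_inverse[OF subfield_K] notin_R by (auto simp: \<pi>_def)
  show "DRvr_at F p"
    unfolding DRvr_at_equal[OF F(1) p]
  proof (intro ballI impI)
    fix a d assume a: "a \<in> F" "a \<in> R" and d: "d \<in> F" "d \<noteq> 0"
    obtain e where e: "e \<in> K" "e \<noteq> 0" "e / d \<in> R" using cofinal d F(3) by blast
    have "e * \<pi> \<in> K" "e * \<pi> \<noteq> 0" using e \<pi> subfield_K by (auto intro: subfield_mult)
    then have "Fr F (e * \<pi>) p" using Fr by blast
    then obtain b where b: "b \<in> F" "b \<in> R" "cgr (e * \<pi>) (b ^ p) a"
      using a unfolding Fr_def by blast
    then obtain r where r: "r \<in> R" "b ^ p - a = e * \<pi> * r" by (auto simp: cgr_def)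
    have "\<pi> * (e / d * r) \<in> \<mm>" by (rule m_mult[OF \<pi>(3) R_mult[OF e(3) r(1)]])
    then have "(b ^ p - a) / d \<in> \<mm>" by (simp add: r(2) ac_simps)
    then show "\<exists>b\<in>F. b \<in> R \<and> (b ^ p - a) / d \<in> \<mm>" using b by blast
  qed
qed

text \<open>No nonzero element of \<open>F\<close> lies in \<open>\<mm>\<close>, so approximation
  means equality.\<close>

lemma DRvr_at_trivial:
  assumes F: "is_subfield F" "F \<subseteq> W" and p: "prime p" "of_nat p = (0::'a)" and K: "K \<subseteq> R"
  shows "DRvr_at F p \<longleftrightarrow> Fr F 0 p"
proof
  have FR: "F \<subseteq> R" using F(2) trivial_W[OF K] by blast
  have m: "x = 0" if "x \<in> \<mm>" "x \<in> F" for x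
    using that FR subfield_inverse[OF F(1)] by (auto simp: m_iff)
  {
    assume "DRvr_at F p"
    then have S: "\<And>a. a \<in> F \<Longrightarrow> a \<in> R \<Longrightarrow> \<exists>b\<in>F. b \<in> R \<and> (b ^ p - a) / 1 \<in> \<mm>"
      using DRvr_at_equal[OF F(1) p] subfield_one[OF F(1)] zero_neq_one by metis
    show "Fr F 0 p"
      unfolding Fr_def
    proof (intro ballI impI)
      fix a assume a: "a \<in> F" "a \<in> R"
      then obtain b where b: "b \<in> F" "b \<in> R" "b ^ p - a \<in> \<mm>" using S by auto
      then have "b ^ p - a = 0" using a F(1) by (intro m) (auto intro: subfield_diff subfield_power)
      then show "\<exists>b\<in>F. b \<in> R \<and> cgr 0 (b ^ p) a" using b by (auto simp: cgr_refl)
    qed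
  next
    assume "Fr F 0 p"
    then have "\<exists>b\<in>F. b \<in> R \<and> b ^ p - a = 0" if "a \<in> F" "a \<in> R" for a
      using that by (auto simp: Fr_def cgr_def)
    then show "DRvr_at F p"
      unfolding DRvr_at_equal[OF F(1) p] using m_0 by (metis div_0)
  }
qed

section \<open>Elements whose \<open>p\<close>-th power has a prescribed value\<close>

lemma smallest_pos_root:
  assumes p: "prime p" "of_nat p \<in> \<mm>" and \<pi>: "\<pi> \<in> F" "eqv (\<pi> ^ p) (of_nat p)"
  shows "\<not> smallest_pos F R (of_nat p)"
proof
  let ?p = "of_nat p :: 'a"
  assume "smallest_pos F R ?p"
  then have s: "\<And>x. x \<in> F \<Longrightarrow> x \<noteq> 0 \<Longrightarrow> vless R 1 x \<Longrightarrow> vle R ?p x" and P0: "?p \<noteq> 0"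
    by (auto simp: smallest_pos_def)
  \<comment> \<open>Since \<open>p\<close> is at least two, splitting one factor off
    \<open>\<pi> ^ p\<close> leaves a positive power of \<open>\<pi>\<close>; so the positive value
    of \<open>\<pi>\<close> is smaller than that of \<open>p\<close>.\<close>
  obtain q where q: "p = Suc (Suc q)" using prime_ge_2_nat[OF p(1)] by (metis Suc_diff_le diff_Suc_Suc le_Suc_ex numeral_2_eq_2 plus_nat.simps(2))
  have \<pi>0: "\<pi> \<noteq> 0" using eqv_nz[OF \<pi>(2)] q by auto
  have "\<pi> ^ p \<in> \<mm>" using eqv_m[OF \<pi>(2)] p(2) by blast
  then have \<pi>m: "\<pi> \<in> \<mm>" using notin_m_power by blast
  then have "vle R ?p \<pi>" using s \<pi>(1) \<pi>0 by (simp add: vless_iff)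
  then have "\<pi> / ?p \<in> R" using P0 by (simp add: vle_iff)
  moreover have "\<pi> ^ Suc q \<in> \<mm>" using \<pi>m by (intro m_power) auto
  ultimately have "\<pi> ^ Suc q * (\<pi> / ?p) \<in> \<mm>" by (intro m_mult)
  moreover have "\<pi> ^ Suc q * (\<pi> / ?p) = \<pi> ^ p / ?p" by (simp add: q)
  ultimately have "\<pi> ^ p / ?p \<in> \<mm>" by (simp only:)
  then show False using \<pi>(2) by (simp add: eqv_def)
qed

text \<open>Choose \<open>x\<close> with value strictly between \<open>0\<close> and that of
  \<open>p\<close>. Both \<open>x\<close> and \<open>p / x\<close> have value below that of
  \<open>p\<close>, so roots modulo \<open>p\<close> realise their values exactly; the product of
  the two roots is the desired \<open>\<pi>\<close>.\<close>

lemma root_of_not_smallest: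
  assumes F: "is_subfield F" and p: "prime p" "of_nat p \<in> \<mm>" "of_nat p \<noteq> (0::'a)"
    and Fr: "Fr F (of_nat p) p" and ns: "\<not> smallest_pos F R (of_nat p)"
  shows "\<exists>\<pi>\<in>F. eqv (\<pi> ^ p) (of_nat p)"
proof -
  let ?p = "of_nat p :: 'a"
  have pF: "?p \<in> F" by (rule subfield_of_nat[OF F])
  obtain x where x: "x \<in> F" "x \<noteq> 0" "vless R 1 x" "\<not> vle R ?p x"
    using ns p pF by (auto simp: smallest_pos_def vless_iff)
  have xm: "x \<in> \<mm>" using x(3) by (simp add: vless_iff)
  have "x / ?p \<notin> R" using x(4) p by (simp add: vle_iff)
  then have ym: "?p / x \<in> \<mm>" using notin_R[of "x / ?p"] by simp
  obtain b where b: "b \<in> F" "cgr ?p (b ^ p) x" using Fr x(1) m_R[OF xm] by (auto simp: Fr_def)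
  have 1: "eqv (b ^ p) x" by (rule cgr_eqv[OF b(2) ym x(2)])
  have "?p / x \<in> F" using pF x F by (intro subfield_divide)
  then obtain b' where b': "b' \<in> F" "cgr ?p (b' ^ p) (?p / x)" using Fr m_R[OF ym] by (auto simp: Fr_def)
  have 2: "eqv (b' ^ p) (?p / x)" using x p xm by (intro cgr_eqv[OF b'(2)]) auto
  have "eqv (b ^ p * b' ^ p) (x * (?p / x))" by (intro eqv_mult 1 2)
  then have "eqv ((b * b') ^ p) ?p" using x by (simp add: power_mult_distrib)
  then show ?thesis using b b' F by (intro bexI[of _ "b * b'"] subfield_mult)
qed

text \<open>Some \<open>y ^ n\<close> with \<open>n\<close> prime to \<open>p\<close> has the value
  of an element of \<open>K\<close>, and so has \<open>y ^ p\<close>; by Bezout so has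
  \<open>y\<close>.\<close>

lemma root_descends:
  assumes p: "prime p" "of_nat p \<in> \<mm>" and a: "a \<in> K" and y: "y \<in> ram_field K R" "eqv (y ^ p) a"
  shows "\<exists>z\<in>K. eqv (z ^ p) a"
proof -
  have y0: "y \<noteq> 0" using eqv_nz[OF y(2)] prime_gt_0_nat[OF p(1)] by (auto simp: power_0_left)
  obtain n s t b where nst: "n * s = Suc (p * t)" "b \<in> K" "eqv (y ^ n) b"
    using ram_field_value[OF y(1) y0 p] by blast
  have "eqv ((y ^ n) ^ s) (b ^ s)" by (intro eqv_power nst)
  moreover have "(y ^ n) ^ s = y * (y ^ p) ^ t" by (simp add: power_mult[symmetric] nst)
  ultimately have "eqv (y * (y ^ p) ^ t / (y ^ p) ^ t) (b ^ s / a ^ t)"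
    using y by (metis eqv_divide eqv_power)
  then have "eqv y (b ^ s / a ^ t)" using y0 by simp
  then have "eqv (b ^ s / a ^ t) y" by (rule eqv_sym)
  then have "eqv ((b ^ s / a ^ t) ^ p) a" using eqv_power[of _ y p] y(2) eqv_trans by blast
  moreover have "b ^ s / a ^ t \<in> K" using nst a subfield_K by (intro subfield_divide subfield_power)
  ultimately show ?thesis by blast
qed

definition DRst_at :: "'a set \<Rightarrow> nat \<Rightarrow> bool" where
  "DRst_at F p \<longleftrightarrow> (\<forall>x\<in>F. x \<noteq> 0 \<longrightarrow> (\<exists>y\<in>F. eqv (y ^ p) x))"

lemma DRst_iff: "DRst F R \<longleftrightarrow> (\<forall>p. prime p \<and> of_nat p \<in> \<mm> \<longrightarrow> DRst_at F p)"
proof -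
  have "(\<exists>y\<in>F. y \<noteq> 0 \<and> vle R x (y ^ p) \<and> vle R (y ^ p) x) \<longleftrightarrow> (\<exists>y\<in>F. eqv (y ^ p) x)"
    if "x \<noteq> 0" "prime p" for x p
    using that R_total
    by (intro bex_cong refl) (auto simp: vle_iff eqv_def notin_m prime_gt_0_nat power_0_left)
  then show ?thesis unfolding DRst_def DRst_at_def by simp
qed

lemma DRst_at_ram_field:
  assumes p: "prime p" "of_nat p \<in> \<mm>"
  shows "DRst_at (ram_field K R) p \<longleftrightarrow> DRst_at K p"
proof
  assume L: "DRst_at (ram_field K R) p"
  show "DRst_at K p"
    unfolding DRst_at_def
  proof (intro ballI impI)
    fix x assume x: "x \<in> K" "x \<noteq> 0"
    then obtain y where "y \<in> ram_field K R" "eqv (y ^ p) x"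
      using L ram_field_tower(2) unfolding DRst_at_def by blast
    then show "\<exists>y\<in>K. eqv (y ^ p) x" by (rule root_descends[OF p x(1)])
  qed
next
  assume K: "DRst_at K p"
  show "DRst_at (ram_field K R) p"
    unfolding DRst_at_def
  proof (intro ballI impI)
    fix x assume x: "x \<in> ram_field K R" "x \<noteq> 0"
    obtain n s t a where nst: "n * s = Suc (p * t)" "a \<in> K" "eqv (x ^ n) a"
      using ram_field_value[OF x p] by blast
    obtain y where y: "y \<in> K" "eqv (y ^ p) a" using K nst eqv_nz[OF nst(3)] by (auto simp: DRst_at_def)
    have "eqv (x ^ n) (y ^ p)" using nst(3) eqv_sym[OF y(2)] by (rule eqv_trans)
    from eqv_sym[OF eqv_root[OF nst(1) this]] have "eqv ((y ^ s / x ^ t) ^ p) x" .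
    moreover have "y ^ s / x ^ t \<in> ram_field K R"
      using y x ram_field_tower by (intro subfield_divide subfield_power) auto
    ultimately show "\<exists>y\<in>ram_field K R. eqv (y ^ p) x" by blast
  qed
qed

text \<open>(DRst) provides an element \<open>\<pi>\<close> as in \<open>smallest_pos_root\<close>
  when \<open>p\<close> is nonzero, so it implies (DRvp).\<close>

lemma DRst_at_smallest:
  assumes p: "prime p" "of_nat p \<in> \<mm>" and F: "is_subfield F" "DRst_at F p"
  shows "\<not> smallest_pos F R (of_nat p)"
proof (cases "of_nat p = (0::'a)")
  case True
  then show ?thesis by (simp add: smallest_pos_def)
next
  case False
  then show ?thesis
    using F smallest_pos_root[OF p] subfield_of_nat[OF F(1)] unfolding DRst_at_def by blast
qed

text \<open>If \<open>p\<close> is nonzero, both conditions together yield an element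
  \<open>\<pi>\<close> whose \<open>p\<close>-th power has the value of \<open>p\<close>. Upwards,
  \<open>Fr_up_mixed\<close> consumes it; downwards, \<open>root_descends\<close> brings it to
  \<open>K\<close>, where it gives (DRvp). So the conditions are transferred as a pair.\<close>

lemma gdr_at_ram_field:
  assumes p: "prime p" "of_nat p \<in> \<mm>"
  shows "DRvr_at (ram_field K R) p \<and> \<not> smallest_pos (ram_field K R) R (of_nat p) \<longleftrightarrow>
    DRvr_at K p \<and> \<not> smallest_pos K R (of_nat p)"
proof (cases "of_nat p = (0::'a)")
  case True
  have fm: "fmod p d" for d using p True R_0 by (auto simp: fmod_def)
  have "DRvr_at (ram_field K R) p \<longleftrightarrow> DRvr_at K p"
  proof (cases "K \<subseteq> R")
    case triv: True
    show ?thesis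
      unfolding DRvr_at_trivial[OF ram_field_tower(1,3) p(1) True triv]
        DRvr_at_trivial[OF subfield_K K_sub_W p(1) True triv]
      using Fr_down[OF fm subfield_zero[OF subfield_K]] Fr_up_trivial[OF p(1) True triv] by blast
  next
    case False
    show ?thesis
      unfolding DRvr_at_nontrivial[OF ram_field_tower p(1) True False]
        DRvr_at_nontrivial[OF subfield_K order_refl K_sub_W p(1) True False]
      using Fr_down[OF fm] Fr_up_equal[OF p(1) True] by blast
  qed
  then show ?thesis using True by (simp add: smallest_pos_def)
next
  case False
  let ?p = "of_nat p :: 'a"
  let ?L = "ram_field K R"
  have fm: "fmod p ?p" using p R_1 by (auto simp: fmod_def)
  have pK: "?p \<in> K" by (rule subfield_of_nat[OF subfield_K])
  note DL = DRvr_at_mixed[OF ram_field_tower(1) p False] and DK = DRvr_at_mixed[OF subfield_K p False]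
  show ?thesis
    unfolding DL DK
  proof
    assume L: "Fr ?L ?p p \<and> \<not> smallest_pos ?L R ?p"
    then obtain \<pi> where "\<pi> \<in> ?L" "eqv (\<pi> ^ p) ?p"
      using root_of_not_smallest[OF ram_field_tower(1) p False] by blast
    then obtain z where "z \<in> K" "eqv (z ^ p) ?p" using root_descends[OF p pK] by blast
    then show "Fr K ?p p \<and> \<not> smallest_pos K R ?p"
      using smallest_pos_root[OF p] Fr_down[OF fm pK] L by blast
  next
    assume K: "Fr K ?p p \<and> \<not> smallest_pos K R ?p"
    then obtain \<pi> where \<pi>: "\<pi> \<in> K" "eqv (\<pi> ^ p) ?p"
      using root_of_not_smallest[OF subfield_K p False] by blast
    then show "Fr ?L ?p p \<and> \<not> smallest_pos ?L R ?p"
      using smallest_pos_root[OF p _ \<pi>(2)] Fr_up_mixed[OF p _ \<pi>] K ram_field_tower(2) by blast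
  qed
qed

end

theorem theorem1p5:
  fixes K R :: "'a::field set"
  assumes "alg_closed_field TYPE('a)"
    and "is_subfield K"
    and "\<forall>x. algebraic_over K x"
    and "valuation_ring R"
  shows "(gdr (ram_field K R) R \<longleftrightarrow> gdr K R) \<and>
         (semitame (ram_field K R) R \<longleftrightarrow> semitame K R)"
proof -
  interpret valued_ext K R using assms by unfold_locales
  define P where "P p \<longleftrightarrow> prime p \<and> of_nat p \<in> max_ideal R" for p
  have DRvr: "DRvr F R \<longleftrightarrow> (\<forall>p. P p \<longrightarrow> DRvr_at F p)" for F
    by (simp add: DRvr_def DRvr_at_def P_def)
  have DRvp: "DRvp F R \<longleftrightarrow> (\<forall>p. P p \<longrightarrow> \<not> smallest_pos F R (of_nat p))" for F
    by (simp add: DRvp_def P_def)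
  have gdr: "gdr F R \<longleftrightarrow> (\<forall>p. P p \<longrightarrow> DRvr_at F p \<and> \<not> smallest_pos F R (of_nat p))" for F
    unfolding gdr_def DRvr DRvp by blast
  have 1: "gdr (ram_field K R) R \<longleftrightarrow> gdr K R"
    unfolding gdr using gdr_at_ram_field by (simp add: P_def)
  have "DRst F R \<Longrightarrow> DRvp F R" if "is_subfield F" for F
    unfolding DRst_iff DRvp P_def using DRst_at_smallest[OF _ _ that] by blast
  \<comment> \<open>Semitame is thus gdr together with (DRst), and both parts transfer.\<close>
  then have "semitame F R \<longleftrightarrow> gdr F R \<and> DRst F R" if "is_subfield F" for F
    using that by (auto simp: semitame_def gdr_def)
  moreover have "DRst (ram_field K R) R \<longleftrightarrow> DRst K R"
    unfolding DRst_iff using DRst_at_ram_field by blast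
  ultimately show ?thesis using 1 subfield_K ram_field_tower(1) by simp
qed

end
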